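(* The space-times which admit a null Killing-Yano tensor $A$ and which are pure radiation fields, $Ric=\sigma\,\ell\otimes\ell$ (with $\sigma$ a function, possibly zero, and $\ell$ the fundamental vector of $A$), are (locally) exactly the (generalized) pp-waves, i.e. the metrics $$ds^2=-2\,du\,dv-2H\,du^2+2\,d\xi\,d\bar\xi,\qquad H=H(u,\xi,\bar\xi)\ \text{real}.$$ Moreover, for such a space-time $\mathcal W=\psi\,\mathcal A\otimes\mathcal A$ for a complex function $\psi$, and if $A(d\psi)=*A(d\psi)=0$, then the space-time is a (generalized) plane wave, i.e. $H$ is quadratic in $\xi,\bar\xi$ (a polynomial of degree at most two in $\xi,\bar\xi$ with coefficients depending on $u$).
   Context: A space-time is an oriented 4-dimensional smooth manifold with metric $g$ of signature $(-,+,+,+)$ and volume element $\eta$; vectors and 1-forms are identified through $g$; all considerations are local. $\nabla$ is the Levi-Civita connection, $*$ the Hodge dual, $( *A)_{\alpha\beta}=\frac12\eta_{\alpha\beta\gamma\delta}A^{\gamma\delta}$, and the codifferential is $(\delta\omega)_{\underline p}=-\nabla_\alpha\omega^{\alpha}{}_{\underline p}$. $W$ is the Weyl tensor and $\mathcal W=\frac12(W-\mathrm i*W)$ its self-dual part. For a two-form $A$ and a 1-form $\tau$, $A(\tau)_\alpha=A_{\alpha\beta}\tau^\beta$. A Killing-Yano tensor is a real two-form $A$ with $\nabla_{(\alpha}A_{\beta)\gamma}=0$. For a real two-form $A$ put $\mathcal A=\frac1{\sqrt2}(A-\mathrm i*A)$. $A$ is null if $A\neq0$ and $\mathcal A_{\alpha\beta}\mathcal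 A^{\alpha\beta}=0$. Then $\mathcal A=\ell\wedge m$ with $\ell$ a real null vector (the fundamental vector of $A$) and $m$ a complex null vector with $(m,\ell)=0$, $(m,\bar m)=1$. *)

theory Defs
  imports "HOL-Analysis.Analysis"
begin

section \<open>Smooth functions\<close>

text \<open>\<open>smooth_on\<close> is meant for open sets: all derivatives are taken at full neighbourhoods.\<close>

primrec Ck_on :: "nat \<Rightarrow> 'a::euclidean_space set \<Rightarrow> ('a \<Rightarrow> 'b::real_normed_vector) \<Rightarrow> bool"
where
  "Ck_on 0 S f \<longleftrightarrow> continuous_on S f"
| "Ck_on (Suc k) S f \<longleftrightarrow>
     (\<forall>x\<in>S. f differentiable (at x)) \<and> (\<forall>v. Ck_on k S (\<lambda>x. frechet_derivative f (at x) v))"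

definition smooth_on :: "'a::euclidean_space set \<Rightarrow> ('a \<Rightarrow> 'b::real_normed_vector) \<Rightarrow> bool" where
  "smooth_on S f \<longleftrightarrow> (\<forall>k. Ck_on k S f)"

definition partial :: "4 \<Rightarrow> (real^4 \<Rightarrow> 'b::real_normed_vector) \<Rightarrow> real^4 \<Rightarrow> 'b" where
  "partial a f x = frechet_derivative f (at x) (axis a 1)"

section \<open>Space-times\<close>

text \<open>
  All considerations being local, a space-time is a coordinate domain \<open>U\<close>, an open subset of
  \<open>real^4\<close>. The fields are given by their components in these coordinates (all indices of
  type \<open>4\<close>) as total functions, of which only the values on \<open>U\<close> matter.
  The indices of vectors, one-forms and two-forms are kept covariant and are raised explicitly
  with \<open>ginv\<close>.
\<close>

definition minkowski :: "real^4^4" where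
  "minkowski = (\<chi> a b. if a = b then (if a = 1 then -1 else 1) else 0)"

definition lorentzian :: "real^4^4 \<Rightarrow> bool" where
  "lorentzian G \<longleftrightarrow> (\<exists>P. invertible P \<and> transpose P ** G ** P = minkowski)"

text \<open>
  Every 4-form on \<open>U\<close> is \<open>w\<close> times the Levi-Civita symbol; it is a volume element of
  \<open>g\<close> iff \<open>w\<^sup>2 = - det g\<close>. The sign of \<open>w\<close> is the orientation.
\<close>

definition spacetime :: "(real^4) set \<Rightarrow> (real^4 \<Rightarrow> real^4^4) \<Rightarrow> (real^4 \<Rightarrow> real) \<Rightarrow> bool" where
  "spacetime U g w \<longleftrightarrow>
     open U \<and> smooth_on U g \<and> (\<forall>x\<in>U. lorentzian (g x)) \<and>
     smooth_on U w \<and> (\<forall>x\<in>U. (w x)\<^sup>2 = - det (g x))"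

definition ginv :: "(real^4 \<Rightarrow> real^4^4) \<Rightarrow> real^4 \<Rightarrow> 4 \<Rightarrow> 4 \<Rightarrow> real" where
  "ginv g x a b = matrix_inv (g x) $ a $ b"

definition levi_civita :: "4 \<Rightarrow> 4 \<Rightarrow> 4 \<Rightarrow> 4 \<Rightarrow> real" where
  "levi_civita a b c d = det (vector [axis a 1, axis b 1, axis c 1, axis d 1] :: real^4^4)"

definition vol :: "(real^4 \<Rightarrow> real) \<Rightarrow> real^4 \<Rightarrow> 4 \<Rightarrow> 4 \<Rightarrow> 4 \<Rightarrow> 4 \<Rightarrow> real" where
  "vol w x a b c d = w x * levi_civita a b c d"

section \<open>Levi-Civita connection and curvature\<close>

text \<open>\<open>christoffel g x a b c\<close> is $\Gamma^a{}_{bc}$ and \<open>riemann_up g x a b c d\<close> is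
  $R^a{}_{bcd}$.\<close>

definition christoffel :: "(real^4 \<Rightarrow> real^4^4) \<Rightarrow> real^4 \<Rightarrow> 4 \<Rightarrow> 4 \<Rightarrow> 4 \<Rightarrow> real" where
  "christoffel g x a b c =
     (\<Sum>d\<in>UNIV. ginv g x a d *
        (partial b (\<lambda>y. g y $ d $ c) x + partial c (\<lambda>y. g y $ d $ b) x
          - partial d (\<lambda>y. g y $ b $ c) x)) / 2"

text \<open>\<open>nabla g A x c a b\<close> is $\nabla_c A_{ab}$.\<close>

definition nabla :: "(real^4 \<Rightarrow> real^4^4) \<Rightarrow> (real^4 \<Rightarrow> real^4^4) \<Rightarrow> real^4 \<Rightarrow> 4 \<Rightarrow> 4 \<Rightarrow> 4 \<Rightarrow> real" where
  "nabla g A x c a b =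
     partial c (\<lambda>y. A y $ a $ b) x
       - (\<Sum>d\<in>UNIV. christoffel g x d c a * A x $ d $ b)
       - (\<Sum>d\<in>UNIV. christoffel g x d c b * A x $ a $ d)"

definition riemann_up :: "(real^4 \<Rightarrow> real^4^4) \<Rightarrow> real^4 \<Rightarrow> 4 \<Rightarrow> 4 \<Rightarrow> 4 \<Rightarrow> 4 \<Rightarrow> real" where
  "riemann_up g x a b c d =
     partial c (\<lambda>y. christoffel g y a d b) x - partial d (\<lambda>y. christoffel g y a c b) x
       + (\<Sum>e\<in>UNIV. christoffel g x a c e * christoffel g x e d b
                   - christoffel g x a d e * christoffel g x e c b)"

definition riemann :: "(real^4 \<Rightarrow> real^4^4) \<Rightarrow> real^4 \<Rightarrow> 4 \<Rightarrow> 4 \<Rightarrow> 4 \<Rightarrow> 4 \<Rightarrow> real" where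
  "riemann g x a b c d = (\<Sum>e\<in>UNIV. g x $ a $ e * riemann_up g x e b c d)"

definition ricci :: "(real^4 \<Rightarrow> real^4^4) \<Rightarrow> real^4 \<Rightarrow> 4 \<Rightarrow> 4 \<Rightarrow> real" where
  "ricci g x b d = (\<Sum>a\<in>UNIV. riemann_up g x a b a d)"

definition scalar_curv :: "(real^4 \<Rightarrow> real^4^4) \<Rightarrow> real^4 \<Rightarrow> real" where
  "scalar_curv g x = (\<Sum>a\<in>UNIV. \<Sum>b\<in>UNIV. ginv g x a b * ricci g x a b)"

definition weyl :: "(real^4 \<Rightarrow> real^4^4) \<Rightarrow> real^4 \<Rightarrow> 4 \<Rightarrow> 4 \<Rightarrow> 4 \<Rightarrow> 4 \<Rightarrow> real" where
  "weyl g x a b c d =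
     riemann g x a b c d
       - (g x $ a $ c * ricci g x b d - g x $ a $ d * ricci g x b c
          + g x $ b $ d * ricci g x a c - g x $ b $ c * ricci g x a d) / 2
       + scalar_curv g x * (g x $ a $ c * g x $ b $ d - g x $ a $ d * g x $ b $ c) / 6"

section \<open>Duality\<close>

definition hodge ::
  "(real^4 \<Rightarrow> real^4^4) \<Rightarrow> (real^4 \<Rightarrow> real) \<Rightarrow> (real^4 \<Rightarrow> real^4^4) \<Rightarrow> real^4 \<Rightarrow> real^4^4"
where
  "hodge g w A x = (\<chi> a b.
     (\<Sum>c\<in>UNIV. \<Sum>d\<in>UNIV. vol w x a b c d *
        (\<Sum>e\<in>UNIV. \<Sum>f\<in>UNIV. ginv g x c e * ginv g x d f * A x $ e $ f)) / 2)"

definition weyl_dual ::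
  "(real^4 \<Rightarrow> real^4^4) \<Rightarrow> (real^4 \<Rightarrow> real) \<Rightarrow> real^4 \<Rightarrow> 4 \<Rightarrow> 4 \<Rightarrow> 4 \<Rightarrow> 4 \<Rightarrow> real"
where
  "weyl_dual g w x a b c d =
     (\<Sum>e\<in>UNIV. \<Sum>f\<in>UNIV. vol w x a b e f *
        (\<Sum>h\<in>UNIV. \<Sum>k\<in>UNIV. ginv g x e h * ginv g x f k * weyl g x h k c d)) / 2"

definition weyl_sd ::
  "(real^4 \<Rightarrow> real^4^4) \<Rightarrow> (real^4 \<Rightarrow> real) \<Rightarrow> real^4 \<Rightarrow> 4 \<Rightarrow> 4 \<Rightarrow> 4 \<Rightarrow> 4 \<Rightarrow> complex"
where
  "weyl_sd g w x a b c d =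
     (complex_of_real (weyl g x a b c d) - \<i> * complex_of_real (weyl_dual g w x a b c d)) / 2"

definition form_sd ::
  "(real^4 \<Rightarrow> real^4^4) \<Rightarrow> (real^4 \<Rightarrow> real) \<Rightarrow> (real^4 \<Rightarrow> real^4^4) \<Rightarrow> real^4 \<Rightarrow> complex^4^4"
where
  "form_sd g w A x = (\<chi> a b.
     (complex_of_real (A x $ a $ b) - \<i> * complex_of_real (hodge g w A x $ a $ b))
       / complex_of_real (sqrt 2))"

section \<open>Null Killing-Yano tensors\<close>

definition two_form_on :: "(real^4) set \<Rightarrow> (real^4 \<Rightarrow> real^4^4) \<Rightarrow> bool" where
  "two_form_on U A \<longleftrightarrow> smooth_on U A \<and> (\<forall>x\<in>U. \<forall>a b. A x $ a $ b = - (A x $ b $ a))"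

definition killing_yano :: "(real^4) set \<Rightarrow> (real^4 \<Rightarrow> real^4^4) \<Rightarrow> (real^4 \<Rightarrow> real^4^4) \<Rightarrow> bool" where
  "killing_yano U g A \<longleftrightarrow>
     two_form_on U A \<and> (\<forall>x\<in>U. \<forall>a b c. nabla g A x a b c + nabla g A x b a c = 0)"

definition null_form ::
  "(real^4) set \<Rightarrow> (real^4 \<Rightarrow> real^4^4) \<Rightarrow> (real^4 \<Rightarrow> real) \<Rightarrow> (real^4 \<Rightarrow> real^4^4) \<Rightarrow> bool"
where
  "null_form U g w A \<longleftrightarrow>
     (\<forall>x\<in>U. A x \<noteq> 0 \<and>
        (\<Sum>a\<in>UNIV. \<Sum>b\<in>UNIV. \<Sum>c\<in>UNIV. \<Sum>d\<in>UNIV.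
           complex_of_real (ginv g x a c * ginv g x b d)
             * form_sd g w A x $ a $ b * form_sd g w A x $ c $ d) = 0)"

definition null_killing_yano ::
  "(real^4) set \<Rightarrow> (real^4 \<Rightarrow> real^4^4) \<Rightarrow> (real^4 \<Rightarrow> real) \<Rightarrow> (real^4 \<Rightarrow> real^4^4) \<Rightarrow> bool"
where
  "null_killing_yano U g w A \<longleftrightarrow> killing_yano U g A \<and> null_form U g w A"

text \<open>The complex-bilinear extension of the metric to complex one-forms.\<close>

definition cinner_g :: "(real^4 \<Rightarrow> real^4^4) \<Rightarrow> real^4 \<Rightarrow> complex^4 \<Rightarrow> complex^4 \<Rightarrow> complex" where
  "cinner_g g x \<alpha> \<beta> = (\<Sum>a\<in>UNIV. \<Sum>b\<in>UNIV. complex_of_real (ginv g x a b) * \<alpha> $ a * \<beta> $ b)"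

text \<open>The fundamental vector of a null two-form at a point; it is unique up to sign.\<close>

definition fundamental_vector ::
  "(real^4 \<Rightarrow> real^4^4) \<Rightarrow> (real^4 \<Rightarrow> real) \<Rightarrow> (real^4 \<Rightarrow> real^4^4) \<Rightarrow> real^4 \<Rightarrow> real^4 \<Rightarrow> bool"
where
  "fundamental_vector g w A x l \<longleftrightarrow>
     (let L = (\<chi> a. complex_of_real (l $ a)) in
      \<exists>m :: complex^4.
        cinner_g g x L L = 0 \<and> cinner_g g x m m = 0 \<and> cinner_g g x m L = 0 \<and>
        cinner_g g x m (\<chi> a. cnj (m $ a)) = 1 \<and>
        (\<forall>a b. form_sd g w A x $ a $ b = L $ a * m $ b - L $ b * m $ a))"

text \<open>As \<open>l\<close> is unique up to sign, $\ell\otimes\ell$ is well defined; a choice of \<open>l\<close>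
  that is continuous on all of \<open>U\<close> need not exist and is not asked for.\<close>

definition pure_radiation ::
  "(real^4) set \<Rightarrow> (real^4 \<Rightarrow> real^4^4) \<Rightarrow> (real^4 \<Rightarrow> real) \<Rightarrow> (real^4 \<Rightarrow> real^4^4) \<Rightarrow> bool"
where
  "pure_radiation U g w A \<longleftrightarrow>
     (\<exists>\<sigma> l. smooth_on U \<sigma> \<and>
        (\<forall>x\<in>U. fundamental_vector g w A x (l x) \<and>
           (\<forall>a b. ricci g x a b = \<sigma> x * l x $ a * l x $ b)))"

text \<open>\<open>form_apply g B \<tau> x\<close> is $B(\tau)$ at \<open>x\<close>, extended complex-linearly in $\tau$.\<close>

definition form_apply ::
  "(real^4 \<Rightarrow> real^4^4) \<Rightarrow> (real^4 \<Rightarrow> real^4^4) \<Rightarrow> (real^4 \<Rightarrow> complex^4) \<Rightarrow> real^4 \<Rightarrow> complex^4"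
where
  "form_apply g B \<tau> x = (\<chi> a.
     \<Sum>b\<in>UNIV. \<Sum>c\<in>UNIV. complex_of_real (B x $ a $ b * ginv g x b c) * \<tau> x $ c)"

definition differential :: "(real^4 \<Rightarrow> complex) \<Rightarrow> real^4 \<Rightarrow> complex^4" where
  "differential \<psi> x = (\<chi> a. partial a \<psi> x)"

section \<open>pp-waves and plane waves\<close>

definition coordinates_on :: "(real^4) set \<Rightarrow> (real^4 \<Rightarrow> 'b::euclidean_space) \<Rightarrow> bool" where
  "coordinates_on V \<Phi> \<longleftrightarrow>
     open V \<and> inj_on \<Phi> V \<and> open (\<Phi> ` V) \<and> smooth_on V \<Phi> \<and> smooth_on (\<Phi> ` V) (inv_into V \<Phi>)"

text \<open>
  On \<open>V\<close>, in the coordinates \<open>u\<close>, \<open>v\<close>, \<open>\<xi>\<close>, the metric is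
  $-2\,du\,dv - 2H\,du^2 + 2\,d\xi\,d\bar\xi$, products being symmetrized:
  $2\,\alpha\,\beta$ has the components $\alpha_a\beta_b+\alpha_b\beta_a$.
\<close>

definition pp_wave_on ::
  "(real^4) set \<Rightarrow> (real^4 \<Rightarrow> real^4^4) \<Rightarrow> (real^4 \<Rightarrow> real) \<Rightarrow> (real^4 \<Rightarrow> real) \<Rightarrow> (real^4 \<Rightarrow> complex)
     \<Rightarrow> (real \<times> complex \<Rightarrow> real) \<Rightarrow> bool"
where
  "pp_wave_on V g u v \<xi> H \<longleftrightarrow>
     coordinates_on V (\<lambda>x. (u x, v x, \<xi> x)) \<and>
     smooth_on ((\<lambda>x. (u x, \<xi> x)) ` V) H \<and>
     (\<forall>x\<in>V. \<forall>a b. complex_of_real (g x $ a $ b) =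
        - complex_of_real (partial a u x * partial b v x + partial b u x * partial a v x)
        - complex_of_real (2 * H (u x, \<xi> x) * partial a u x * partial b u x)
        + (partial a \<xi> x * cnj (partial b \<xi> x) + partial b \<xi> x * cnj (partial a \<xi> x)))"

definition pp_wave_near :: "(real^4) set \<Rightarrow> (real^4 \<Rightarrow> real^4^4) \<Rightarrow> real^4 \<Rightarrow> bool" where
  "pp_wave_near U g p \<longleftrightarrow> (\<exists>V u v \<xi> H. p \<in> V \<and> V \<subseteq> U \<and> pp_wave_on V g u v \<xi> H)"

definition quadratic_on :: "(real \<times> complex) set \<Rightarrow> (real \<times> complex \<Rightarrow> real) \<Rightarrow> bool" where
  "quadratic_on D H \<longleftrightarrow>
     (\<exists>c0 c1 c2 c3 c4 c5 :: real \<Rightarrow> complex. \<forall>(s, z)\<in>D.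
        complex_of_real (H (s, z)) =
          c0 s + c1 s * z + c2 s * cnj z + c3 s * z\<^sup>2 + c4 s * z * cnj z + c5 s * (cnj z)\<^sup>2)"

definition plane_wave_near :: "(real^4) set \<Rightarrow> (real^4 \<Rightarrow> real^4^4) \<Rightarrow> real^4 \<Rightarrow> bool" where
  "plane_wave_near U g p \<longleftrightarrow>
     (\<exists>V u v \<xi> H. p \<in> V \<and> V \<subseteq> U \<and> pp_wave_on V g u v \<xi> H \<and>
        quadratic_on ((\<lambda>x. (u x, \<xi> x)) ` V) H)"

end

theory Submission
  imports Defs
begin

text \<open>
  In a null frame $\ell,n,p,q$ with $A=\ell\wedge p$ and $*A=\ell\wedge q$ the Killing-Yano equation is
  linear in the connection coefficients and leaves $\nabla\ell$ with a single coefficient $\kappa$.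
  The Ricci identity for $\ell$ shows that a Ricci tensor proportional to $\ell\otimes\ell$ forces
  $3\kappa^2=0$, so that $\ell$, $A$ and $*A$ are parallel. Hence $\ell=du$ locally, a null rotation
  makes $p=dx$ and $q=dy$ exact, and then $n=dv+H\,du$ with $H$ constant along $\ell$: these are the
  coordinates of a pp-wave. Conversely, in such a frame the Koszul formula yields the connection,
  the Ricci tensor $(H_{xx}+H_{yy})\,\ell\otimes\ell$ and
  $\psi=\frac12(H_{xx}-H_{yy})+\mathrm{i}H_{xy}$. The condition on $d\psi$ says that $\psi$ depends on
  $u$ alone; then $H_{xxy}=H_{xyy}=0$, therefore also $H_{xxx}=H_{xyy}=0$ and $H_{yyy}=H_{xxy}=0$.
\<close>

section \<open>Smooth functions\<close>

text \<open>The data are only pointwise: a fundamental vector exists at each point, up to sign, and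
  nothing links the choices at neighbouring points. The smooth frame has to be manufactured from g,
  A and the dual of A alone: a contraction of A with itself is the tensor square of l, which yields
  l up to sign, and p and q arise by inserting an auxiliary vector into A and into its dual. Taking
  q from the dual of A builds the orientation into the frame; in the converse direction, where the
  frame comes first, the orientation survives as a sign. One analytic fact does the integrations
  after u: a form whose exterior derivative is divisible by du is exact up to a multiple of du. For
  p and q this defect is the parameter of the null rotation; for n it is -H. The fact rests on a
  Poincare lemma with parameters on the slices u = const. The factor \<psi> is unique because A has
  a nonzero entry, so the factors found in varying charts glue.\<close>

lemmas diff_has_derivative = frechet_derivative_works[THEN iffD1]

lemma Ck_on_SucD:
  assumes "Ck_on (Suc k) S f" "x \<in> S"
  shows "(f has_derivative frechet_derivative f (at x)) (at x)"
proof (rule diff_has_derivative)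
  show "f differentiable (at x)" using assms by simp
qed

text \<open>On an open set a derivative is determined by the values on the set. Hence total
  functions may be exchanged off \<open>S\<close>, and later identities have to be verified on the
  coordinate domain only.\<close>

lemma Ck_on_cong:
  fixes f g :: "'a::euclidean_space \<Rightarrow> 'b::real_normed_vector"
  assumes "open S" "\<And>x. x \<in> S \<Longrightarrow> f x = g x" "Ck_on k S f"
  shows "Ck_on k S g"
  using assms(2,3)
proof (induction k arbitrary: f g)
  case 0
  then show ?case by (simp cong: continuous_on_cong)
next
  case (Suc k)
  have d: "(g has_derivative frechet_derivative f (at x)) (at x)" if "x \<in> S" for x
  proof (rule has_derivative_transform_within_open[OF _ assms(1) that Suc.prems(1)])
    show "(f has_derivative frechet_derivative f (at x)) (at x)"
      by (rule Ck_on_SucD[OF Suc.prems(2) that])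
  qed
  have e: "frechet_derivative f (at x) = frechet_derivative g (at x)" if "x \<in> S" for x
    using frechet_derivative_at[OF d[OF that]] .
  have "Ck_on k S (\<lambda>x. frechet_derivative g (at x) v)" for v
  proof (rule Suc.IH)
    show "Ck_on k S (\<lambda>x. frechet_derivative f (at x) v)" using Suc.prems(2) by simp
  qed (simp add: e)
  then show ?case using differentiableI[OF d] by simp
qed

text \<open>Replaces \<open>frechet_derivative\<close> in the induction step by any explicitly known
  derivative, so that smoothness of a composite can be read off from its differentiation
  rule.\<close>

lemma Ck_on_SucI:
  assumes "open S" and d: "\<And>x. x \<in> S \<Longrightarrow> (f has_derivative f' x) (at x)" and c: "\<And>v. Ck_on k S (\<lambda>x. f' x v)"
  shows "Ck_on (Suc k) S f"
proof -
  have "Ck_on k S (\<lambda>x. frechet_derivative f (at x) v)" for v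
  proof (rule Ck_on_cong[OF assms(1) _ c[of v]])
    show "f' x v = frechet_derivative f (at x) v" if "x \<in> S" for x
      using frechet_derivative_at[OF d[OF that]] by (rule fun_cong)
  qed
  moreover have "\<forall>x\<in>S. f differentiable (at x)"
    using differentiableI[OF d] by simp
  ultimately show ?thesis by simp
qed

lemma Ck_on_dec: "Ck_on (Suc k) S f \<Longrightarrow> Ck_on k S f"
proof (induction k arbitrary: f)
  case 0
  then have "f differentiable (at x)" if "x \<in> S" for x using that by simp
  then show ?case
    by (simp add: continuous_at_imp_continuous_on differentiable_imp_continuous_within)
next
  case (Suc k)
  have "Ck_on k S (\<lambda>x. frechet_derivative f (at x) v)" for v
    using Suc.prems by (intro Suc.IH) simp
  moreover have "\<forall>x\<in>S. f differentiable (at x)" using Suc.prems by simp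
  ultimately show ?case by simp
qed
lemma Ck_on_continuous: "Ck_on k S f \<Longrightarrow> continuous_on S f"
proof (induction k)
  case (Suc k)
  then show ?case using Ck_on_dec[OF Suc.prems] by simp
qed simp

lemma Ck_on_subset: "Ck_on k S f \<Longrightarrow> T \<subseteq> S \<Longrightarrow> Ck_on k T f"
  by (induction k arbitrary: f) (auto intro: continuous_on_subset)

lemma Ck_on_const [simp]: "Ck_on k S (\<lambda>x. c)"
  by (induction k arbitrary: c) auto

lemma Ck_on_add:
  assumes "open S" "Ck_on k S f" "Ck_on k S g"
  shows "Ck_on k S (\<lambda>x. f x + g x)"
  using assms
proof (induction k arbitrary: f g)
  case 0
  then show ?case by (auto intro: continuous_intros)
next
  case (Suc k)
  show ?case
    by (rule Ck_on_SucI[OF Suc.prems(1) has_derivative_add[OF Ck_on_SucD Ck_on_SucD]])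
      (use Suc in auto)
qed

lemma Ck_on_bounded_linear:
  assumes "bounded_linear L" "open S" "Ck_on k S f"
  shows "Ck_on k S (\<lambda>x. L (f x))"
  using assms(2,3)
proof (induction k arbitrary: f)
  case 0
  then show ?case using assms(1) by (auto intro: bounded_linear.continuous_on)
next
  case (Suc k)
  show ?case
    by (rule Ck_on_SucI[OF Suc.prems(1) bounded_linear.has_derivative[OF assms(1) Ck_on_SucD]])
      (use Suc in auto)
qed

lemma Ck_on_id: "bounded_linear L \<Longrightarrow> open S \<Longrightarrow> Ck_on k S L"
proof (cases k)
  case 0
  then show "bounded_linear L \<Longrightarrow> ?thesis" by (simp add: linear_continuous_on)
next
  case (Suc m)
  then show "bounded_linear L \<Longrightarrow> open S \<Longrightarrow> ?thesis"
    unfolding Suc by (intro Ck_on_SucI[where f'="\<lambda>x. L"]) (auto intro: bounded_linear_imp_has_derivative)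
qed

lemma Ck_on_bilinear:
  assumes "bounded_bilinear B" "open S" "Ck_on k S f" "Ck_on k S g"
  shows "Ck_on k S (\<lambda>x. B (f x) (g x))"
  using assms(2-)
proof (induction k arbitrary: f g)
  case 0
  then show ?case using assms(1) by (auto intro: bounded_bilinear.continuous_on)
next
  case (Suc k)
  note dec = Suc.prems(2,3)[THEN Ck_on_dec]
  have "Ck_on k S (\<lambda>x. B (f x) (frechet_derivative g (at x) v) + B (frechet_derivative f (at x) v) (g x))" for v
    using Suc.prems(2,3) by (intro Ck_on_add Suc.IH Suc.prems(1) dec) auto
  note c = this
  show ?case
    by (rule Ck_on_SucI[OF Suc.prems(1) bounded_bilinear.FDERIV[OF assms(1) Ck_on_SucD Ck_on_SucD] c])
      (use Suc.prems in auto)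
qed

lemma Ck_on_sum:
  assumes "open S" "\<And>i. i \<in> I \<Longrightarrow> Ck_on k S (f i)"
  shows "Ck_on k S (\<lambda>x. \<Sum>i\<in>I. f i x)"
  using assms(2)
  by (induction I rule: infinite_finite_induct) (auto intro: Ck_on_add[OF assms(1)])

lemma Ck_on_prod:
  fixes f :: "'i \<Rightarrow> 'a::euclidean_space \<Rightarrow> real"
  assumes "open S" "\<And>i. i \<in> I \<Longrightarrow> Ck_on k S (f i)"
  shows "Ck_on k S (\<lambda>x. \<Prod>i\<in>I. f i x)"
  using assms(2)
  by (induction I rule: infinite_finite_induct) (auto intro: Ck_on_bilinear[OF bounded_bilinear_mult assms(1)])

text \<open>In the chain rule the inner derivative sits in the argument of a linear map that itself
  varies with the point. Expanding this argument in \<open>Basis\<close> gives a finite sum of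
  products of a scalar and a fixed directional derivative of \<open>f\<close>, to which the
  induction hypothesis applies.\<close>

lemma Ck_on_compose:
  fixes f :: "'b::euclidean_space \<Rightarrow> 'c::real_normed_vector" and g :: "'a::euclidean_space \<Rightarrow> 'b"
  assumes "open S" "Ck_on k S g" "Ck_on k T f" "g ` S \<subseteq> T"
  shows "Ck_on k S (\<lambda>x. f (g x))"
  using assms
proof (induction k arbitrary: f)
  case 0
  then show ?case by (auto intro: continuous_on_compose2)
next
  case (Suc k)
  note dec = Suc.prems(2)[THEN Ck_on_dec]
  have d: "((\<lambda>x. f (g x)) has_derivative
      (\<lambda>v. \<Sum>b\<in>Basis. (frechet_derivative g (at x) v \<bullet> b) *\<^sub>R frechet_derivative f (at (g x)) b)) (at x)"
    if "x \<in> S" for x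
  proof -
    have f: "(f has_derivative frechet_derivative f (at (g x))) (at (g x))"
      by (rule Ck_on_SucD[OF Suc.prems(3)]) (use Suc.prems(4) that in auto)
    then interpret f: bounded_linear "frechet_derivative f (at (g x))"
      by (rule has_derivative_bounded_linear)
    have "frechet_derivative f (at (g x)) v
        = (\<Sum>b\<in>Basis. (v \<bullet> b) *\<^sub>R frechet_derivative f (at (g x)) b)" for v
      using arg_cong[OF euclidean_representation[of v], of "frechet_derivative f (at (g x))"]
      by (simp add: f.sum f.scaleR)
    then show ?thesis
      by (intro has_derivative_eq_rhs[OF has_derivative_compose[OF Ck_on_SucD[OF Suc.prems(2) that] f]] ext)
  qed
  have c: "Ck_on k S (\<lambda>x. \<Sum>b\<in>Basis. (frechet_derivative g (at x) v \<bullet> b) *\<^sub>R frechet_derivative f (at (g x)) b)"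
      for v
  proof (intro Ck_on_sum[OF Suc.prems(1)] Ck_on_bilinear[OF bounded_bilinear_scaleR Suc.prems(1)])
    fix b :: 'b
    show "Ck_on k S (\<lambda>x. frechet_derivative g (at x) v \<bullet> b)"
      using Suc.prems(2) by (intro Ck_on_bounded_linear[OF bounded_linear_inner_left Suc.prems(1)]) simp
    show "Ck_on k S (\<lambda>x. frechet_derivative f (at (g x)) b)"
      using Suc.IH[of "\<lambda>y. frechet_derivative f (at y) b"] Suc.prems dec by simp
  qed
  show ?case by (rule Ck_on_SucI[OF Suc.prems(1) d c])
qed

text \<open>The derivative is a product of the derivative of \<open>f\<close> with two copies of the
  function under consideration, so the induction on \<open>k\<close> feeds itself.\<close>

lemma Ck_on_inverse:
  fixes f :: "'a::euclidean_space \<Rightarrow> real"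
  assumes "open S" "Ck_on k S f" "\<And>x. x \<in> S \<Longrightarrow> f x \<noteq> 0"
  shows "Ck_on k S (\<lambda>x. inverse (f x))"
  using assms
proof (induction k)
  case 0
  then show ?case by (auto intro: continuous_intros)
next
  case (Suc k)
  note dec = Suc.prems(2)[THEN Ck_on_dec]
  have d: "((\<lambda>x. inverse (f x)) has_derivative
      (\<lambda>v. - (inverse (f x) * frechet_derivative f (at x) v * inverse (f x)))) (at x)" if "x \<in> S" for x
    using Suc.prems that by (intro Deriv.has_derivative_inverse Ck_on_SucD) auto
  have "Ck_on k S (\<lambda>x. - (inverse (f x) * frechet_derivative f (at x) v * inverse (f x)))" for v
    using Suc dec by (intro Ck_on_bilinear[OF bounded_bilinear_mult] Ck_on_bounded_linear[OF
        bounded_linear_minus[OF bounded_linear_ident]]) auto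
  note c = this
  show ?case by (rule Ck_on_SucI[OF Suc.prems(1) d c])
qed

text \<open>The derivative involves the reciprocal of the root, so the induction runs through
  \<open>Ck_on_inverse\<close>.\<close>

lemma Ck_on_sqrt:
  fixes f :: "'a::euclidean_space \<Rightarrow> real"
  assumes "open S" "Ck_on k S f" "\<And>x. x \<in> S \<Longrightarrow> f x > 0"
  shows "Ck_on k S (\<lambda>x. sqrt (f x))"
  using assms
proof (induction k)
  case 0
  then show ?case by (auto intro: continuous_intros)
next
  case (Suc k)
  note dec = Suc.prems(2)[THEN Ck_on_dec]
  have d: "((\<lambda>x. sqrt (f x)) has_derivative
      (\<lambda>v. frechet_derivative f (at x) v * (inverse (sqrt (f x)) / 2))) (at x)" if "x \<in> S" for x
    using Suc.prems that by (intro has_derivative_real_sqrt Ck_on_SucD) auto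
  have s: "Ck_on k S (\<lambda>x. inverse (sqrt (f x)))"
    using Suc.prems dec by (intro Ck_on_inverse Suc.IH) (auto simp: less_imp_neq[symmetric])
  have "Ck_on k S (\<lambda>x. frechet_derivative f (at x) v * (inverse (sqrt (f x)) / 2))" for v
    using Suc s by (intro Ck_on_bilinear[OF bounded_bilinear_mult] Ck_on_bounded_linear[OF
        bounded_linear_divide]) auto
  note c = this
  show ?case by (rule Ck_on_SucI[OF Suc.prems(1) d c])
qed

lemma smooth_onI: "(\<And>k. Ck_on k S f) \<Longrightarrow> smooth_on S f"
  by (simp add: smooth_on_def)

lemma smooth_onD: "smooth_on S f \<Longrightarrow> Ck_on k S f"
  by (simp add: smooth_on_def)

lemma smooth_on_differentiable: "smooth_on S f \<Longrightarrow> x \<in> S \<Longrightarrow> f differentiable (at x)"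
  using smooth_onD[of S f "Suc 0"] by simp

lemma smooth_on_has_derivative:
  "smooth_on S f \<Longrightarrow> x \<in> S \<Longrightarrow> (f has_derivative frechet_derivative f (at x)) (at x)"
  by (intro diff_has_derivative smooth_on_differentiable)

lemma smooth_on_continuous: "smooth_on S f \<Longrightarrow> continuous_on S f"
  by (rule Ck_on_continuous[OF smooth_onD[where k=0]])

lemma smooth_on_frechet: "smooth_on S f \<Longrightarrow> smooth_on S (\<lambda>x. frechet_derivative f (at x) v)"
proof (rule smooth_onI)
  show "Ck_on k S (\<lambda>x. frechet_derivative f (at x) v)" if "smooth_on S f" for k
    using smooth_onD[OF that, of "Suc k"] by simp
qed

lemma smooth_on_cong:
  assumes "open S" "\<And>x. x \<in> S \<Longrightarrow> f x = g x"
  shows "smooth_on S f \<longleftrightarrow> smooth_on S g"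
  using assms by (auto simp: smooth_on_def intro: Ck_on_cong[of S f g] Ck_on_cong[of S g f])

lemma smooth_on_subset: "smooth_on S f \<Longrightarrow> T \<subseteq> S \<Longrightarrow> smooth_on T f"
  by (auto simp: smooth_on_def intro: Ck_on_subset)

text \<open>Serves to glue: the factor of the Weyl tensor is known to be smooth only near each
  point, in charts that vary with the point.\<close>

lemma Ck_on_local:
  assumes "\<And>x. x \<in> S \<Longrightarrow> \<exists>T. open T \<and> x \<in> T \<and> Ck_on k T f"
  shows "Ck_on k S f"
  using assms
proof (induction k arbitrary: f)
  case 0
  have "isCont f x" if "x \<in> S" for x
    using 0[OF that] by (auto simp: continuous_on_eq_continuous_at)
  then show ?case by (simp add: continuous_at_imp_continuous_on)
next
  case (Suc k)
  have d: "f differentiable at x" if "x \<in> S" for x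
    using Suc.prems[OF that] by auto
  have "Ck_on k S (\<lambda>x. frechet_derivative f (at x) v)" for v
  proof (rule Suc.IH)
    fix x assume "x \<in> S"
    then obtain T where "open T" "x \<in> T" "Ck_on (Suc k) T f" using Suc.prems by metis
    then show "\<exists>T. open T \<and> x \<in> T \<and> Ck_on k T (\<lambda>x. frechet_derivative f (at x) v)"
      by (intro exI[of _ T]) simp
  qed
  with d show ?case by simp
qed

lemma smooth_on_local:
  assumes "\<And>x. x \<in> S \<Longrightarrow> \<exists>T. open T \<and> x \<in> T \<and> smooth_on T f"
  shows "smooth_on S f"
proof (intro smooth_onI Ck_on_local)
  fix k x assume "x \<in> S"
  then obtain T where "open T" "x \<in> T" "smooth_on T f" using assms by metis
  then show "\<exists>T. open T \<and> x \<in> T \<and> Ck_on k T f" using smooth_onD[of T f k] by metis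
qed

lemma smooth_on_const: "smooth_on S (\<lambda>x. c)"
  by (simp add: smooth_on_def)

lemma smooth_on_linear: "bounded_linear L \<Longrightarrow> open S \<Longrightarrow> smooth_on S L"
  by (simp add: smooth_on_def Ck_on_id)

lemma smooth_on_bounded_linear:
  "bounded_linear L \<Longrightarrow> open S \<Longrightarrow> smooth_on S f \<Longrightarrow> smooth_on S (\<lambda>x. L (f x))"
  by (simp add: smooth_on_def Ck_on_bounded_linear)

lemma smooth_on_add: "open S \<Longrightarrow> smooth_on S f \<Longrightarrow> smooth_on S g \<Longrightarrow> smooth_on S (\<lambda>x. f x + g x)"
  by (simp add: smooth_on_def Ck_on_add)

lemma smooth_on_bilinear:
  "bounded_bilinear B \<Longrightarrow> open S \<Longrightarrow> smooth_on S f \<Longrightarrow> smooth_on S g \<Longrightarrow> smooth_on S (\<lambda>x. B (f x) (g x))"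
  by (simp add: smooth_on_def Ck_on_bilinear)

lemma smooth_on_mult:
  fixes f g :: "'a::euclidean_space \<Rightarrow> 'b::real_normed_algebra"
  shows "open S \<Longrightarrow> smooth_on S f \<Longrightarrow> smooth_on S g \<Longrightarrow> smooth_on S (\<lambda>x. f x * g x)"
  by (rule smooth_on_bilinear[OF bounded_bilinear_mult])

lemma smooth_on_minus: "open S \<Longrightarrow> smooth_on S f \<Longrightarrow> smooth_on S (\<lambda>x. - f x)"
  by (rule smooth_on_bounded_linear[OF bounded_linear_minus[OF bounded_linear_ident]])

lemma smooth_on_diff: "open S \<Longrightarrow> smooth_on S f \<Longrightarrow> smooth_on S g \<Longrightarrow> smooth_on S (\<lambda>x. f x - g x)"
  using smooth_on_add[of S f "\<lambda>x. - g x"] smooth_on_minus[of S g] by simp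

lemma smooth_on_sum:
  "open S \<Longrightarrow> (\<And>i. i \<in> I \<Longrightarrow> smooth_on S (f i)) \<Longrightarrow> smooth_on S (\<lambda>x. \<Sum>i\<in>I. f i x)"
  by (simp add: smooth_on_def Ck_on_sum)

lemma smooth_on_inverse:
  fixes f :: "'a::euclidean_space \<Rightarrow> real"
  shows "open S \<Longrightarrow> smooth_on S f \<Longrightarrow> (\<And>x. x \<in> S \<Longrightarrow> f x \<noteq> 0) \<Longrightarrow> smooth_on S (\<lambda>x. inverse (f x))"
  by (simp add: smooth_on_def Ck_on_inverse)

lemma smooth_on_divide:
  fixes f :: "'a::euclidean_space \<Rightarrow> real"
  shows "open S \<Longrightarrow> smooth_on S f \<Longrightarrow> smooth_on S g \<Longrightarrow> (\<And>x. x \<in> S \<Longrightarrow> g x \<noteq> 0) \<Longrightarrow>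
    smooth_on S (\<lambda>x. f x / g x)"
  unfolding divide_inverse by (intro smooth_on_mult smooth_on_inverse)

lemma smooth_on_sqrt:
  fixes f :: "'a::euclidean_space \<Rightarrow> real"
  shows "open S \<Longrightarrow> smooth_on S f \<Longrightarrow> (\<And>x. x \<in> S \<Longrightarrow> f x > 0) \<Longrightarrow> smooth_on S (\<lambda>x. sqrt (f x))"
  by (simp add: smooth_on_def Ck_on_sqrt)

lemma smooth_on_compose:
  fixes f :: "'b::euclidean_space \<Rightarrow> 'c::real_normed_vector" and g :: "'a::euclidean_space \<Rightarrow> 'b"
  assumes "open S" "smooth_on S g" "smooth_on T f" "g ` S \<subseteq> T"
  shows "smooth_on S (\<lambda>x. f (g x))"
  by (rule smooth_onI) (rule Ck_on_compose[OF assms(1) smooth_onD[OF assms(2)] smooth_onD[OF assms(3)] assms(4)])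

lemma smooth_on_partial: "smooth_on S f \<Longrightarrow> smooth_on S (partial a f)"
  unfolding partial_def[abs_def] by (rule smooth_on_frechet)

lemma smooth_on_euclidean:
  fixes f :: "'a::euclidean_space \<Rightarrow> 'b::euclidean_space"
  assumes "open S" "\<And>b. b \<in> Basis \<Longrightarrow> smooth_on S (\<lambda>x. f x \<bullet> b)"
  shows "smooth_on S f"
proof -
  have "smooth_on S (\<lambda>x. \<Sum>b\<in>Basis. (f x \<bullet> b) *\<^sub>R b)"
    using assms by (intro smooth_on_sum smooth_on_bilinear[OF bounded_bilinear_scaleR] smooth_on_const)
  then show ?thesis by (simp add: euclidean_representation)
qed

lemma smooth_on_nth: "open S \<Longrightarrow> smooth_on S f \<Longrightarrow> smooth_on S (\<lambda>x. f x $ a)"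
  by (rule smooth_on_bounded_linear[OF bounded_linear_vec_nth])

lemma smooth_on_vec:
  fixes f :: "'a::euclidean_space \<Rightarrow> 'b::euclidean_space^'n"
  assumes "open S" "\<And>a. smooth_on S (\<lambda>x. f x $ a)"
  shows "smooth_on S f"
proof (rule smooth_on_euclidean[OF assms(1)])
  fix b :: "'b^'n" assume "b \<in> Basis"
  then obtain i c where "b = axis i c" by (auto simp: Basis_vec_def)
  then show "smooth_on S (\<lambda>x. f x \<bullet> b)"
    using smooth_on_bounded_linear[OF bounded_linear_inner_left assms(1) assms(2)[of i], of c]
    by (simp add: inner_axis)
qed

lemma smooth_on_Pair:
  fixes f :: "'a::euclidean_space \<Rightarrow> 'b::euclidean_space" and g :: "'a \<Rightarrow> 'c::euclidean_space"
  assumes "open S" "smooth_on S f" "smooth_on S g"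
  shows "smooth_on S (\<lambda>x. (f x, g x))"
proof (rule smooth_on_euclidean[OF assms(1)])
  fix b :: "'b \<times> 'c"
  show "smooth_on S (\<lambda>x. (f x, g x) \<bullet> b)"
    unfolding inner_prod_def fst_conv snd_conv
    by (intro smooth_on_add smooth_on_bounded_linear[OF bounded_linear_inner_left] assms)
qed

lemma smooth_on_Complex:
  fixes f g :: "'a::euclidean_space \<Rightarrow> real"
  assumes "open S" "smooth_on S f" "smooth_on S g"
  shows "smooth_on S (\<lambda>x. Complex (f x) (g x))"
proof (rule smooth_on_euclidean[OF assms(1)])
  fix b :: complex
  show "smooth_on S (\<lambda>x. Complex (f x) (g x) \<bullet> b)"
    unfolding inner_complex_def complex.sel
    by (intro smooth_on_add smooth_on_mult smooth_on_const assms)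
qed

lemmas smooth_intros = smooth_on_const smooth_on_add smooth_on_mult smooth_on_minus smooth_on_diff
  smooth_on_sum smooth_on_partial

section \<open>Partial derivatives\<close>

lemma partial_eqI: "(f has_derivative f') (at x) \<Longrightarrow> partial a f x = f' (axis a 1)"
  unfolding partial_def using frechet_derivative_at[of f f' x] by simp

lemma partial_cong:
  assumes "open S" "x \<in> S" "\<And>y. y \<in> S \<Longrightarrow> f y = g y"
  shows "partial a f x = partial a g x"
proof -
  have "(f has_derivative D) (at x) \<longleftrightarrow> (g has_derivative D) (at x)" for D
  proof
    show "(g has_derivative D) (at x)" if "(f has_derivative D) (at x)"
      by (rule has_derivative_transform_within_open[OF that assms(1,2)]) (rule assms(3))
    show "(f has_derivative D) (at x)" if "(g has_derivative D) (at x)"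
      by (rule has_derivative_transform_within_open[OF that assms(1,2)]) (rule assms(3)[symmetric])
  qed
  then show ?thesis by (simp only: partial_def frechet_derivative_def)
qed

lemma partial_const [simp]: "partial a (\<lambda>x. c) x = 0"
  by (simp add: partial_def)

lemma partial_add:
  assumes "f differentiable at x" "g differentiable at x"
  shows "partial a (\<lambda>x. f x + g x) x = partial a f x + partial a g x"
  using partial_eqI[OF has_derivative_add[OF assms[THEN diff_has_derivative]]] by (simp add: partial_def)

lemma partial_diff:
  assumes "f differentiable at x" "g differentiable at x"
  shows "partial a (\<lambda>x. f x - g x) x = partial a f x - partial a g x"
  using partial_eqI[OF has_derivative_diff[OF assms[THEN diff_has_derivative]]] by (simp add: partial_def)

lemma partial_mult:
  fixes f g :: "real^4 \<Rightarrow> 'b::real_normed_algebra"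
  assumes "f differentiable at x" "g differentiable at x"
  shows "partial a (\<lambda>x. f x * g x) x = partial a f x * g x + f x * partial a g x"
  using partial_eqI[OF has_derivative_mult[OF assms[THEN diff_has_derivative]]]
  by (simp add: partial_def add.commute)

lemma partial_sum:
  assumes "\<And>i. i \<in> I \<Longrightarrow> f i differentiable at x"
  shows "partial a (\<lambda>x. \<Sum>i\<in>I. f i x) x = (\<Sum>i\<in>I. partial a (f i) x)"
  using partial_eqI[OF has_derivative_sum[OF assms[THEN diff_has_derivative]]] by (simp add: partial_def)

lemma partial_bounded_linear:
  assumes "bounded_linear L" "f differentiable at x"
  shows "partial a (\<lambda>x. L (f x)) x = L (partial a f x)"
  using partial_eqI[OF bounded_linear.has_derivative[OF assms(1) diff_has_derivative[OF assms(2)]]]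
  by (simp add: partial_def)

lemma frechet_partial:
  fixes f :: "real^4 \<Rightarrow> 'b::real_normed_vector"
  assumes "f differentiable at x"
  shows "frechet_derivative f (at x) v = (\<Sum>a\<in>UNIV. v $ a *\<^sub>R partial a f x)"
proof -
  interpret bounded_linear "frechet_derivative f (at x)"
    using diff_has_derivative[OF assms] by (rule has_derivative_bounded_linear)
  have "v = (\<Sum>a\<in>UNIV. v $ a *\<^sub>R axis a 1)"
    using basis_expansion[of v] by (simp add: scalar_mult_eq_scaleR)
  from arg_cong[OF this, of "frechet_derivative f (at x)"] show ?thesis
    by (simp add: partial_def sum scaleR)
qed

lemma has_derivative_partial:
  fixes f :: "real^4 \<Rightarrow> 'b::real_normed_vector"
  assumes "f differentiable at x"
  shows "(f has_derivative (\<lambda>v. \<Sum>a\<in>UNIV. v $ a *\<^sub>R partial a f x)) (at x)"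
proof -
  have "frechet_derivative f (at x) = (\<lambda>v. \<Sum>a\<in>UNIV. v $ a *\<^sub>R partial a f x)"
    using frechet_partial[OF assms] by (rule ext)
  then show ?thesis using diff_has_derivative[OF assms] by simp
qed

lemma partial_compose:
  fixes f :: "real^4 \<Rightarrow> 'b::real_normed_vector" and g :: "real^4 \<Rightarrow> real^4"
  assumes "f differentiable at (g x)" "g differentiable at x"
  shows "partial a (\<lambda>x. f (g x)) x = (\<Sum>b\<in>UNIV. partial a (\<lambda>y. g y $ b) x *\<^sub>R partial b f (g x))"
proof -
  have "partial a (\<lambda>x. f (g x)) x = frechet_derivative f (at (g x)) (partial a g x)"
    using partial_eqI[OF has_derivative_compose[OF diff_has_derivative[OF assms(2)] diff_has_derivative[OF assms(1)]]] by (simp add: partial_def)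
  then show ?thesis
    by (simp only: frechet_partial[OF assms(1)] partial_bounded_linear[OF bounded_linear_vec_nth assms(2)])
qed

lemma line_derivative:
  fixes f :: "real^4 \<Rightarrow> real"
  assumes "f differentiable (at (p + s *\<^sub>R axis a 1))"
  shows "((\<lambda>s. f (p + s *\<^sub>R axis a 1)) has_real_derivative partial a f (p + s *\<^sub>R axis a 1)) (at s)"
proof -
  interpret bounded_linear "frechet_derivative f (at (p + s *\<^sub>R axis a 1))"
    using diff_has_derivative[OF assms] by (rule has_derivative_bounded_linear)
  have "((\<lambda>s. p + s *\<^sub>R axis a 1) has_derivative (\<lambda>s. s *\<^sub>R axis a 1)) (at s)"
    by (auto intro!: derivative_eq_intros)
  from has_derivative_compose[OF this diff_has_derivative[OF assms]]
  have "((\<lambda>s. f (p + s *\<^sub>R axis a 1)) has_derivative (\<lambda>s. s * partial a f (p + s' *\<^sub>R axis a 1))) (at s)"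
    if "s' = s" for s'
    by (simp add: scaleR partial_def that)
  then show ?thesis
    by (simp add: has_field_derivative_def mult_commute_abs)
qed

text \<open>The mean value theorem is used twice: for the increment of \<open>f\<close> in direction
  \<open>b\<close> as a function of the \<open>a\<close>-coordinate, then for
  \<open>partial a f\<close> along \<open>b\<close>. The second difference is symmetric in
  \<open>a\<close> and \<open>b\<close>, which forces the mixed derivatives to agree in the
  limit.\<close>

lemma second_difference:
  fixes f :: "real^4 \<Rightarrow> real"
  assumes f: "smooth_on (ball x r) f" and h: "0 < h" "2 * h < r"
  obtains y where "norm (y - x) < 2 * h"
    "f (x + h *\<^sub>R axis a 1 + h *\<^sub>R axis b 1) - f (x + h *\<^sub>R axis a 1) - f (x + h *\<^sub>R axis b 1) + f x
      = h * h * partial b (partial a f) y"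
proof -
  have n: "norm (s *\<^sub>R axis a (1::real) + t *\<^sub>R axis b 1 :: real^4) \<le> s + t" if "0 \<le> s" "0 \<le> t" for s t
    using norm_triangle_ineq[of "s *\<^sub>R axis a 1 :: real^4" "t *\<^sub>R axis b 1"] that
    by (simp add: norm_axis_1)
  have B: "x + s *\<^sub>R axis a 1 + t *\<^sub>R axis b 1 \<in> ball x r" if "0 \<le> s" "s \<le> h" "0 \<le> t" "t \<le> h" for s t
  proof -
    have "dist x (x + v) = norm v" for v :: "real^4" by (simp add: dist_norm)
    then show ?thesis using n[of s t] that h by (simp add: add.assoc)
  qed
  let ?G = "\<lambda>s. f (x + h *\<^sub>R axis b 1 + s *\<^sub>R axis a 1) - f (x + s *\<^sub>R axis a 1)"
  let ?G' = "\<lambda>s. partial a f (x + h *\<^sub>R axis b 1 + s *\<^sub>R axis a 1) - partial a f (x + s *\<^sub>R axis a 1)"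
  have G: "(?G has_real_derivative ?G' s) (at s)" if "0 \<le> s" "s \<le> h" for s
    using B[OF that, of h] B[OF that, of 0] h
    by (intro DERIV_diff line_derivative smooth_on_differentiable[OF f]) (auto simp: ac_simps)
  obtain s where s: "0 < s" "s < h" and 1: "?G h - ?G 0 = (h - 0) * ?G' s"
    using MVT2[OF h(1) G] by metis
  let ?K = "\<lambda>t. partial a f (x + s *\<^sub>R axis a 1 + t *\<^sub>R axis b 1)"
  let ?K' = "\<lambda>t. partial b (partial a f) (x + s *\<^sub>R axis a 1 + t *\<^sub>R axis b 1)"
  have K: "(?K has_real_derivative ?K' t) (at t)" if "0 \<le> t" "t \<le> h" for t
    using B[of s t] that s
    by (intro line_derivative smooth_on_differentiable[OF smooth_on_partial[OF f]]) auto
  obtain t where t: "0 < t" "t < h" and 2: "?K h - ?K 0 = (h - 0) * ?K' t"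
    using MVT2[OF h(1) K] by metis
  show thesis
  proof (rule that)
    show "norm (x + s *\<^sub>R axis a 1 + t *\<^sub>R axis b 1 - x) < 2 * h"
      using n[of s t] s t by (simp add: add.assoc)
    show "f (x + h *\<^sub>R axis a 1 + h *\<^sub>R axis b 1) - f (x + h *\<^sub>R axis a 1) - f (x + h *\<^sub>R axis b 1) + f x
      = h * h * ?K' t"
      using 1 2 by (simp add: ac_simps)
  qed
qed

lemma partial_commute:
  fixes f :: "real^4 \<Rightarrow> real"
  assumes "open S" "smooth_on S f" "x \<in> S"
  shows "partial a (partial b f) x = partial b (partial a f) x"
proof (rule ccontr)
  assume "partial a (partial b f) x \<noteq> partial b (partial a f) x"
  \<comment> \<open>Half of the supposed gap: values within \<open>e\<close> of the two derivatives
    cannot coincide.\<close>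
  define e where "e = \<bar>partial a (partial b f) x - partial b (partial a f) x\<bar> / 2"
  then have e: "e > 0" using \<open>_ \<noteq> _\<close> by simp
  have "isCont (partial a (partial b f)) x" "isCont (partial b (partial a f)) x"
    using smooth_on_continuous[OF smooth_on_partial[OF smooth_on_partial[OF assms(2)]]] assms(1,3)
    by (simp_all add: continuous_on_eq_continuous_at)
  then obtain d1 d2 where d: "d1 > 0" "d2 > 0"
    and d1: "\<And>y. dist y x < d1 \<Longrightarrow> \<bar>partial a (partial b f) y - partial a (partial b f) x\<bar> < e"
    and d2: "\<And>y. dist y x < d2 \<Longrightarrow> \<bar>partial b (partial a f) y - partial b (partial a f) x\<bar> < e"
    using e unfolding continuous_at_eps_delta by (metis dist_real_def)
  obtain r where r: "r > 0" "ball x r \<subseteq> S" using assms open_contains_ball by blast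
  define h where "h = min r (min d1 d2) / 4"
  have h: "0 < h" "2 * h < r" "2 * h < d1" "2 * h < d2" using d r by (auto simp: h_def)
  have f: "smooth_on (ball x r) f" using smooth_on_subset[OF assms(2) r(2)] .
  obtain y where y: "norm (y - x) < 2 * h" "f (x + h *\<^sub>R axis a 1 + h *\<^sub>R axis b 1) - f (x + h *\<^sub>R axis a 1) - f (x + h *\<^sub>R axis b 1) + f x
      = h * h * partial b (partial a f) y" using second_difference[OF f h(1,2)] .
  obtain z where z: "norm (z - x) < 2 * h" "f (x + h *\<^sub>R axis b 1 + h *\<^sub>R axis a 1) - f (x + h *\<^sub>R axis b 1) - f (x + h *\<^sub>R axis a 1) + f x
      = h * h * partial a (partial b f) z" using second_difference[OF f h(1,2)] .
  have "h * h * partial b (partial a f) y = h * h * partial a (partial b f) z"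
  proof -
    have e: "x + h *\<^sub>R axis b 1 + h *\<^sub>R axis a 1 = x + h *\<^sub>R axis a 1 + h *\<^sub>R axis b (1::real)"
      by (simp add: algebra_simps)
    show ?thesis using y(2) z(2)[unfolded e] by linarith
  qed
  then have "partial b (partial a f) y = partial a (partial b f) z" using h by simp
  moreover have "\<bar>partial a (partial b f) z - partial a (partial b f) x\<bar> < e"
    using z(1) h by (intro d1) (simp add: dist_norm)
  moreover have "\<bar>partial b (partial a f) y - partial b (partial a f) x\<bar> < e"
    using y(1) h by (intro d2) (simp add: dist_norm)
  ultimately show False unfolding e_def by argo
qed

section \<open>Inverse matrices and charts\<close>

lemma matrix_inv_right:
  fixes A :: "'a::semiring_1^'n^'n"
  assumes "invertible A"
  shows "A ** matrix_inv A = mat 1"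
  using assms someI_ex[of "\<lambda>B. A ** B = mat 1 \<and> B ** A = mat 1"]
  by (simp add: matrix_inv_def invertible_def)

lemma matrix_inv_left:
  fixes A :: "'a::semiring_1^'n^'n"
  assumes "invertible A"
  shows "matrix_inv A ** A = mat 1"
  using assms someI_ex[of "\<lambda>B. A ** B = mat 1 \<and> B ** A = mat 1"]
  by (simp add: matrix_inv_def invertible_def)

text \<open>Makes each entry of the inverse a quotient of polynomials in the entries of the matrix,
  hence as differentiable as these.\<close>

lemma matrix_inv_cramer:
  fixes A :: "real^'n^'n"
  assumes "invertible A"
  shows "matrix_inv A $ k $ j = det (\<chi> i l. if l = k then axis j 1 $ i else A $ i $ l) / det A"
proof -
  have "A *v (matrix_inv A *v axis j 1) = axis j 1"
    using assms by (simp add: matrix_vector_mul_assoc matrix_inv_right)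
  then have "matrix_inv A *v axis j 1 = (\<chi> k. det (\<chi> i l. if l = k then axis j 1 $ i else A $ i $ l) / det A)"
    using cramer[of A] assms by (simp add: invertible_det_nz)
  moreover have "(matrix_inv A *v axis j 1) $ k = matrix_inv A $ k $ j"
    by (simp add: matrix_vector_mul_component inner_axis)
  ultimately show ?thesis by simp
qed

lemma Ck_on_matrix_inv:
  fixes M :: "'a::euclidean_space \<Rightarrow> real^'n^'n"
  assumes S: "open S" and M: "\<And>i j. Ck_on k S (\<lambda>x. M x $ i $ j)" and inv: "\<And>x. x \<in> S \<Longrightarrow> invertible (M x)"
  shows "Ck_on k S (\<lambda>x. matrix_inv (M x) $ i $ j)"
proof -
  have det: "Ck_on k S (\<lambda>x. det (N x))" if "\<And>i j. Ck_on k S (\<lambda>x. N x $ i $ j)" for N :: "'a \<Rightarrow> real^'n^'n"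
    unfolding det_def
    by (intro Ck_on_sum Ck_on_bilinear[OF bounded_bilinear_mult] Ck_on_prod S that Ck_on_const)
  have "Ck_on k S (\<lambda>x. det (\<chi> r l. if l = i then axis j 1 $ r else M x $ r $ l) * inverse (det (M x)))"
  proof (intro Ck_on_bilinear[OF bounded_bilinear_mult] Ck_on_inverse det S M)
    show "Ck_on k S (\<lambda>x. (\<chi> r l. if l = i then axis j 1 $ r else M x $ r $ l) $ r $ l)" for r l
      using M[of r l] by (cases "l = i") auto
  qed (use inv in \<open>simp add: invertible_det_nz\<close>)
  then show ?thesis
    by (rule Ck_on_cong[OF S, rotated]) (simp add: matrix_inv_cramer[OF inv] divide_inverse)
qed

text \<open>A box rather than a ball, so that membership is tested one coordinate at a time:
  rescaling some coordinates towards the centre, or resetting them to the centre, stays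
  inside.\<close>

definition cube :: "real^4 \<Rightarrow> real \<Rightarrow> (real^4) set" where
  "cube c r = {y. \<forall>i. \<bar>y $ i - c $ i\<bar> < r}"

lemma open_cube: "open (cube c r)"
proof -
  have "cube c r = (\<Inter>i\<in>UNIV. {y. \<bar>y $ i - c $ i\<bar> < r})" by (auto simp: cube_def)
  moreover have "open {y::real^4. \<bar>y $ i - c $ i\<bar> < r}" for i
    by (intro open_Collect_less continuous_intros)
  ultimately show ?thesis by (simp add: open_INT)
qed

lemma convex_cube: "convex (cube c r)"
proof -
  have "cube c r = (\<Inter>i\<in>UNIV. (\<lambda>y. y $ i) -` ball (c $ i) r)" by (auto simp: cube_def dist_real_def abs_minus_commute)
  moreover have "convex ((\<lambda>y. y $ i) -` ball (c $ i) r)" for i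
    by (intro convex_linear_vimage convex_ball) (simp add: bounded_linear.linear[OF bounded_linear_vec_nth])
  ultimately show ?thesis by (auto intro: convex_INT)
qed

lemma center_in_cube: "r > 0 \<Longrightarrow> c \<in> cube c r"
  by (simp add: cube_def)

lemma cube_subset:
  assumes "open V" "c \<in> V"
  obtains r where "r > 0" "cube c r \<subseteq> V"
proof -
  obtain e where e: "e > 0" "ball c e \<subseteq> V" using assms open_contains_ball by blast
  have "cube c (e / 4) \<subseteq> ball c e"
  proof
    fix y assume y: "y \<in> cube c (e / 4)"
    have "norm (y - c) \<le> (\<Sum>i\<in>UNIV. \<bar>(y - c) $ i\<bar>)" by (rule norm_le_l1_cart)
    also have "\<dots> < (\<Sum>i\<in>(UNIV::4 set). e / 4)"
      using y by (intro sum_strict_mono) (auto simp: cube_def)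
    finally show "y \<in> ball c e" by (simp add: dist_norm norm_minus_commute)
  qed
  then show ?thesis using e by (intro that[of "e / 4"]) auto
qed

text \<open>The inverse function theorem yields a differentiable inverse. Its derivative is the
  inverse matrix of the derivative of \<open>f\<close> at \<open>g y\<close>, thus of class
  \<open>k\<close> as soon as \<open>g\<close> is; this bootstraps \<open>g\<close> to all orders.
  The neighbourhood is cut down so that its image is a cube.\<close>

lemma smooth_chart:
  fixes f :: "real^4 \<Rightarrow> real^4"
  assumes U: "open U" "p \<in> U" and f: "smooth_on U f"
    and inj: "\<And>v. frechet_derivative f (at p) v = 0 \<Longrightarrow> v = 0"
  obtains r V g where "r > 0" "open V" "p \<in> V" "V \<subseteq> U" "f ` V = cube (f p) r" "g ` cube (f p) r = V"
    "\<And>x. x \<in> V \<Longrightarrow> g (f x) = x" "\<And>y. y \<in> cube (f p) r \<Longrightarrow> f (g y) = y" "smooth_on (cube (f p) r) g"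
proof -
  let ?D = "\<lambda>x. frechet_derivative f (at x)"
  have D: "(f has_derivative ?D x) (at x)" if "x \<in> U" for x
    using smooth_on_has_derivative[OF f that] .
  then have bl: "bounded_linear (?D x)" if "x \<in> U" for x
    using has_derivative_bounded_linear that by auto
  then have ba: "blinfun_apply (Blinfun (?D x)) = ?D x" if "x \<in> U" for x
    using that by (simp add: bounded_linear_Blinfun_apply)
  have lin: "linear (?D p)" using bl[OF U(2)] by (rule bounded_linear.linear)
  have "inj (?D p)"
    using inj lin by (simp add: linear_injective_0)
  then obtain I where I: "linear I" "I \<circ> ?D p = id"
    using linear_injective_left_inverse[OF lin] by auto
  have cont: "continuous_on U (\<lambda>x. Blinfun (?D x))"
  proof (rule continuous_on_blinfun_componentwise)
    fix i :: "real^4"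
    show "continuous_on U (\<lambda>x. blinfun_apply (Blinfun (?D x)) i)"
      using smooth_on_continuous[OF smooth_on_frechet[OF f, of i]] by (simp add: ba cong: continuous_on_cong)
  qed
  have "Blinfun I o\<^sub>L Blinfun (?D p) = id_blinfun"
    using I ba[OF U(2)] by (intro blinfun_eqI) (auto simp: bounded_linear_Blinfun_apply linear_conv_bounded_linear o_def id_def fun_eq_iff)
  from inverse_function_theorem[OF U(1) _ cont U(2) this] D ba
  obtain U' V g g' where U': "open U'" "U' \<subseteq> U" "p \<in> U'" and V: "open V" "f p \<in> V" "homeomorphism U' V f g"
    and g: "\<And>y. y \<in> V \<Longrightarrow> (g has_derivative (g' y)) (at y)"
    and g': "\<And>y. y \<in> V \<Longrightarrow> g' y = inv (blinfun_apply (Blinfun (?D (g y))))"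
    and bij: "\<And>y. y \<in> V \<Longrightarrow> bij (blinfun_apply (Blinfun (?D (g y))))"
    by metis
  have gU: "g y \<in> U" if "y \<in> V" for y
    using V(3) U'(2) that by (auto simp: homeomorphism_def)
  have mat: "?D x = (*v) (matrix (?D x))" if "x \<in> U" for x
    using bl[OF that] by (intro ext) (simp add: bounded_linear.linear matrix_works)
  have inv: "invertible (matrix (?D (g y)))" if y: "y \<in> V" for y
  proof -
    have l: "linear (?D (g y))" by (rule bounded_linear.linear[OF bl[OF gU[OF y]]])
    have "inj (?D (g y))" using bij[OF y] gU[OF y] by (simp add: ba bij_def)
    then obtain J where J: "linear J" "J \<circ> ?D (g y) = id"
      using linear_injective_left_inverse[OF l] by auto
    then have "matrix J ** matrix (?D (g y)) = mat 1"
      using matrix_compose[OF l J(1)] by (simp add: matrix_id_mat_1)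
    then show ?thesis using invertible_left_inverse by blast
  qed
  have g'_eq: "g' y v = matrix_inv (matrix (?D (g y))) *v v" if "y \<in> V" for y v
  proof -
    have "?D (g y) (matrix_inv (matrix (?D (g y))) *v v) = matrix (?D (g y)) *v (matrix_inv (matrix (?D (g y))) *v v)"
      by (rule fun_cong[OF mat[OF gU[OF that]]])
    then have "?D (g y) (matrix_inv (matrix (?D (g y))) *v v) = v"
      using inv[OF that] by (simp add: matrix_vector_mul_assoc matrix_inv_right)
    then show ?thesis
      using bij[OF that] unfolding g'[OF that] ba[OF gU[OF that]] by (metis bij_inv_eq_iff)
  qed
  have Ck: "Ck_on k V g" for k
  proof (induction k)
    case 0
    show ?case using has_derivative_continuous[OF g] by (simp add: continuous_at_imp_continuous_on)
  next
    case (Suc k)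
    have "Ck_on k V (\<lambda>y. matrix (?D (g y)) $ i $ j)" for i j
    proof -
      have "Ck_on k U (\<lambda>x. ?D x (axis j 1) $ i)"
        by (rule smooth_onD[OF smooth_on_nth[OF U(1) smooth_on_frechet[OF f]]])
      from Ck_on_compose[OF V(1) Suc this] gU show ?thesis by (auto simp: matrix_def)
    qed
    then have m: "Ck_on k V (\<lambda>y. matrix_inv (matrix (?D (g y))) $ i $ j)" for i j
      by (rule Ck_on_matrix_inv[OF V(1) _ inv])
    have "Ck_on k V (\<lambda>y. g' y v)" for v
    proof (rule Ck_on_cong[OF V(1)])
      show "(\<Sum>i\<in>UNIV. (\<Sum>j\<in>UNIV. matrix_inv (matrix (?D (g y))) $ i $ j * v $ j) *\<^sub>R axis i 1) = g' y v" if "y \<in> V" for y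
        by (simp add: g'_eq[OF that] vec_eq_iff matrix_vector_mult_def axis_def if_distrib cong: if_cong)
      show "Ck_on k V (\<lambda>y. \<Sum>i\<in>UNIV. (\<Sum>j\<in>UNIV. matrix_inv (matrix (?D (g y))) $ i $ j * v $ j) *\<^sub>R axis i 1)"
        by (intro Ck_on_sum Ck_on_bilinear[OF bounded_bilinear_scaleR] Ck_on_bilinear[OF bounded_bilinear_mult]
            V(1) m Ck_on_const)
    qed
    then show ?case using Ck_on_SucI[OF V(1) g] by blast
  qed
  obtain r where r: "r > 0" "cube (f p) r \<subseteq> V" using cube_subset[OF V(1,2)] .
  have hom: "f ` U' = V" "g ` V = U'" "\<And>x. x \<in> U' \<Longrightarrow> g (f x) = x" "\<And>y. y \<in> V \<Longrightarrow> f (g y) = y" "continuous_on U' f"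
    using V(3) by (auto simp: homeomorphism_def)
  show thesis
  proof (rule that[OF r(1)])
    have eq: "g ` cube (f p) r = U' \<inter> f -` cube (f p) r"
      using hom r(2) by (auto simp: image_iff) (metis image_eqI)+
    show "open (g ` cube (f p) r)" unfolding eq
      using continuous_open_preimage[OF hom(5) U'(1) open_cube] .
    show "p \<in> g ` cube (f p) r" unfolding eq using U'(3) r(1) by (simp add: center_in_cube)
    show "g ` cube (f p) r \<subseteq> U" unfolding eq using U'(2) by auto
    show "f ` g ` cube (f p) r = cube (f p) r" using hom(4) r(2) by (force simp: image_image)
    show "g (f x) = x" if "x \<in> g ` cube (f p) r" for x using that hom(3) unfolding eq by auto
    show "f (g y) = y" if "y \<in> cube (f p) r" for y using hom(4) that r(2) by auto
    show "smooth_on (cube (f p) r) g" by (rule smooth_onI[OF Ck_on_subset[OF Ck r(2)]])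
  qed simp
qed

section \<open>Potentials\<close>

definition proj_on :: "4 set \<Rightarrow> real^4 \<Rightarrow> real^4" where
  "proj_on I v = (\<chi> i. if i \<in> I then v $ i else 0)"

text \<open>A homotopy from the projection that resets the \<open>I\<close>-coordinates to those of
  \<open>c\<close> (t = 0) to the identity (t = 1). The coordinates outside \<open>I\<close> are
  kept, so a single integral produces potentials on all slices at once, smooth in the
  parameters.\<close>

definition contract_on :: "4 set \<Rightarrow> real^4 \<Rightarrow> real \<Rightarrow> real^4 \<Rightarrow> real^4" where
  "contract_on I c t y = y + (t - 1) *\<^sub>R proj_on I (y - c)"

lemma bounded_linear_proj_on: "bounded_linear (proj_on I)"
  unfolding linear_conv_bounded_linear[symmetric]
  by (rule linearI) (auto simp: proj_on_def vec_eq_iff)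

lemma contract_on_in_cube:
  assumes "y \<in> cube c r" "0 \<le> t" "t \<le> 1"
  shows "contract_on I c t y \<in> cube c r"
  unfolding cube_def
proof (rule CollectI, rule allI)
  fix i
  have "\<bar>t * (y $ i - c $ i)\<bar> \<le> \<bar>y $ i - c $ i\<bar>"
    using assms by (simp add: abs_mult mult_left_le_one_le)
  moreover have "\<bar>y $ i - c $ i\<bar> < r" using assms by (simp add: cube_def)
  moreover have "contract_on I c t y $ i - c $ i = (if i \<in> I then t * (y $ i - c $ i) else y $ i - c $ i)"
    by (simp add: contract_on_def proj_on_def algebra_simps)
  ultimately show "\<bar>contract_on I c t y $ i - c $ i\<bar> < r" by (simp split: if_splits)
qed

lemma has_derivative_contract_on:
  "(contract_on I c t has_derivative (\<lambda>v. v + (t - 1) *\<^sub>R proj_on I v)) (at y)"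
  unfolding contract_on_def[abs_def]
  by (auto intro!: derivative_eq_intros bounded_linear.has_derivative[OF bounded_linear_proj_on])

lemma continuous_on_contract_on [continuous_intros]:
  "continuous_on S f \<Longrightarrow> continuous_on S g \<Longrightarrow> continuous_on S (\<lambda>x. contract_on I c (f x) (g x))"
  unfolding contract_on_def
  by (intro continuous_intros bounded_linear.continuous_on[OF bounded_linear_proj_on])

lemma continuous_on_along_contraction:
  assumes "continuous_on (cube c r) f" "continuous_on {0..1} \<phi>"
  shows "continuous_on (cube c r \<times> {0..1}) (\<lambda>(y, t). \<phi> t * (f (contract_on I c t y) :: real))"
  unfolding split_beta
  by (intro continuous_intros continuous_on_compose2[OF assms(1)] continuous_on_compose2[OF assms(2)])
    (auto intro: contract_on_in_cube)

lemma continuous_on_along_contraction':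
  assumes "continuous_on (cube c r) f" "continuous_on {0..1} \<phi>" "y \<in> cube c r"
  shows "continuous_on {0..1} (\<lambda>t. \<phi> t * (f (contract_on I c t y) :: real))"
  by (intro continuous_intros continuous_on_compose2[OF assms(1)] assms(2))
    (auto intro: contract_on_in_cube assms)

text \<open>The weight \<phi> is present because differentiation multiplies the integrand by factors
  1 or \<open>t\<close>. With arbitrary continuous weights the class of these integrals is closed
  under differentiation, and smoothness follows by induction.\<close>

definition contraction_integral :: "4 set \<Rightarrow> real^4 \<Rightarrow> (real \<Rightarrow> real) \<Rightarrow> (real^4 \<Rightarrow> real) \<Rightarrow> real^4 \<Rightarrow> real" where
  "contraction_integral I c \<phi> f y = integral {0..1} (\<lambda>t. \<phi> t * f (contract_on I c t y))"

lemma has_derivative_contraction_integral: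
  assumes f: "Ck_on (Suc 0) (cube c r) f" and \<phi>: "continuous_on {0..1} \<phi>" and y: "y \<in> cube c r"
  shows "(contraction_integral I c \<phi> f has_derivative
    (\<lambda>v. \<Sum>i\<in>UNIV. contraction_integral I c (\<lambda>t. \<phi> t * (v + (t - 1) *\<^sub>R proj_on I v) $ i) (partial i f) y)) (at y)"
proof -
  have fd: "f differentiable (at z)" if "z \<in> cube c r" for z using f that by simp
  have fp: "continuous_on (cube c r) (partial i f)" for i
    using f by (simp add: partial_def[abs_def])
  have fc: "continuous_on (cube c r) f" using Ck_on_continuous[OF f] .
  define E where "E t i = Blinfun (\<lambda>v. (v + (t - 1) *\<^sub>R proj_on I v) $ i)" for t :: real and i
  have E: "blinfun_apply (E t i) v = (v + (t - 1) *\<^sub>R proj_on I v) $ i" for t i v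
  proof -
    have "bounded_linear (\<lambda>v. (v + (t - 1) *\<^sub>R proj_on I v) $ i)"
      using bounded_linear_compose[OF bounded_linear_vec_nth has_derivative_bounded_linear[OF has_derivative_contract_on]] .
    then show ?thesis unfolding E_def by (simp add: bounded_linear_Blinfun_apply)
  qed
  have Ec: "continuous_on {0..1} (\<lambda>t. E t i)" for i
    by (rule continuous_on_blinfun_componentwise) (simp add: E, intro continuous_intros)
  \<comment> \<open>The derivative of the integrand as a \<open>blinfun\<close>, jointly continuous
    in point and parameter, as the Leibniz rule requires.\<close>
  define fx where "fx z t = (\<Sum>i\<in>UNIV. (\<phi> t * partial i f (contract_on I c t z)) *\<^sub>R E t i)" for z t
  have cfx: "continuous_on (cube c r \<times> cbox 0 1) (\<lambda>(z, t). fx z t)"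
    unfolding split_beta fx_def cbox_interval
    by (intro continuous_intros continuous_on_compose2[OF fp] continuous_on_compose2[OF \<phi>]
        continuous_on_compose2[OF Ec]) (auto intro: contract_on_in_cube)
  have "((\<lambda>z. integral (cbox 0 1) (\<lambda>t. \<phi> t * f (contract_on I c t z))) has_derivative
      blinfun_apply (integral (cbox 0 1) (fx y))) (at y within cube c r)"
  proof (rule leibniz_rule[OF _ _ cfx y convex_cube])
    fix z t assume z: "z \<in> cube c r" and t: "t \<in> cbox 0 (1::real)"
    then have c: "contract_on I c t z \<in> cube c r" by (auto intro: contract_on_in_cube)
    have "((\<lambda>z. f (contract_on I c t z)) has_derivative (\<lambda>v. \<Sum>i\<in>UNIV. (v + (t - 1) *\<^sub>R proj_on I v) $ i *\<^sub>R
        partial i f (contract_on I c t z))) (at z)"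
      by (rule has_derivative_compose[OF has_derivative_contract_on has_derivative_partial[OF fd[OF c]]])
    from has_derivative_mult_right[OF this, of "\<phi> t"]
    have "((\<lambda>z. \<phi> t * f (contract_on I c t z)) has_derivative blinfun_apply (fx z t)) (at z)"
      by (rule has_derivative_eq_rhs)
        (auto simp: fx_def E blinfun.sum_left blinfun.scaleR_left sum_distrib_left ac_simps)
    then show "((\<lambda>z. \<phi> t * f (contract_on I c t z)) has_derivative blinfun_apply (fx z t)) (at z within cube c r)"
      by (rule has_derivative_at_withinI)
  next
    fix z assume "z \<in> cube c r"
    then show "(\<lambda>t. \<phi> t * f (contract_on I c t z)) integrable_on cbox 0 1"
      using continuous_on_along_contraction'[OF fc \<phi>] by (simp add: integrable_continuous_interval)
  qed
  moreover have "blinfun_apply (integral (cbox 0 1) (fx y)) v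
      = (\<Sum>i\<in>UNIV. contraction_integral I c (\<lambda>t. \<phi> t * (v + (t - 1) *\<^sub>R proj_on I v) $ i) (partial i f) y)" for v
  proof -
    have "continuous_on (cbox 0 1) (fx y)"
      unfolding fx_def cbox_interval
      by (intro continuous_intros continuous_on_compose2[OF fp] continuous_on_compose2[OF \<phi>]
          continuous_on_compose2[OF Ec]) (auto intro: contract_on_in_cube y)
    then have "blinfun_apply (integral (cbox 0 1) (fx y)) v = integral (cbox 0 1) (\<lambda>t. fx y t v)"
      by (rule blinfun_apply_integral[OF integrable_continuous])
    also have "\<dots> = integral {0..1} (\<lambda>t. \<Sum>i\<in>UNIV. (\<phi> t * (v + (t - 1) *\<^sub>R proj_on I v) $ i) * partial i f (contract_on I c t y))"
      by (simp add: fx_def E blinfun.sum_left blinfun.scaleR_left ac_simps)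
    also have "\<dots> = (\<Sum>i\<in>UNIV. contraction_integral I c (\<lambda>t. \<phi> t * (v + (t - 1) *\<^sub>R proj_on I v) $ i) (partial i f) y)"
      unfolding contraction_integral_def
    proof (rule integral_sum)
      show "(\<lambda>t. \<phi> t * (v + (t - 1) *\<^sub>R proj_on I v) $ i * partial i f (contract_on I c t y)) integrable_on {0..1}" for i
        by (intro integrable_continuous_interval continuous_on_along_contraction'[OF fp _ y] continuous_intros \<phi>)
    qed simp
    finally show ?thesis .
  qed
  ultimately show ?thesis
    using at_within_open[OF y open_cube]
    by (auto simp: contraction_integral_def[abs_def] cbox_interval elim!: has_derivative_eq_rhs intro!: ext)
qed

lemma Ck_on_contraction_integral:
  assumes "Ck_on k (cube c r) f" "continuous_on {0..1} \<phi>"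
  shows "Ck_on k (cube c r) (contraction_integral I c \<phi> f)"
  using assms
proof (induction k arbitrary: f \<phi>)
  case 0
  have "continuous_on (cube c r) (\<lambda>y. integral (cbox 0 1) (\<lambda>t. \<phi> t * f (contract_on I c t y)))"
    using continuous_on_along_contraction[of c r f \<phi> I] 0
    by (intro integral_continuous_on_param) (simp add: split_beta)
  then show ?case by (simp add: contraction_integral_def[abs_def])
next
  case (Suc k)
  have "continuous_on (cube c r) (\<lambda>x. frechet_derivative f (at x) v)" for v
    using Suc.prems(1) by (intro Ck_on_continuous[of k]) simp
  then have 1: "Ck_on (Suc 0) (cube c r) f"
    using Suc.prems(1) by simp
  show ?case
  proof (rule Ck_on_SucI[OF open_cube has_derivative_contraction_integral[OF 1 Suc.prems(2)]])
    fix v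
    have "Ck_on k (cube c r) (contraction_integral I c (\<lambda>t. \<phi> t * (v + (t - 1) *\<^sub>R proj_on I v) $ i) (partial i f))" for i
    proof (rule Suc.IH)
      show "Ck_on k (cube c r) (partial i f)" using Suc.prems(1) by (simp add: partial_def[abs_def])
      show "continuous_on {0..1} (\<lambda>t. \<phi> t * (v + (t - 1) *\<^sub>R proj_on I v) $ i)"
        by (intro continuous_intros Suc.prems)
    qed
    then show "Ck_on k (cube c r) (\<lambda>y. \<Sum>i\<in>UNIV. contraction_integral I c (\<lambda>t. \<phi> t * (v + (t - 1) *\<^sub>R proj_on I v) $ i) (partial i f) y)"
      by (intro Ck_on_sum open_cube)
  qed
qed

text \<open>Poincare lemma with parameters: the potential is the line integral of \<theta> along the
  segment that contracts the \<open>I\<close>-coordinates to the centre. Closedness concerns the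
  indices in \<open>I\<close>, while the potential is smooth in all coordinates.\<close>

lemma potential_on_cube:
  fixes \<theta> :: "4 \<Rightarrow> real^4 \<Rightarrow> real"
  assumes \<theta>: "\<And>i. smooth_on (cube c r) (\<theta> i)"
    and closed: "\<And>y i j. y \<in> cube c r \<Longrightarrow> i \<in> I \<Longrightarrow> j \<in> I \<Longrightarrow> partial i (\<theta> j) y = partial j (\<theta> i) y"
  obtains f where "smooth_on (cube c r) f" "\<And>y i. y \<in> cube c r \<Longrightarrow> i \<in> I \<Longrightarrow> partial i f y = \<theta> i y"
proof -
  let ?J = "\<lambda>i. contraction_integral I c (\<lambda>t. 1) (\<theta> i)"
  define f where "f y = (\<Sum>i\<in>I. (y $ i - c $ i) * ?J i y)" for y
  have J: "smooth_on (cube c r) (?J i)" for i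
    by (rule smooth_onI[OF Ck_on_contraction_integral[OF smooth_onD[OF \<theta>]]]) simp
  have co: "smooth_on (cube c r) (\<lambda>y. y $ i - c $ i)" for i
    by (intro smooth_on_diff smooth_on_const smooth_on_linear bounded_linear_vec_nth open_cube)
  have f: "smooth_on (cube c r) f"
    unfolding f_def[abs_def] by (intro smooth_on_sum smooth_on_mult open_cube co J)
  moreover have "partial j f y = \<theta> j y" if y: "y \<in> cube c r" and j: "j \<in> I" for y j
  proof -
    have pco: "partial j (\<lambda>y. y $ i - c $ i) y = (if i = j then 1 else 0)" for i
    proof -
      have "((\<lambda>y. y $ i - c $ i) has_derivative (\<lambda>v. v $ i)) (at y)"
        by (auto intro!: derivative_eq_intros bounded_linear_imp_has_derivative bounded_linear_vec_nth)
      then show ?thesis by (simp add: partial_eqI axis_def)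
    qed
    have pJ: "partial j (?J i) y = integral {0..1} (\<lambda>t. t * partial j (\<theta> i) (contract_on I c t y))" for i
    proof -
      have "(axis j 1 + (t - 1) *\<^sub>R proj_on I (axis j 1)) $ k = (if k = j then t else (0::real))" for t k
        using j by (simp add: proj_on_def axis_def)
      then have "partial j (?J i) y = (\<Sum>k\<in>UNIV. contraction_integral I c (\<lambda>t. if k = j then t else 0) (partial k (\<theta> i)) y)"
        by (subst partial_eqI[OF has_derivative_contraction_integral[OF smooth_onD[OF \<theta>] _ y]]) simp_all
      also have "\<dots> = (\<Sum>k\<in>UNIV. if k = j then contraction_integral I c (\<lambda>t. t) (partial k (\<theta> i)) y else 0)"
        by (intro sum.cong) (simp_all add: contraction_integral_def)
      finally show ?thesis by (simp add: contraction_integral_def)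
    qed
    have "partial j f y = (\<Sum>i\<in>I. partial j (\<lambda>y. (y $ i - c $ i) * ?J i y) y)"
      unfolding f_def[abs_def]
      by (intro partial_sum smooth_on_differentiable[OF smooth_on_mult[OF open_cube co J]] y)
    also have "\<dots> = (\<Sum>i\<in>I. (if i = j then ?J i y else 0) + (y $ i - c $ i) * partial j (?J i) y)"
      by (intro sum.cong refl)
        (auto simp: partial_mult[OF smooth_on_differentiable[OF co y] smooth_on_differentiable[OF J y]] pco)
    also have "\<dots> = ?J j y + (\<Sum>i\<in>I. (y $ i - c $ i) * partial j (?J i) y)"
      using j by (simp add: sum.distrib)
    also have "\<dots> = integral {0..1} (\<lambda>t. \<theta> j (contract_on I c t y)
        + t * (\<Sum>i\<in>I. (y $ i - c $ i) * partial j (\<theta> i) (contract_on I c t y)))"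
    proof -
      have i1: "(\<lambda>t. \<theta> j (contract_on I c t y)) integrable_on {0..1}"
        using continuous_on_along_contraction'[OF smooth_on_continuous[OF \<theta>] continuous_on_const[of _ 1] y]
        by (intro integrable_continuous_interval) simp
      have i2: "(\<lambda>t. (y $ i - c $ i) * (t * partial j (\<theta> i) (contract_on I c t y))) integrable_on {0..1}" for i
        by (intro integrable_continuous_interval continuous_on_mult continuous_on_const
            continuous_on_along_contraction'[OF smooth_on_continuous[OF smooth_on_partial[OF \<theta>]] continuous_on_id y])
      have "(\<Sum>i\<in>I. (y $ i - c $ i) * partial j (?J i) y)
          = (\<Sum>i\<in>I. integral {0..1} (\<lambda>t. (y $ i - c $ i) * (t * partial j (\<theta> i) (contract_on I c t y))))"
        by (simp add: pJ)
      also have "\<dots> = integral {0..1} (\<lambda>t. \<Sum>i\<in>I. (y $ i - c $ i) * (t * partial j (\<theta> i) (contract_on I c t y)))"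
        by (rule integral_sum[symmetric]) (auto intro: i2)
      finally have "?J j y + (\<Sum>i\<in>I. (y $ i - c $ i) * partial j (?J i) y)
          = integral {0..1} (\<lambda>t. \<theta> j (contract_on I c t y))
            + integral {0..1} (\<lambda>t. \<Sum>i\<in>I. (y $ i - c $ i) * (t * partial j (\<theta> i) (contract_on I c t y)))"
        by (simp add: contraction_integral_def)
      also have "\<dots> = integral {0..1} (\<lambda>t. \<theta> j (contract_on I c t y)
            + (\<Sum>i\<in>I. (y $ i - c $ i) * (t * partial j (\<theta> i) (contract_on I c t y))))"
        by (rule integral_add[OF i1 integrable_sum, symmetric]) (auto intro: i2)
      finally show ?thesis by (simp only: sum_distrib_left mult.left_commute)
    qed
    \<comment> \<open>By closedness the integrand is the derivative of \<open>t\<close> times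
      \<open>\<theta> j\<close> along the contraction; this product is 0 at t = 0 and
      \<open>\<theta> j y\<close> at t = 1.\<close>
    also have "\<dots> = \<theta> j y"
    proof -
      have "((\<lambda>t. t * \<theta> j (contract_on I c t y)) has_vector_derivative
          \<theta> j (contract_on I c t y) + t * (\<Sum>i\<in>I. (y $ i - c $ i) * partial j (\<theta> i) (contract_on I c t y)))
          (at t within {0..1})" if t: "t \<in> {0..1}" for t
      proof -
        have c: "contract_on I c t y \<in> cube c r" using t y by (auto intro: contract_on_in_cube)
        have "((\<lambda>t. contract_on I c t y) has_derivative (\<lambda>s. s *\<^sub>R proj_on I (y - c))) (at t)"
          unfolding contract_on_def by (auto intro!: derivative_eq_intros)
        from has_derivative_compose[OF this has_derivative_partial[OF smooth_on_differentiable[OF \<theta> c]]]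
        have "((\<lambda>t. \<theta> j (contract_on I c t y)) has_derivative
          (\<lambda>s. \<Sum>a\<in>UNIV. (s *\<^sub>R proj_on I (y - c)) $ a *\<^sub>R partial a (\<theta> j) (contract_on I c t y))) (at t)" .
        moreover have "(\<lambda>s. \<Sum>a\<in>UNIV. (s *\<^sub>R proj_on I (y - c)) $ a *\<^sub>R partial a (\<theta> j) (contract_on I c t y))
          = (\<lambda>s. s * (\<Sum>i\<in>I. (y $ i - c $ i) * partial j (\<theta> i) (contract_on I c t y)))"
        proof
          fix s
          have "(\<Sum>a\<in>UNIV. (s *\<^sub>R proj_on I (y - c)) $ a *\<^sub>R partial a (\<theta> j) (contract_on I c t y))
            = (\<Sum>a\<in>UNIV. if a \<in> I then s * ((y $ a - c $ a) * partial a (\<theta> j) (contract_on I c t y)) else 0)"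
            by (intro sum.cong) (auto simp: proj_on_def)
          also have "\<dots> = (\<Sum>a\<in>I. s * ((y $ a - c $ a) * partial j (\<theta> a) (contract_on I c t y)))"
            using closed[OF c _ j] by (simp add: sum.If_cases)
          finally show "(\<Sum>a\<in>UNIV. (s *\<^sub>R proj_on I (y - c)) $ a *\<^sub>R partial a (\<theta> j) (contract_on I c t y))
            = s * (\<Sum>i\<in>I. (y $ i - c $ i) * partial j (\<theta> i) (contract_on I c t y))"
            by (simp add: sum_distrib_left)
        qed
        ultimately have "((\<lambda>t. \<theta> j (contract_on I c t y)) has_real_derivative
            (\<Sum>i\<in>I. (y $ i - c $ i) * partial j (\<theta> i) (contract_on I c t y))) (at t)"
          by (simp add: has_field_derivative_def mult_commute_abs)
        from DERIV_mult[OF DERIV_ident this]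
        have "((\<lambda>t. t * \<theta> j (contract_on I c t y)) has_real_derivative
            \<theta> j (contract_on I c t y) + t * (\<Sum>i\<in>I. (y $ i - c $ i) * partial j (\<theta> i) (contract_on I c t y))) (at t)"
          by (rule DERIV_cong) (simp add: mult.commute)
        then show ?thesis
          unfolding has_real_derivative_iff_has_vector_derivative by (rule has_vector_derivative_at_within)
      qed
      from fundamental_theorem_of_calculus[OF _ this]
      show ?thesis by (simp add: integral_unique contract_on_def)
    qed
    finally show ?thesis .
  qed
  ultimately show thesis by (rule that)
qed

text \<open>The segment between the two points stays in the convex cube and has no component outside
  \<open>I\<close>, so the derivative along it vanishes.\<close>

lemma constant_along_slices:
  fixes f :: "real^4 \<Rightarrow> real"
  assumes f: "smooth_on (cube c r) f" and z: "\<And>y i. y \<in> cube c r \<Longrightarrow> i \<in> I \<Longrightarrow> partial i f y = 0"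
    and y: "y \<in> cube c r" "y' \<in> cube c r" "\<And>i. i \<notin> I \<Longrightarrow> y $ i = y' $ i"
  shows "f y = f y'"
proof -
  let ?w = "y' - y"
  have in_cube: "y + t *\<^sub>R ?w \<in> cube c r" if "0 \<le> t" "t \<le> 1" for t
    using convexD_alt[OF convex_cube y(1,2) that] by (simp add: algebra_simps)
  have "((\<lambda>t. f (y + t *\<^sub>R ?w)) has_real_derivative 0) (at t)" if t: "0 \<le> t" "t \<le> 1" for t
  proof -
    have 0: "(\<Sum>a\<in>UNIV. (s *\<^sub>R ?w) $ a *\<^sub>R partial a f (y + t *\<^sub>R ?w)) = 0" for s
    proof (rule sum.neutral, rule ballI)
      fix a show "(s *\<^sub>R ?w) $ a *\<^sub>R partial a f (y + t *\<^sub>R ?w) = 0"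
        using z[OF in_cube[OF t], of a] y(3)[of a] by (cases "a \<in> I") auto
    qed
    have "((\<lambda>t. y + t *\<^sub>R ?w) has_derivative (\<lambda>s. s *\<^sub>R ?w)) (at t)"
      by (auto intro!: derivative_eq_intros)
    from has_derivative_compose[OF this has_derivative_partial[OF smooth_on_differentiable[OF f in_cube[OF t]]]]
    show ?thesis unfolding 0 has_field_derivative_def by (simp add: lambda_zero)
  qed
  from MVT2[of 0 1 "\<lambda>t. f (y + t *\<^sub>R ?w)" "\<lambda>_. 0", OF _ this]
  show ?thesis by auto
qed

lemma partial_coordinate: "partial a (\<lambda>x. x $ i) x = (if i = a then 1 else 0)"
  using partial_eqI[OF bounded_linear_imp_has_derivative[OF bounded_linear_vec_nth]] by (simp add: axis_def)

lemma smooth_on_coordinate: "open S \<Longrightarrow> smooth_on S (\<lambda>x. x $ i)"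
  by (rule smooth_on_linear[OF bounded_linear_vec_nth])

lemma frechet_nth:
  fixes f :: "real^4 \<Rightarrow> real^4"
  assumes "f differentiable (at x)"
  shows "frechet_derivative f (at x) v $ i = (\<Sum>a\<in>UNIV. v $ a * partial a (\<lambda>x. f x $ i) x)"
  using assms by (simp add: frechet_partial partial_bounded_linear[OF bounded_linear_vec_nth])

lemma partial_chart_inverse:
  fixes f g :: "real^4 \<Rightarrow> real^4"
  assumes V: "open V" "x \<in> V" and f: "f differentiable (at x)" and g: "g differentiable (at (f x))"
    and inv: "\<And>x. x \<in> V \<Longrightarrow> g (f x) = x"
  shows "(\<Sum>i\<in>UNIV. partial b (\<lambda>x. f x $ i) x * partial i (\<lambda>y. g y $ a) (f x)) = (if a = b then 1 else 0)"
proof -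
  have ga: "(\<lambda>y. g y $ a) differentiable (at (f x))"
    using bounded_linear.has_derivative[OF bounded_linear_vec_nth diff_has_derivative[OF g]]
    by (rule differentiableI)
  have "partial b (\<lambda>x. g (f x) $ a) x = (\<Sum>i\<in>UNIV. partial b (\<lambda>x. f x $ i) x *\<^sub>R partial i (\<lambda>y. g y $ a) (f x))"
    by (rule partial_compose[OF ga f])
  moreover have "partial b (\<lambda>x. g (f x) $ a) x = partial b (\<lambda>x. x $ a) x"
    by (rule partial_cong[OF V]) (simp add: inv)
  ultimately show ?thesis by (simp add: partial_coordinate)
qed

text \<open>In the chart in which \<open>u\<close> is a coordinate, \<open>\<theta>\<close> is closed on every slice of constant \<open>u\<close>.\<close>

lemma potential_along_slices:
  fixes u :: "real^4 \<Rightarrow> real"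
  assumes U: "open U" "p \<in> U" and u: "smooth_on U u" and du: "partial a0 u p \<noteq> 0"
  obtains V where "open V" "p \<in> V" "V \<subseteq> U"
    "\<And>(\<theta> :: 4 \<Rightarrow> real^4 \<Rightarrow> real) \<pi>. (\<And>a. smooth_on V (\<theta> a)) \<Longrightarrow>
      (\<And>x a b. x \<in> V \<Longrightarrow> partial a (\<theta> b) x - partial b (\<theta> a) x
         = \<pi> a x * partial b u x - \<pi> b x * partial a u x) \<Longrightarrow>
      \<exists>f k. smooth_on V f \<and> smooth_on V k \<and> (\<forall>x\<in>V. \<forall>b. partial b f x = \<theta> b x + k x * partial b u x)"
proof -
  \<comment> \<open>One coordinate is replaced by \<open>u\<close>. As \<open>partial a0 u p\<close>
    is nonzero, the triangular Jacobian is invertible, and the slices u = const become coordinate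
    slices.\<close>
  define \<Phi> where "\<Phi> x = (\<chi> i. if i = a0 then u x else x $ i)" for x
  have \<Phi>i: "(\<lambda>x. \<Phi> x $ i) = (if i = a0 then u else (\<lambda>x. x $ i))" for i
    by (auto simp: \<Phi>_def)
  have s\<Phi>: "smooth_on U \<Phi>"
    by (rule smooth_on_vec[OF U(1)]) (use u smooth_on_coordinate[OF U(1)] in \<open>simp add: \<Phi>i\<close>)
  have "v = 0" if "frechet_derivative \<Phi> (at p) v = 0" for v
  proof -
    have *: "(\<Sum>a\<in>UNIV. v $ a * partial a (\<lambda>x. \<Phi> x $ i) p) = 0" for i
      using frechet_nth[OF smooth_on_differentiable[OF s\<Phi> U(2)], of v i] that by simp
    have 1: "v $ i = 0" if "i \<noteq> a0" for i
      using *[of i] that by (simp add: \<Phi>i partial_coordinate if_distrib cong: if_cong)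
    have "(\<Sum>a\<in>UNIV. v $ a * partial a u p) = v $ a0 * partial a0 u p"
      using 1 by (subst sum.remove[of _ a0]) (auto intro!: sum.neutral)
    then have "v $ a0 = 0" using *[of a0] du by (simp add: \<Phi>i)
    then show "v = 0" using 1 by (metis vec_eq_iff zero_index)
  qed
  from smooth_chart[OF U s\<Phi> this]
  obtain r V g where r: "r > 0" and V: "open V" "p \<in> V" "V \<subseteq> U" and img: "\<Phi> ` V = cube (\<Phi> p) r" "g ` cube (\<Phi> p) r = V"
    and g\<Phi>: "\<And>x. x \<in> V \<Longrightarrow> g (\<Phi> x) = x" and \<Phi>g: "\<And>y. y \<in> cube (\<Phi> p) r \<Longrightarrow> \<Phi> (g y) = y"
    and g: "smooth_on (cube (\<Phi> p) r) g" by metis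
  let ?W = "cube (\<Phi> p) r"
  have gV: "g y \<in> V" if "y \<in> ?W" for y using img that by auto
  have \<Phi>W: "\<Phi> x \<in> ?W" if "x \<in> V" for x using img that by auto
  have s\<Phi>V: "smooth_on V \<Phi>" using smooth_on_subset[OF s\<Phi> V(3)] .
  have sg: "smooth_on ?W (\<lambda>y. g y $ a)" for a by (rule smooth_on_nth[OF open_cube g])
  have comp: "smooth_on ?W (\<lambda>y. f (g y))" if "smooth_on V f" for f :: "real^4 \<Rightarrow> real"
    using smooth_on_compose[OF open_cube g that] img by simp
  show thesis
  proof (rule that[OF V])
    fix \<theta> :: "4 \<Rightarrow> real^4 \<Rightarrow> real" and \<pi>
    assume \<theta>: "\<And>a. smooth_on V (\<theta> a)" and closed: "\<And>x a b. x \<in> V \<Longrightarrow>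
      partial a (\<theta> b) x - partial b (\<theta> a) x = \<pi> a x * partial b u x - \<pi> b x * partial a u x"
    \<comment> \<open>Components of the pull-back of \<theta> in the new chart.\<close>
    define \<eta> where "\<eta> i y = (\<Sum>a\<in>UNIV. \<theta> a (g y) * partial i (\<lambda>y. g y $ a) y)" for i y
    have s\<eta>: "smooth_on ?W (\<eta> i)" for i
      unfolding \<eta>_def[abs_def] by (intro smooth_on_sum smooth_on_mult open_cube comp \<theta> smooth_on_partial sg)
    have p\<eta>: "partial j (\<eta> i) y = (\<Sum>a\<in>UNIV. (\<Sum>b\<in>UNIV. partial j (\<lambda>y. g y $ b) y * partial b (\<theta> a) (g y)) * partial i (\<lambda>y. g y $ a) y)
        + (\<Sum>a\<in>UNIV. \<theta> a (g y) * partial j (partial i (\<lambda>y. g y $ a)) y)" if y: "y \<in> ?W" for i j y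
    proof -
      have "partial j (\<eta> i) y = (\<Sum>a\<in>UNIV. partial j (\<lambda>y. \<theta> a (g y) * partial i (\<lambda>y. g y $ a) y) y)"
        unfolding \<eta>_def[abs_def]
        by (intro partial_sum smooth_on_differentiable[OF smooth_on_mult[OF open_cube comp[OF \<theta>] smooth_on_partial[OF sg]] y])
      also have "\<dots> = (\<Sum>a\<in>UNIV. partial j (\<lambda>y. \<theta> a (g y)) y * partial i (\<lambda>y. g y $ a) y
          + \<theta> a (g y) * partial j (partial i (\<lambda>y. g y $ a)) y)"
        by (intro sum.cong refl partial_mult smooth_on_differentiable[OF comp[OF \<theta>] y]
            smooth_on_differentiable[OF smooth_on_partial[OF sg] y])
      also have "\<dots> = (\<Sum>a\<in>UNIV. (\<Sum>b\<in>UNIV. partial j (\<lambda>y. g y $ b) y * partial b (\<theta> a) (g y)) * partial i (\<lambda>y. g y $ a) y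
          + \<theta> a (g y) * partial j (partial i (\<lambda>y. g y $ a)) y)"
        by (simp only: partial_compose[OF smooth_on_differentiable[OF \<theta> gV[OF y]] smooth_on_differentiable[OF g y]] real_scaleR_def)
      finally show ?thesis by (simp add: sum.distrib)
    qed
    \<comment> \<open>In the chart \<open>u\<close> is the coordinate \<open>a0\<close>, so its
      derivatives along the slices are zero. This removes both terms of the curl of
      \<theta>.\<close>
    have slice: "(\<Sum>b\<in>UNIV. partial j (\<lambda>y. g y $ b) y * partial b u (g y)) = 0" if y: "y \<in> ?W" and j: "j \<noteq> a0" for j y
    proof -
      have "partial j (\<lambda>y. u (g y)) y = partial j (\<lambda>y. y $ a0) y"
      proof (rule partial_cong[OF open_cube y])
        show "u (g y) = y $ a0" if "y \<in> ?W" for y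
          using arg_cong[OF \<Phi>g[OF that], of "\<lambda>z. z $ a0"] by (simp add: \<Phi>_def)
      qed
      moreover have "partial j (\<lambda>y. u (g y)) y = (\<Sum>b\<in>UNIV. partial j (\<lambda>y. g y $ b) y *\<^sub>R partial b u (g y))"
        using u gV[OF y] V(3) by (intro partial_compose smooth_on_differentiable[OF g y] smooth_on_differentiable[OF u]) auto
      ultimately show ?thesis using j by (simp add: partial_coordinate)
    qed
    have "partial i (\<eta> j) y = partial j (\<eta> i) y" if y: "y \<in> ?W" and ij: "i \<noteq> a0" "j \<noteq> a0" for i j y
    proof -
      let ?G = "\<lambda>i a. partial i (\<lambda>y. g y $ a) y"
      have "(\<Sum>a\<in>UNIV. \<Sum>b\<in>UNIV. ?G j b * ?G i a * partial b (\<theta> a) (g y))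
          - (\<Sum>a\<in>UNIV. \<Sum>b\<in>UNIV. ?G i b * ?G j a * partial b (\<theta> a) (g y))
        = (\<Sum>a\<in>UNIV. \<Sum>b\<in>UNIV. ?G j b * ?G i a * partial b (\<theta> a) (g y))
          - (\<Sum>a\<in>UNIV. \<Sum>b\<in>UNIV. ?G i a * ?G j b * partial a (\<theta> b) (g y))"
        by (subst (2) sum.swap) (rule refl)
      also have "\<dots> = (\<Sum>a\<in>UNIV. \<Sum>b\<in>UNIV. ?G j b * ?G i a * (partial b (\<theta> a) (g y) - partial a (\<theta> b) (g y)))"
        by (simp add: sum_subtractf algebra_simps)
      also have "\<dots> = (\<Sum>a\<in>UNIV. \<Sum>b\<in>UNIV. (?G j b * \<pi> b (g y)) * (?G i a * partial a u (g y))
          - (?G i a * \<pi> a (g y)) * (?G j b * partial b u (g y)))"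
        by (simp add: closed[OF gV[OF y]] algebra_simps)
      also have "\<dots> = (\<Sum>b\<in>UNIV. ?G j b * \<pi> b (g y)) * (\<Sum>a\<in>UNIV. ?G i a * partial a u (g y))
          - (\<Sum>a\<in>UNIV. ?G i a * \<pi> a (g y)) * (\<Sum>b\<in>UNIV. ?G j b * partial b u (g y))"
        by (simp add: sum_subtractf sum_product) (subst sum.swap, rule refl)
      also have "\<dots> = 0" by (simp add: slice[OF y] ij)
      finally have 1: "(\<Sum>a\<in>UNIV. (\<Sum>b\<in>UNIV. ?G j b * partial b (\<theta> a) (g y)) * ?G i a)
          = (\<Sum>a\<in>UNIV. (\<Sum>b\<in>UNIV. ?G i b * partial b (\<theta> a) (g y)) * ?G j a)"
        by (simp add: sum_distrib_left sum_distrib_right ac_simps)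
      show ?thesis
        unfolding p\<eta>[OF y] 1 partial_commute[OF open_cube sg y, of i j] by (rule refl)
    qed
    note closed_slices = this
    obtain F where F: "smooth_on ?W F" "\<And>y i. y \<in> ?W \<Longrightarrow> i \<noteq> a0 \<Longrightarrow> partial i F y = \<eta> i y"
      by (rule potential_on_cube[of "\<Phi> p" r \<eta> "- {a0}", OF s\<eta>]) (auto simp: closed_slices)
    define f where "f x = F (\<Phi> x)" for x
    \<comment> \<open>\<open>F\<close> is a potential in the slice directions only; \<open>k\<close>
      measures its failure in the remaining direction and becomes the coefficient of du.\<close>
    define k where "k x = partial a0 F (\<Phi> x) - \<eta> a0 (\<Phi> x)" for x
    have comp': "smooth_on V (\<lambda>x. h (\<Phi> x))" if "smooth_on ?W h" for h :: "real^4 \<Rightarrow> real"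
      using smooth_on_compose[OF V(1) s\<Phi>V that] img by simp
    have "partial b f x = \<theta> b x + k x * partial b u x" if x: "x \<in> V" for x b
    proof -
      have "partial b f x = (\<Sum>i\<in>UNIV. partial b (\<lambda>x. \<Phi> x $ i) x * partial i F (\<Phi> x))"
        unfolding f_def using partial_compose[OF smooth_on_differentiable[OF F(1) \<Phi>W[OF x]] smooth_on_differentiable[OF s\<Phi>V x]]
        by simp
      also have "\<dots> = (\<Sum>i\<in>UNIV. partial b (\<lambda>x. \<Phi> x $ i) x * \<eta> i (\<Phi> x)
          + (if i = a0 then partial b u x * k x else 0))"
        by (intro sum.cong) (auto simp: F(2)[OF \<Phi>W[OF x]] \<Phi>i k_def algebra_simps)
      also have "\<dots> = (\<Sum>i\<in>UNIV. \<Sum>a\<in>UNIV. \<theta> a x * (partial b (\<lambda>x. \<Phi> x $ i) x * partial i (\<lambda>y. g y $ a) (\<Phi> x))) + partial b u x * k x"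
        by (simp add: sum.distrib \<eta>_def g\<Phi>[OF x] sum_distrib_left ac_simps)
      also have "\<dots> = (\<Sum>a\<in>UNIV. \<theta> a x * (\<Sum>i\<in>UNIV. partial b (\<lambda>x. \<Phi> x $ i) x * partial i (\<lambda>y. g y $ a) (\<Phi> x))) + partial b u x * k x"
        by (subst sum.swap) (simp add: sum_distrib_left)
      also have "\<dots> = \<theta> b x + k x * partial b u x"
        by (simp add: partial_chart_inverse[OF V(1) x smooth_on_differentiable[OF s\<Phi>V x] smooth_on_differentiable[OF g \<Phi>W[OF x]] g\<Phi>]
            if_distrib cong: if_cong)
      finally show ?thesis .
    qed
    moreover have "smooth_on V f" unfolding f_def[abs_def] by (rule comp'[OF F(1)])
    moreover have "smooth_on V k" unfolding k_def[abs_def]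
      by (intro smooth_on_diff comp' smooth_on_partial F(1) s\<eta> V(1))
    ultimately show "\<exists>f k. smooth_on V f \<and> smooth_on V k \<and> (\<forall>x\<in>V. \<forall>b. partial b f x = \<theta> b x + k x * partial b u x)"
      by blast
  qed
qed

section \<open>Metric, connection and curvature\<close>

definition mpartial :: "4 \<Rightarrow> (real^4 \<Rightarrow> real^4^4) \<Rightarrow> real^4 \<Rightarrow> real^4^4" where
  "mpartial c M x = (\<chi> a b. partial c (\<lambda>y. M y $ a $ b) x)"

lemma mpartial_mult:
  assumes "\<And>a b. (\<lambda>y. M y $ a $ b) differentiable (at x)" "\<And>a b. (\<lambda>y. N y $ a $ b) differentiable (at x)"
  shows "mpartial c (\<lambda>y. M y ** N y) x = mpartial c M x ** N x + M x ** mpartial c N x"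
proof -
  have "partial c (\<lambda>y. \<Sum>k\<in>UNIV. M y $ a $ k * N y $ k $ b) x
      = (\<Sum>k\<in>UNIV. partial c (\<lambda>y. M y $ a $ k) x * N x $ k $ b + M x $ a $ k * partial c (\<lambda>y. N y $ k $ b) x)" for a b
  proof -
    have "(\<lambda>y. M y $ a $ k * N y $ k $ b) differentiable (at x)" for k
      using assms by (intro differentiable_mult)
    then show ?thesis by (simp add: partial_sum partial_mult assms)
  qed
  then show ?thesis
    by (simp add: mpartial_def matrix_matrix_mult_def vec_eq_iff sum.distrib)
qed

lemma transpose_add: "transpose (A + B) = transpose A + transpose (B :: real^'n^'m)"
  by (simp add: transpose_def vec_eq_iff)

lemma matrix_add_rdistrib: "(A + B) ** C = A ** C + B ** (C :: real^'n^'n)"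
  by (simp add: matrix_matrix_mult_def vec_eq_iff distrib_right sum.distrib)

lemma matrix_mult_diff_right: "C ** (A - B) = C ** A - C ** (B :: real^'n^'n)"
  by (simp add: matrix_matrix_mult_def vec_eq_iff right_diff_distrib sum_subtractf)

lemma smooth_intros_vec_lambda:
  fixes f :: "real^4 \<Rightarrow> 4 \<Rightarrow> 4 \<Rightarrow> real"
  assumes "open S" "\<And>a b. smooth_on S (\<lambda>x. f x a b)"
  shows "smooth_on S (\<lambda>x. \<chi> a b. f x a b)"
  by (intro smooth_on_vec assms(1)) (simp add: assms(2))

text \<open>For a fixed derivative index \<open>c\<close> the connection as a matrix: curvature is
  then an exterior derivative plus a commutator, and index sums become matrix products.\<close>

definition chr :: "(real^4 \<Rightarrow> real^4^4) \<Rightarrow> 4 \<Rightarrow> real^4 \<Rightarrow> real^4^4" where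
  "chr g c x = (\<chi> a b. christoffel g x a c b)"

definition cov :: "(real^4 \<Rightarrow> real^4^4) \<Rightarrow> (4 \<Rightarrow> real^4 \<Rightarrow> real) \<Rightarrow> 4 \<Rightarrow> 4 \<Rightarrow> real^4 \<Rightarrow> real" where
  "cov g \<theta> c a x = partial c (\<theta> a) x - (\<Sum>e\<in>UNIV. christoffel g x e c a * \<theta> e x)"

definition cov2 :: "(real^4 \<Rightarrow> real^4^4) \<Rightarrow> (4 \<Rightarrow> 4 \<Rightarrow> real^4 \<Rightarrow> real) \<Rightarrow> 4 \<Rightarrow> 4 \<Rightarrow> 4 \<Rightarrow> real^4 \<Rightarrow> real" where
  "cov2 g M d c a x = partial d (M c a) x
     - (\<Sum>e\<in>UNIV. christoffel g x e d c * M e a x) - (\<Sum>e\<in>UNIV. christoffel g x e d a * M c e x)"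

definition ip :: "(real^4 \<Rightarrow> real^4^4) \<Rightarrow> (4 \<Rightarrow> real^4 \<Rightarrow> real) \<Rightarrow> (4 \<Rightarrow> real^4 \<Rightarrow> real) \<Rightarrow> real^4 \<Rightarrow> real" where
  "ip g \<theta> \<phi> x = (\<Sum>a\<in>UNIV. \<Sum>b\<in>UNIV. ginv g x a b * \<theta> a x * \<phi> b x)"

lemma spacetime_subset: "spacetime U g w \<Longrightarrow> open V \<Longrightarrow> V \<subseteq> U \<Longrightarrow> spacetime V g w"
  unfolding spacetime_def using smooth_on_subset[of U g V] smooth_on_subset[of U w V] by auto

locale spacetime_on =
  fixes U :: "(real^4) set" and g :: "real^4 \<Rightarrow> real^4^4" and w :: "real^4 \<Rightarrow> real"
  assumes spacetime: "spacetime U g w"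
begin

lemma open_U: "open U"
  using spacetime by (simp add: spacetime_def)

lemma smooth_g: "smooth_on U (\<lambda>x. g x $ a $ b)"
  using spacetime by (auto simp: spacetime_def intro!: smooth_on_nth)

lemma det_minkowski: "det minkowski = -1"
proof -
  have "det minkowski = (\<Prod>i\<in>(UNIV::4 set). minkowski $ i $ i)"
    by (rule det_diagonal) (simp add: minkowski_def)
  also have "\<dots> = -1" unfolding UNIV_4 by (simp add: minkowski_def)
  finally show ?thesis .
qed

lemma det_g:
  assumes "x \<in> U"
  shows "det (g x) \<noteq> 0"
proof -
  obtain P where "transpose P ** g x ** P = minkowski"
    using spacetime assms unfolding spacetime_def lorentzian_def by metis
  then have "det (transpose P) * det (g x) * det P = -1"
    using det_minkowski det_mul by metis
  then show ?thesis by auto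
qed

lemma invertible_g: "x \<in> U \<Longrightarrow> invertible (g x)"
  using det_g by (simp add: invertible_det_nz)

text \<open>Symmetry is no separate axiom of \<open>spacetime\<close>: \<open>g x\<close> is
  congruent to the symmetric matrix \<open>minkowski\<close>, and congruence by an invertible matrix
  is injective.\<close>

lemma transpose_g: "x \<in> U \<Longrightarrow> transpose (g x) = g x"
proof -
  assume "x \<in> U"
  then obtain P where P: "invertible P" "transpose P ** g x ** P = minkowski"
    using spacetime by (auto simp: spacetime_def lorentzian_def)
  obtain Q where Q: "P ** Q = mat 1" using P(1) by (auto simp: invertible_def)
  then have Q': "transpose Q ** transpose P = mat 1" by (metis matrix_transpose_mul transpose_mat)
  have X: "X = transpose Q ** (transpose P ** X ** P) ** Q" for X :: "real^4^4"
  proof -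
    have "transpose Q ** (transpose P ** X ** P) ** Q = (transpose Q ** transpose P) ** X ** (P ** Q)"
      by (simp only: matrix_mul_assoc)
    then show ?thesis using Q Q' by simp
  qed
  have "transpose (transpose P ** g x ** P) = transpose (minkowski)" using P by simp
  then have "transpose P ** transpose (g x) ** P = minkowski"
    by (simp add: matrix_transpose_mul matrix_mul_assoc) (simp add: minkowski_def transpose_def vec_eq_iff)
  then show ?thesis using X[of "g x"] X[of "transpose (g x)"] P(2) by simp
qed

lemma g_sym: "x \<in> U \<Longrightarrow> g x $ a $ b = g x $ b $ a"
  using arg_cong[OF transpose_g, of x "\<lambda>M. M $ b $ a"] by (simp add: transpose_def)

lemma transpose_inv_g: "x \<in> U \<Longrightarrow> transpose (matrix_inv (g x)) = matrix_inv (g x)"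
proof -
  assume x: "x \<in> U"
  have "transpose (matrix_inv (g x)) ** g x = mat 1"
    using arg_cong[OF matrix_inv_right[OF invertible_g[OF x]], of transpose] transpose_g[OF x]
    by (simp add: matrix_transpose_mul)
  then have "transpose (matrix_inv (g x)) ** (g x ** matrix_inv (g x)) = matrix_inv (g x)"
    by (simp add: matrix_mul_assoc)
  then show ?thesis using matrix_inv_right[OF invertible_g[OF x]] by simp
qed

lemma ginv_sym: "x \<in> U \<Longrightarrow> ginv g x a b = ginv g x b a"
  using arg_cong[OF transpose_inv_g, of x "\<lambda>M. M $ b $ a"] by (simp add: transpose_def ginv_def)

lemma g_ginv: "x \<in> U \<Longrightarrow> (\<Sum>b\<in>UNIV. g x $ a $ b * ginv g x b c) = (if a = c then 1 else 0)"
  using arg_cong[OF matrix_inv_right[OF invertible_g], of x "\<lambda>M. M $ a $ c"]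
  by (simp add: matrix_matrix_mult_def ginv_def mat_def)

lemma ginv_g: "x \<in> U \<Longrightarrow> (\<Sum>b\<in>UNIV. ginv g x a b * g x $ b $ c) = (if a = c then 1 else 0)"
  using arg_cong[OF matrix_inv_left[OF invertible_g], of x "\<lambda>M. M $ a $ c"]
  by (simp add: matrix_matrix_mult_def ginv_def mat_def)

lemma smooth_ginv: "smooth_on U (\<lambda>x. ginv g x a b)"
  unfolding ginv_def
  by (intro smooth_onI Ck_on_matrix_inv open_U smooth_onD[OF smooth_g] invertible_g)

lemma smooth_christoffel: "smooth_on U (\<lambda>x. christoffel g x a b c)"
  unfolding christoffel_def
  by (intro smooth_on_divide smooth_intros smooth_on_partial smooth_g smooth_ginv open_U) simp

lemma smooth_cov: "(\<And>a. smooth_on V (\<theta> a)) \<Longrightarrow> open V \<Longrightarrow> V \<subseteq> U \<Longrightarrow> smooth_on V (cov g \<theta> c a)"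
  unfolding cov_def[abs_def]
  by (intro smooth_intros smooth_on_subset[OF smooth_christoffel])

lemma smooth_chr: "smooth_on U (\<lambda>x. chr g c x $ a $ b)"
  by (simp add: chr_def smooth_christoffel)

lemma christoffel_sym: "x \<in> U \<Longrightarrow> christoffel g x a b c = christoffel g x a c b"
proof -
  assume x: "x \<in> U"
  have "partial d (\<lambda>y. g y $ b $ c) x = partial d (\<lambda>y. g y $ c $ b) x" for d
    by (rule partial_cong[OF open_U x]) (rule g_sym)
  then show ?thesis unfolding christoffel_def by (simp add: add.commute)
qed

lemma christoffel_lower:
  assumes x: "x \<in> U"
  shows "(g x ** chr g c x) $ a $ b = (partial c (\<lambda>y. g y $ a $ b) x + partial b (\<lambda>y. g y $ a $ c) x
      - partial a (\<lambda>y. g y $ c $ b) x) / 2"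
proof -
  let ?K = "\<lambda>d. partial c (\<lambda>y. g y $ d $ b) x + partial b (\<lambda>y. g y $ d $ c) x - partial d (\<lambda>y. g y $ c $ b) x"
  have "(g x ** chr g c x) $ a $ b = (\<Sum>e\<in>UNIV. \<Sum>d\<in>UNIV. g x $ a $ e * ginv g x e d * ?K d) / 2"
    by (simp add: matrix_matrix_mult_def chr_def christoffel_def sum_distrib_left sum_divide_distrib mult.assoc)
  also have "(\<Sum>e\<in>UNIV. \<Sum>d\<in>UNIV. g x $ a $ e * ginv g x e d * ?K d) = (\<Sum>d\<in>UNIV. (\<Sum>e\<in>UNIV. g x $ a $ e * ginv g x e d) * ?K d)"
    by (subst sum.swap) (simp only: sum_distrib_right)
  also have "\<dots> = ?K a" by (simp add: g_ginv[OF x] if_distribR if_distrib cong: if_cong)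
  finally show ?thesis .
qed

text \<open>In the lowered Christoffel symbol two of the three derivatives of \<open>g\<close> form
  a part antisymmetric in the two matrix indices; adding the transpose cancels it.\<close>

lemma metric_compatible:
  assumes x: "x \<in> U"
  shows "mpartial c g x = g x ** chr g c x + transpose (g x ** chr g c x)"
proof -
  have "partial d (\<lambda>y. g y $ b $ c) x = partial d (\<lambda>y. g y $ c $ b) x" for b c d
    by (rule partial_cong[OF open_U x]) (rule g_sym)
  then show ?thesis
    by (simp add: vec_eq_iff mpartial_def transpose_def christoffel_lower[OF x]) (simp add: field_simps)
qed

text \<open>Differentiation of the product of \<open>g\<close> and its inverse, followed by metric
  compatibility.\<close>

lemma mpartial_inv_g:
  assumes x: "x \<in> U"
  shows "mpartial c (\<lambda>y. matrix_inv (g y)) x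
    = - (chr g c x ** matrix_inv (g x)) - transpose (chr g c x ** matrix_inv (g x))"
proof -
  let ?G = "matrix_inv (g x)" and ?C = "chr g c x"
  have "mpartial c (\<lambda>y. g y ** matrix_inv (g y)) x = 0"
  proof -
    have "partial c (\<lambda>y. (g y ** matrix_inv (g y)) $ a $ b) x = partial c (\<lambda>y. mat 1 $ a $ b) x" for a b
      by (rule partial_cong[OF open_U x]) (simp add: matrix_inv_right[OF invertible_g])
    then show ?thesis by (simp add: mpartial_def vec_eq_iff)
  qed
  moreover have "mpartial c (\<lambda>y. g y ** matrix_inv (g y)) x = mpartial c g x ** ?G + g x ** mpartial c (\<lambda>y. matrix_inv (g y)) x"
    using smooth_on_differentiable[OF smooth_g x] smooth_on_differentiable[OF smooth_ginv x]
    by (intro mpartial_mult) (simp_all add: ginv_def)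
  ultimately have "g x ** mpartial c (\<lambda>y. matrix_inv (g y)) x = - (mpartial c g x ** ?G)"
    by (simp add: eq_neg_iff_add_eq_0 add.commute)
  then have "?G ** (g x ** mpartial c (\<lambda>y. matrix_inv (g y)) x) = ?G ** (- (mpartial c g x ** ?G))" by simp
  then have "mpartial c (\<lambda>y. matrix_inv (g y)) x = ?G ** (0 - (mpartial c g x ** ?G))"
    by (simp add: matrix_mul_assoc matrix_inv_left[OF invertible_g[OF x]])
  also have "\<dots> = - (?G ** mpartial c g x ** ?G)"
    by (simp only: matrix_mult_diff_right matrix_mul_assoc) (simp add: matrix_matrix_mult_def vec_eq_iff)
  also have "?G ** mpartial c g x ** ?G = (?G ** g x) ** ?C ** ?G + ?G ** transpose ?C ** (g x ** ?G)"
    by (simp add: metric_compatible[OF x] matrix_transpose_mul transpose_g[OF x] matrix_add_ldistrib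
        matrix_add_rdistrib matrix_mul_assoc)
  also have "\<dots> = ?C ** ?G + transpose (?C ** ?G)"
    by (simp add: matrix_inv_left matrix_inv_right invertible_g[OF x] matrix_transpose_mul transpose_inv_g[OF x])
  finally show ?thesis by simp
qed

lemma partial_ginv:
  assumes x: "x \<in> U"
  shows "partial c (\<lambda>y. ginv g y a b) x
    = - (\<Sum>e\<in>UNIV. christoffel g x a c e * ginv g x e b) - (\<Sum>e\<in>UNIV. christoffel g x b c e * ginv g x e a)"
  using arg_cong[OF mpartial_inv_g[OF x, of c], of "\<lambda>M. M $ a $ b"]
  by (simp add: mpartial_def matrix_matrix_mult_def chr_def transpose_def ginv_def)

lemma partial_ip:
  assumes x: "x \<in> V" "V \<subseteq> U" and \<theta>: "\<And>a. smooth_on V (\<theta> a)" and \<phi>: "\<And>a. smooth_on V (\<phi> a)" and V: "open V"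
  shows "partial c (ip g \<theta> \<phi>) x = ip g (cov g \<theta> c) \<phi> x + ip g \<theta> (cov g \<phi> c) x"
proof -
  have xU: "x \<in> U" using x by auto
  note d = smooth_on_differentiable[OF \<theta> x(1)] smooth_on_differentiable[OF \<phi> x(1)] smooth_on_differentiable[OF smooth_ginv xU]
  have "partial c (ip g \<theta> \<phi>) x = (\<Sum>a\<in>UNIV. \<Sum>b\<in>UNIV. partial c (\<lambda>x. ginv g x a b * \<theta> a x * \<phi> b x) x)"
    unfolding ip_def[abs_def] using d by (simp add: partial_sum differentiable_mult differentiable_sum)
  also have "\<dots> = (\<Sum>a\<in>UNIV. \<Sum>b\<in>UNIV. partial c (\<lambda>x. ginv g x a b) x * \<theta> a x * \<phi> b x
      + ginv g x a b * partial c (\<theta> a) x * \<phi> b x + ginv g x a b * \<theta> a x * partial c (\<phi> b) x)"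
    using d by (intro sum.cong refl) (simp add: partial_mult differentiable_mult algebra_simps)
  finally show ?thesis
    unfolding partial_ginv[OF xU] ip_def cov_def
    using ginv_sym[OF xU, of 2 1] ginv_sym[OF xU, of 3 1] ginv_sym[OF xU, of 4 1]
      ginv_sym[OF xU, of 3 2] ginv_sym[OF xU, of 4 2] ginv_sym[OF xU, of 4 3]
    by (simp add: sum_4 algebra_simps)
qed

lemma riemann_up_matrix:
  assumes x: "x \<in> U"
  shows "riemann_up g x a b c d = (mpartial c (chr g d) x - mpartial d (chr g c) x
     + (chr g c x ** chr g d x - chr g d x ** chr g c x)) $ a $ b"
  by (simp add: riemann_up_def mpartial_def chr_def matrix_matrix_mult_def sum_subtractf)

lemma riemann_matrix:
  assumes x: "x \<in> U"
  shows "riemann g x a b c d = (g x ** (mpartial c (chr g d) x - mpartial d (chr g c) x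
     + (chr g c x ** chr g d x - chr g d x ** chr g c x))) $ a $ b"
  by (simp add: riemann_def riemann_up_matrix[OF x] matrix_matrix_mult_def)

lemma mpartial_commute:
  assumes x: "x \<in> U"
  shows "mpartial c (mpartial d g) x = mpartial d (mpartial c g) x"
  by (simp add: mpartial_def vec_eq_iff partial_commute[OF open_U smooth_g x])

lemma second_mpartial_g:
  assumes x: "x \<in> U"
  defines "K c d \<equiv> transpose (chr g d x) ** g x ** chr g c x + g x ** chr g d x ** chr g c x + g x ** mpartial d (chr g c) x"
  shows "mpartial d (mpartial c g) x = K c d + transpose (K c d)"
proof -
  have "mpartial d (mpartial c g) x = mpartial d (\<lambda>y. g y ** chr g c y + transpose (g y ** chr g c y)) x"
    unfolding mpartial_def[of d]
    using metric_compatible by (intro arg_cong[where f=vec_lambda] ext partial_cong[OF open_U x]) simp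
  also have "\<dots> = mpartial d (\<lambda>y. g y ** chr g c y) x + transpose (mpartial d (\<lambda>y. g y ** chr g c y) x)"
  proof -
    have "(\<lambda>y. (g y ** chr g c y) $ a $ b) differentiable (at x)" for a b
      unfolding matrix_matrix_mult_def using smooth_on_differentiable[OF smooth_g x] smooth_on_differentiable[OF smooth_chr x]
      by (simp add: differentiable_sum differentiable_mult)
    then show ?thesis by (simp add: mpartial_def transpose_def vec_eq_iff partial_add)
  qed
  also have "mpartial d (\<lambda>y. g y ** chr g c y) x = K c d"
    using mpartial_mult[OF smooth_on_differentiable[OF smooth_g x] smooth_on_differentiable[OF smooth_chr x], of d c]
    by (simp add: K_def metric_compatible[OF x] matrix_transpose_mul transpose_g[OF x] matrix_add_rdistrib matrix_mul_assoc)
  finally show ?thesis .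
qed

text \<open>Second partial derivatives of the metric commute. Rewritten by metric compatibility,
  this says that \<open>T d c - T c d\<close>, the lowered curvature, is antisymmetric: the terms
  \<open>S\<close> are exchanged by transposition and drop out.\<close>

lemma riemann_antisym:
  assumes x: "x \<in> U"
  shows "riemann g x a b c d = - riemann g x b a c d"
proof -
  define S where "S c d = transpose (chr g d x) ** g x ** chr g c x" for c d
  define T where "T c d = g x ** chr g d x ** chr g c x + g x ** mpartial d (chr g c) x" for c d
  have S: "transpose (S c d) = S d c" for c d
    by (simp add: S_def matrix_transpose_mul transpose_g[OF x] matrix_mul_assoc)
  have "S c d + T c d + transpose (S c d + T c d) = S d c + T d c + transpose (S d c + T d c)"
    using second_mpartial_g[OF x, of c d] second_mpartial_g[OF x, of d c] mpartial_commute[OF x, of c d]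
    unfolding S_def T_def by (simp add: add.assoc)
  then have "T c d + transpose (T c d) = T d c + transpose (T d c)"
    unfolding transpose_add S by (simp add: algebra_simps)
  then have "(T d c + transpose (T d c)) $ a $ b = (T c d + transpose (T c d)) $ a $ b" by simp
  then have "(T d c - T c d) $ a $ b = - (T d c - T c d) $ b $ a" by (simp add: transpose_def)
  moreover have "riemann g x a b c d = (T d c - T c d) $ a $ b" for a b
    unfolding riemann_matrix[OF x] T_def
    by (simp add: matrix_add_ldistrib matrix_mult_diff_right matrix_mul_assoc)
  ultimately show ?thesis by simp
qed

lemma riemann_antisym2: "riemann g x a b c d = - riemann g x a b d c"
proof -
  have "riemann_up g x e b c d = - riemann_up g x e b d c" for e
    by (simp add: riemann_up_def sum_subtractf)
  then show ?thesis unfolding riemann_def by (simp add: sum_negf[symmetric])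
qed

lemma riemann_cyclic:
  assumes x: "x \<in> U"
  shows "riemann g x a b c d + riemann g x a c d b + riemann g x a d b c = 0"
proof -
  have p: "partial e (\<lambda>y. christoffel g y a b c) x = partial e (\<lambda>y. christoffel g y a c b) x" for a b c e
    by (rule partial_cong[OF open_U x]) (rule christoffel_sym)
  have "riemann_up g x e b c d + riemann_up g x e c d b + riemann_up g x e d b c = 0" for e
    unfolding riemann_up_def p[of _ e d b] p[of _ e c b] p[of _ e d c]
      christoffel_sym[OF x, of _ d b] christoffel_sym[OF x, of _ c b] christoffel_sym[OF x, of _ d c]
    by (simp add: sum_subtractf algebra_simps)
  then have "(\<Sum>e\<in>UNIV. g x $ a $ e * (riemann_up g x e b c d + riemann_up g x e c d b + riemann_up g x e d b c)) = 0"
    by simp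
  then show ?thesis by (simp add: riemann_def distrib_left sum.distrib)
qed

text \<open>Four instances of the cyclic identity, added with suitable signs, cancel by the
  antisymmetries within the two index pairs.\<close>

lemma riemann_pair_sym:
  assumes x: "x \<in> U"
  shows "riemann g x a b c d = riemann g x c d a b"
  using riemann_cyclic[OF x, of a b c d] riemann_cyclic[OF x, of b c d a]
    riemann_cyclic[OF x, of c d a b] riemann_cyclic[OF x, of d a b c]
    riemann_antisym[OF x] riemann_antisym2[of x] 
  by (smt (verit))

text \<open>Turns curvature into second derivatives of one-forms: applied to the forms of a frame it
  delivers the components of the Riemann tensor.\<close>

lemma ricci_identity:
  assumes x: "x \<in> V" "V \<subseteq> U" "open V" and \<theta>: "\<And>a. smooth_on V (\<theta> a)"
  shows "cov2 g (cov g \<theta>) d c a x - cov2 g (cov g \<theta>) c d a x = - (\<Sum>e\<in>UNIV. riemann_up g x e a d c * \<theta> e x)"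
proof -
  have xU: "x \<in> U" using x by auto
  note dG = smooth_on_differentiable[OF smooth_christoffel xU]
  note dt = smooth_on_differentiable[OF \<theta> x(1)]
  have P: "partial d (cov g \<theta> c a) x = partial d (partial c (\<theta> a)) x
      - (\<Sum>e\<in>UNIV. partial d (\<lambda>y. christoffel g y e c a) x * \<theta> e x + christoffel g x e c a * partial d (\<theta> e) x)" for d c a
  proof -
    have "partial d (cov g \<theta> c a) x = partial d (partial c (\<theta> a)) x - partial d (\<lambda>x. \<Sum>e\<in>UNIV. christoffel g x e c a * \<theta> e x) x"
      unfolding cov_def[abs_def] using dG dt
      by (intro partial_diff smooth_on_differentiable[OF smooth_on_partial[OF \<theta>] x(1)] differentiable_sum differentiable_mult) auto
    also have "partial d (\<lambda>x. \<Sum>e\<in>UNIV. christoffel g x e c a * \<theta> e x) x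
        = (\<Sum>e\<in>UNIV. partial d (\<lambda>x. christoffel g x e c a * \<theta> e x) x)"
      using dG dt by (intro partial_sum differentiable_mult)
    also have "\<dots> = (\<Sum>e\<in>UNIV. partial d (\<lambda>y. christoffel g y e c a) x * \<theta> e x + christoffel g x e c a * partial d (\<theta> e) x)"
      by (intro sum.cong refl partial_mult dG dt)
    finally show ?thesis .
  qed
  have c: "partial d (partial c (\<theta> a)) x = partial c (partial d (\<theta> a)) x"
    by (rule partial_commute[OF x(3) \<theta> x(1)])
  show ?thesis
    unfolding cov2_def P c riemann_up_def christoffel_sym[OF xU, of _ c d]
    by (simp add: cov_def sum_4 algebra_simps)
qed

end

section \<open>Null frames\<close>

text \<open>A null frame consists of the one-forms \<open>F 1\<close>, \<open>F 2\<close>, \<open>F 3\<close>, \<open>F 4\<close>, written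
  $\ell, n, p, q$ on paper, with $(\ell,n)=-1$, $(p,p)=(q,q)=1$ and all other products zero.\<close>

definition nullm :: "4 \<Rightarrow> 4 \<Rightarrow> real" where
  "nullm i j = (if i = 1 \<and> j = 2 \<or> i = 2 \<and> j = 1 then -1 else if i = j \<and> (i = 3 \<or> i = 4) then 1 else 0)"

lemma nullm_sym: "nullm i j = nullm j i"
  by (auto simp: nullm_def)

lemma nullm_simps [simp]:
  "nullm 1 1 = 0" "nullm 1 2 = -1" "nullm 1 3 = 0" "nullm 1 4 = 0"
  "nullm 2 1 = -1" "nullm 2 2 = 0" "nullm 2 3 = 0" "nullm 2 4 = 0"
  "nullm 3 1 = 0" "nullm 3 2 = 0" "nullm 3 3 = 1" "nullm 3 4 = 0"
  "nullm 4 1 = 0" "nullm 4 2 = 0" "nullm 4 3 = 0" "nullm 4 4 = 1"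
  by (simp_all add: nullm_def)

lemma sum_kronecker:
  fixes f :: "'a::finite \<Rightarrow> real"
  shows "(\<Sum>c\<in>UNIV. (if a = c then 1 else 0) * f c) = f a" "(\<Sum>c\<in>UNIV. (if c = a then 1 else 0) * f c) = f a"
proof -
  have "(\<lambda>c. (if a = c then 1 else 0) * f c) = (\<lambda>c. if a = c then f c else 0)"
    "(\<lambda>c. (if c = a then 1 else 0) * f c) = (\<lambda>c. if c = a then f c else 0)" by auto
  note * = this
  show "(\<Sum>c\<in>UNIV. (if a = c then 1 else 0) * f c) = f a" "(\<Sum>c\<in>UNIV. (if c = a then 1 else 0) * f c) = f a"
    unfolding * by simp_all
qed

text \<open>Contraction of a vector with a function of one index. Nested, it evaluates tensors on
  frame vectors, and \<open>con_swap\<close> lets the slots be reordered.\<close>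

definition con :: "(4 \<Rightarrow> real) \<Rightarrow> (4 \<Rightarrow> real) \<Rightarrow> real" where
  "con e f = (\<Sum>a\<in>UNIV. e a * f a)"

lemma con_simps:
  "con e (\<lambda>a. f a + h a) = con e f + con e h"
  "con e (\<lambda>a. f a - h a) = con e f - con e h"
  "con e (\<lambda>a. - f a) = - con e f"
  "con e (\<lambda>a. c * f a) = c * con e f"
  "con e (\<lambda>a. f a * c) = con e f * c"
  "con e (\<lambda>a. 0) = 0"
  by (simp_all add: con_def sum.distrib sum_subtractf sum_negf sum_distrib_left sum_distrib_right algebra_simps)

lemma con_swap: "con e (\<lambda>a. con f (\<lambda>b. T a b)) = con f (\<lambda>b. con e (\<lambda>a. T a b))"
  unfolding con_def sum_distrib_left by (subst sum.swap) (simp add: mult.left_commute)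

lemma con_swap_pairs:
  "con e (\<lambda>a. con f (\<lambda>b. con h (\<lambda>c. con k (\<lambda>d. T a b c d))))
    = con h (\<lambda>c. con k (\<lambda>d. con e (\<lambda>a. con f (\<lambda>b. T a b c d))))"
  by (simp only: con_swap[of f h] con_swap[of f k] con_swap[of e h] con_swap[of e k])

lemma cov2_prod:
  assumes "x \<in> V" "\<And>a. smooth_on V (\<theta> a)" "\<And>a. smooth_on V (\<phi> a)"
  shows "cov2 g (\<lambda>c a x. \<theta> c x * \<phi> a x) d c a x = cov g \<theta> d c x * \<phi> a x + \<theta> c x * cov g \<phi> d a x"
  using smooth_on_differentiable[OF assms(2) assms(1)] smooth_on_differentiable[OF assms(3) assms(1)]
  by (simp add: cov2_def cov_def partial_mult sum_distrib_left sum_distrib_right algebra_simps)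

lemma cov2_diff:
  assumes "(M c a) differentiable (at x)" "(N c a) differentiable (at x)"
  shows "cov2 g (\<lambda>c a x. M c a x - N c a x) d c a x = cov2 g M d c a x - cov2 g N d c a x"
  using assms by (simp add: cov2_def partial_diff sum_subtractf algebra_simps)

lemma cov2_cong:
  assumes "open V" "x \<in> V" "\<And>y c a. y \<in> V \<Longrightarrow> M c a y = N c a y"
  shows "cov2 g M d c a x = cov2 g N d c a x"
proof -
  have "partial d (M c a) x = partial d (N c a) x"
    using assms by (intro partial_cong[of V]) auto
  then show ?thesis by (simp add: cov2_def assms(2,3))
qed

lemma cov_scale:
  assumes "x \<in> V" "smooth_on V f" "\<And>a. smooth_on V (\<theta> a)"
  shows "cov g (\<lambda>a x. f x * \<theta> a x) c a x = partial c f x * \<theta> a x + f x * cov g \<theta> c a x"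
  using smooth_on_differentiable[OF assms(2) assms(1)] smooth_on_differentiable[OF assms(3) assms(1)]
  by (simp add: cov_def partial_mult sum_distrib_left algebra_simps)

lemma cov_add:
  assumes "x \<in> V" "\<And>a. smooth_on V (\<theta> a)" "\<And>a. smooth_on V (\<phi> a)"
  shows "cov g (\<lambda>a x. \<theta> a x + \<phi> a x) c a x = cov g \<theta> c a x + cov g \<phi> c a x"
  using smooth_on_differentiable[OF assms(2) assms(1)] smooth_on_differentiable[OF assms(3) assms(1)]
  by (simp add: cov_def partial_add sum.distrib algebra_simps)

lemma nabla_cov2: "nabla g A x c a b = cov2 g (\<lambda>a b x. A x $ a $ b) c a b x"
  by (simp add: nabla_def cov2_def)

text \<open>These are the frame forms with index raised, not the dual basis: the pairings are those
  of \<open>nullm\<close>, so \<open>E 1\<close> and \<open>E 2\<close> are paired with each other's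
  forms, with a minus sign. This explains the crossed indices and the signs in all expansions
  below.\<close>

definition raise :: "(real^4 \<Rightarrow> real^4^4) \<Rightarrow> (4 \<Rightarrow> 4 \<Rightarrow> real^4 \<Rightarrow> real) \<Rightarrow> 4 \<Rightarrow> real^4 \<Rightarrow> 4 \<Rightarrow> real" where
  "raise g F i x a = (\<Sum>b\<in>UNIV. ginv g x a b * F i b x)"

locale null_frame = spacetime_on V g w for V g w +
  fixes F :: "4 \<Rightarrow> 4 \<Rightarrow> real^4 \<Rightarrow> real"
  assumes smooth_F: "smooth_on V (F i a)"
    and ip_F: "x \<in> V \<Longrightarrow> ip g (F i) (F j) x = nullm i j"
begin

abbreviation E where "E \<equiv> raise g F"

lemma smooth_E: "smooth_on V (\<lambda>x. E i x a)"
  unfolding raise_def by (intro smooth_intros smooth_ginv smooth_F open_U)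

lemma con_E: "x \<in> V \<Longrightarrow> con (E i x) (\<lambda>a. \<theta> a x) = ip g (F i) \<theta> x"
  unfolding con_def raise_def ip_def sum_distrib_right
  by (subst sum.swap) (simp add: ginv_sym[of x] ac_simps)

lemma ip_sym: "x \<in> V \<Longrightarrow> ip g \<theta> \<phi> x = ip g \<phi> \<theta> x"
  unfolding ip_def by (subst sum.swap) (simp add: ginv_sym[of x] ac_simps)

lemma con_E_F: "x \<in> V \<Longrightarrow> con (E i x) (\<lambda>a. F j a x) = nullm i j"
  by (simp add: con_E ip_F)

text \<open>The products of the frame say that the matrix of forms times that of vectors is
  \<open>N\<close>, where \<open>N ** N = mat 1\<close>. A one-sided inverse of a square matrix is
  two-sided, and the product in the other order is the resolution of the identity.\<close>

lemma completeness:
  assumes x: "x \<in> V"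
  shows "- E 1 x a * F 2 b x - E 2 x a * F 1 b x + E 3 x a * F 3 b x + E 4 x a * F 4 b x = (if a = b then 1 else 0)"
proof -
  define \<Theta> :: "real^4^4" where "\<Theta> = (\<chi> i a. F i a x)"
  define R :: "real^4^4" where "R = (\<chi> a i. E i x a)"
  define N :: "real^4^4" where "N = (\<chi> i j. nullm i j)"
  have 1: "\<Theta> ** R = N"
    using con_E_F[OF x]
    by (simp add: \<Theta>_def R_def N_def matrix_matrix_mult_def vec_eq_iff con_def mult.commute nullm_sym)
  have "(\<Sum>k\<in>UNIV. nullm i k * nullm k j) = (if i = j then 1 else 0)" for i j
    using exhaust_4[of i] exhaust_4[of j] by (elim disjE) (simp_all add: sum_4)
  then have "N ** N = mat 1"
    by (simp add: N_def matrix_matrix_mult_def vec_eq_iff mat_def)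
  then have "\<Theta> ** (R ** N) = mat 1" using 1 by (simp add: matrix_mul_assoc)
  then have "(R ** N) ** \<Theta> = mat 1" by (simp add: matrix_left_right_inverse)
  from arg_cong[OF this, of "\<lambda>M. M $ a $ b"] show ?thesis
    by (simp add: R_def N_def \<Theta>_def matrix_matrix_mult_def mat_def sum_4)
qed

lemma frame_expand:
  assumes x: "x \<in> V"
  shows "f b = - con (E 1 x) f * F 2 b x - con (E 2 x) f * F 1 b x + con (E 3 x) f * F 3 b x + con (E 4 x) f * F 4 b x"
proof -
  have "f b = (\<Sum>a\<in>UNIV. (if a = b then 1 else 0) * f a)" by (simp add: sum_kronecker)
  also have "\<dots> = (\<Sum>a\<in>UNIV. (- E 1 x a * F 2 b x - E 2 x a * F 1 b x + E 3 x a * F 3 b x + E 4 x a * F 4 b x) * f a)"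
    by (simp only: completeness[OF x])
  finally show ?thesis
    by (simp add: con_def sum_distrib_left sum_distrib_right sum_subtractf sum.distrib sum_negf algebra_simps)
qed

lemma frame_ext:
  assumes "x \<in> V" "\<And>i. con (E i x) f = con (E i x) h"
  shows "f = h"
proof
  fix b show "f b = h b" using frame_expand[OF assms(1), of f b] frame_expand[OF assms(1), of h b] assms(2) by simp
qed

lemma frame_ext2:
  assumes "x \<in> V" "\<And>i j. con (E i x) (\<lambda>a. con (E j x) (\<lambda>b. S a b)) = con (E i x) (\<lambda>a. con (E j x) (\<lambda>b. T a b))"
  shows "S a b = T a b"
proof -
  have "(\<lambda>a. con (E j x) (\<lambda>b. S a b)) = (\<lambda>a. con (E j x) (\<lambda>b. T a b))" for j
    by (rule frame_ext[OF assms(1)]) (rule assms(2))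
  then have "con (E j x) (S a) = con (E j x) (T a)" for j by (metis (full_types))
  then have "S a = T a" by (rule frame_ext[OF assms(1)])
  then show ?thesis by simp
qed

lemma g_expand:
  assumes x: "x \<in> V"
  shows "g x $ a $ b = - F 1 a x * F 2 b x - F 2 a x * F 1 b x + F 3 a x * F 3 b x + F 4 a x * F 4 b x"
proof -
  have "con (E i x) (\<lambda>b. g x $ a $ b) = F i a x" for i
  proof -
    have "con (E i x) (\<lambda>b. g x $ a $ b) = (\<Sum>c\<in>UNIV. (\<Sum>b\<in>UNIV. g x $ a $ b * ginv g x b c) * F i c x)"
      unfolding con_def raise_def sum_distrib_right by (subst sum.swap) (simp add: ac_simps)
    then show ?thesis by (simp add: g_ginv[OF x] sum_kronecker)
  qed
  then show ?thesis using frame_expand[OF x, of "\<lambda>b. g x $ a $ b" b] by simp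
qed

lemma ginv_expand:
  assumes x: "x \<in> V"
  shows "ginv g x a b = - E 1 x a * E 2 x b - E 2 x a * E 1 x b + E 3 x a * E 3 x b + E 4 x a * E 4 x b"
proof -
  have "ginv g x a b = (\<Sum>c\<in>UNIV. ginv g x a c * (if b = c then 1 else 0))" by (simp add: if_distrib cong: if_cong)
  also have "\<dots> = (\<Sum>c\<in>UNIV. ginv g x a c * (- E 1 x b * F 2 c x - E 2 x b * F 1 c x + E 3 x b * F 3 c x + E 4 x b * F 4 c x))"
    by (simp only: completeness[OF x])
  also have "\<dots> = - E 1 x b * (\<Sum>c\<in>UNIV. ginv g x a c * F 2 c x) - E 2 x b * (\<Sum>c\<in>UNIV. ginv g x a c * F 1 c x)
      + E 3 x b * (\<Sum>c\<in>UNIV. ginv g x a c * F 3 c x) + E 4 x b * (\<Sum>c\<in>UNIV. ginv g x a c * F 4 c x)"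
    by (simp add: sum_distrib_left sum.distrib sum_subtractf sum_negf algebra_simps)
  finally show ?thesis unfolding raise_def[symmetric] by (simp add: mult.commute)
qed

text \<open>Ricci rotation coefficients: \<open>k\<close> is the direction of differentiation,
  \<open>i\<close> the differentiated form, \<open>j\<close> the component.\<close>

definition gam :: "4 \<Rightarrow> 4 \<Rightarrow> 4 \<Rightarrow> real^4 \<Rightarrow> real" where
  "gam k i j x = con (E k x) (\<lambda>c. con (E j x) (\<lambda>a. cov g (F i) c a x))"

lemma smooth_gam: "smooth_on V (gam k i j)"
  unfolding gam_def[abs_def] con_def
  by (intro smooth_intros smooth_E smooth_cov smooth_F open_U order.refl)

lemma gam_antisym: "x \<in> V \<Longrightarrow> gam k i j x = - gam k j i x"
proof -
  assume x: "x \<in> V"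
  have "con (E j x) (\<lambda>a. cov g (F i) c a x) + con (E i x) (\<lambda>a. cov g (F j) c a x) = 0" for c
  proof -
    have "partial c (ip g (F i) (F j)) x = partial c (\<lambda>x. nullm i j) x"
      by (rule partial_cong[OF open_U x]) (rule ip_F)
    then show ?thesis
      using partial_ip[OF x order.refl, of "F i" "F j" c, OF smooth_F smooth_F open_U]
      by (simp add: con_E[OF x] ip_sym[OF x, of "F j"])
  qed
  then have "con (E k x) (\<lambda>c. con (E j x) (\<lambda>a. cov g (F i) c a x) + con (E i x) (\<lambda>a. cov g (F j) c a x)) = 0"
    by (simp add: con_simps)
  then show ?thesis by (simp add: con_simps gam_def)
qed

lemma gam_diag: "x \<in> V \<Longrightarrow> gam k i i x = 0"
  using gam_antisym[of x k i i] by simp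

definition Rf :: "4 \<Rightarrow> 4 \<Rightarrow> 4 \<Rightarrow> 4 \<Rightarrow> real^4 \<Rightarrow> real" where
  "Rf i j k m x = con (E i x) (\<lambda>a. con (E j x) (\<lambda>b. con (E k x) (\<lambda>c. con (E m x) (\<lambda>d. riemann g x a b c d))))"

lemma Rf_antisym: "x \<in> V \<Longrightarrow> Rf i j k m x = - Rf j i k m x"
proof -
  assume x: "x \<in> V"
  have "con (E i x) (\<lambda>a. con (E j x) (\<lambda>b. con (E k x) (\<lambda>c. con (E m x) (\<lambda>d. riemann g x a b c d))))
    = con (E i x) (\<lambda>a. con (E j x) (\<lambda>b. con (E k x) (\<lambda>c. con (E m x) (\<lambda>d. - riemann g x b a c d))))"
    by (simp only: riemann_antisym[OF x, of _ _ _ _, symmetric])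
  also have "\<dots> = - Rf j i k m x"
    unfolding Rf_def con_simps(3) by (simp only: con_swap[of "E i x"])
  finally show ?thesis unfolding Rf_def .
qed

lemma Rf_antisym2: "Rf i j k m x = - Rf i j m k x"
proof -
  have "con (E k x) (\<lambda>c. con (E m x) (\<lambda>d. riemann g x a b c d))
    = - con (E m x) (\<lambda>d. con (E k x) (\<lambda>c. riemann g x a b d c))" for a b
    by (subst con_swap) (simp only: con_simps(3)[symmetric] riemann_antisym2[of x a b, symmetric])
  then show ?thesis unfolding Rf_def by (simp add: con_simps)
qed

lemma Rf_pair_sym: "x \<in> V \<Longrightarrow> Rf i j k m x = Rf k m i j x"
  unfolding Rf_def by (subst con_swap_pairs) (simp only: riemann_pair_sym[of x])

text \<open>Pairing the first slot with \<open>E i\<close> lowers and raises the same index, so the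
  Riemann tensor meets the form \<open>F i\<close> itself and the Ricci identity applies.\<close>

lemma Rf_ricci_identity:
  assumes x: "x \<in> V"
  shows "Rf i j k m x = - con (E k x) (\<lambda>c. con (E m x) (\<lambda>d. con (E j x) (\<lambda>b.
     cov2 g (cov g (F i)) c d b x - cov2 g (cov g (F i)) d c b x)))"
proof -
  have "con (E i x) (\<lambda>a. riemann g x a b c d) = - (cov2 g (cov g (F i)) c d b x - cov2 g (cov g (F i)) d c b x)" for b c d
  proof -
    have e: "(\<Sum>a\<in>UNIV. E i x a * g x $ a $ e) = F i e x" for e
    proof -
      have "(\<Sum>a\<in>UNIV. E i x a * g x $ a $ e) = (\<Sum>b\<in>UNIV. (\<Sum>a\<in>UNIV. g x $ e $ a * ginv g x a b) * F i b x)"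
        unfolding raise_def sum_distrib_right by (subst sum.swap) (simp add: g_sym[OF x, of _ e] ac_simps)
      then show ?thesis by (simp add: g_ginv[OF x] sum_kronecker)
    qed
    have "con (E i x) (\<lambda>a. riemann g x a b c d) = (\<Sum>e\<in>UNIV. (\<Sum>a\<in>UNIV. E i x a * g x $ a $ e) * riemann_up g x e b c d)"
      unfolding con_def riemann_def sum_distrib_left by (subst sum.swap) (simp add: sum_distrib_left sum_distrib_right ac_simps)
    then show ?thesis
      unfolding e using ricci_identity[OF x order.refl open_U, of "F i" c d b, OF smooth_F] by (simp add: mult.commute)
  qed
  moreover have "Rf i j k m x = con (E k x) (\<lambda>c. con (E m x) (\<lambda>d. con (E j x) (\<lambda>b. con (E i x) (\<lambda>a. riemann g x a b c d))))"
    unfolding Rf_def by (subst con_swap_pairs) (subst con_swap[of "E i x"], rule refl)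
  ultimately show ?thesis by (simp add: con_simps)
qed

lemma ricci_frame:
  assumes x: "x \<in> V"
  shows "con (E j x) (\<lambda>b. con (E m x) (\<lambda>d. ricci g x b d))
    = - Rf 1 j 2 m x - Rf 2 j 1 m x + Rf 3 j 3 m x + Rf 4 j 4 m x"
proof -
  have "ricci g x b d = (\<Sum>a\<in>UNIV. \<Sum>e\<in>UNIV. ginv g x a e * riemann g x e b a d)" for b d
  proof -
    have "(\<Sum>e\<in>UNIV. ginv g x a e * riemann g x e b a d)
        = (\<Sum>f\<in>UNIV. (\<Sum>e\<in>UNIV. ginv g x a e * g x $ e $ f) * riemann_up g x f b a d)" for a
      unfolding riemann_def sum_distrib_left by (subst sum.swap) (simp add: sum_distrib_left sum_distrib_right ac_simps)
    then show ?thesis by (simp add: ricci_def ginv_g[OF x] sum_kronecker)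
  qed
  also have "(\<Sum>a\<in>UNIV. \<Sum>e\<in>UNIV. ginv g x a e * riemann g x e b a d)
      = - con (E 1 x) (\<lambda>a. con (E 2 x) (\<lambda>e. riemann g x e b a d)) - con (E 2 x) (\<lambda>a. con (E 1 x) (\<lambda>e. riemann g x e b a d))
        + con (E 3 x) (\<lambda>a. con (E 3 x) (\<lambda>e. riemann g x e b a d)) + con (E 4 x) (\<lambda>a. con (E 4 x) (\<lambda>e. riemann g x e b a d))" for b d
    unfolding ginv_expand[OF x] con_def
    by (simp add: sum_distrib_left sum.distrib sum_subtractf sum_negf algebra_simps)
  also have "con (E j x) (\<lambda>b. con (E m x) (\<lambda>d. con (E k x) (\<lambda>a. con (E i x) (\<lambda>e. riemann g x e b a d)))) = Rf i j k m x" for i k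
  proof -
    have "con (E j x) (\<lambda>b. con (E m x) (\<lambda>d. con (E k x) (\<lambda>a. con (E i x) (\<lambda>e. riemann g x e b a d))))
      = con (E k x) (\<lambda>a. con (E i x) (\<lambda>e. con (E j x) (\<lambda>b. con (E m x) (\<lambda>d. riemann g x e b a d))))"
      by (rule con_swap_pairs)
    also have "\<dots> = con (E i x) (\<lambda>e. con (E k x) (\<lambda>a. con (E j x) (\<lambda>b. con (E m x) (\<lambda>d. riemann g x e b a d))))"
      by (rule con_swap)
    also have "\<dots> = Rf i j k m x" unfolding Rf_def by (subst con_swap[of "E k x"]) (rule refl)
    finally show ?thesis .
  qed
  ultimately show ?thesis by (simp add: con_simps)
qed

end

section \<open>The Killing-Yano equation in a null frame\<close>

context null_frame
begin

lemma cov2_wedge: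
  assumes x: "x \<in> V"
  shows "cov2 g (\<lambda>a b x. F i a x * F j b x - F i b x * F j a x) c a b x
    = cov g (F i) c a x * F j b x + F i a x * cov g (F j) c b x
      - (cov g (F i) c b x * F j a x + F i b x * cov g (F j) c a x)"
proof -
  note d = smooth_on_differentiable[OF smooth_F x]
  have "cov2 g (\<lambda>a b x. F i a x * F j b x - F i b x * F j a x) c a b x
      = cov2 g (\<lambda>a b x. F i a x * F j b x) c a b x - cov2 g (\<lambda>a b x. F i b x * F j a x) c a b x"
    by (rule cov2_diff) (intro differentiable_mult d)+
  moreover have "cov2 g (\<lambda>a b x. F i a x * F j b x) c a b x = cov g (F i) c a x * F j b x + F i a x * cov g (F j) c b x"
    by (rule cov2_prod[OF x smooth_F smooth_F])
  moreover have "cov2 g (\<lambda>a b x. F i b x * F j a x) c a b x = cov g (F i) c b x * F j a x + F i b x * cov g (F j) c a x"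
  proof -
    have "cov2 g (\<lambda>a b x. F i b x * F j a x) c a b x = cov2 g (\<lambda>a b x. F j a x * F i b x) c a b x"
      by (simp only: mult.commute)
    also have "\<dots> = cov g (F j) c a x * F i b x + F j a x * cov g (F i) c b x"
      by (rule cov2_prod[OF x smooth_F smooth_F])
    finally show ?thesis by simp
  qed
  ultimately show ?thesis by simp
qed

text \<open>\<open>Y k i j\<close> is the derivative of A in the frame, and the equation is its
  antisymmetry in the first two slots. Of the 24 rotation coefficients, those of the index pairs 2,
  3 and 2, 4 describe null rotations about \<open>F 1\<close>; such rotations preserve A, and
  accordingly these coefficients do not enter. The other sixteen reduce to \<kappa>, which is
  \<open>gam 2 1 4\<close>.\<close>

lemma killing_yano_gam:
  assumes A: "\<And>x a b. x \<in> V \<Longrightarrow> A x $ a $ b = F 1 a x * F 3 b x - F 1 b x * F 3 a x"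
    and ky: "killing_yano V g A" and x: "x \<in> V"
  shows "gam k 1 3 x = 0" "gam k 1 2 x = (if k = 4 then - gam 2 1 4 x else 0)"
    "gam k 1 4 x = (if k = 2 then gam 2 1 4 x else 0)" "gam k 3 4 x = (if k = 3 then - gam 2 1 4 x else 0)"
proof -
  define X where "X c a b = cov g (F 1) c a x * F 3 b x + F 1 a x * cov g (F 3) c b x
      - (cov g (F 1) c b x * F 3 a x + F 1 b x * cov g (F 3) c a x)" for c a b
  define Y where "Y k i j = con (E k x) (\<lambda>c. con (E i x) (\<lambda>a. con (E j x) (\<lambda>b. X c a b)))" for k i j
  have "nabla g A x c a b = X c a b" for c a b
    unfolding nabla_cov2 X_def using cov2_cong[OF open_U x, of "\<lambda>a b x. A x $ a $ b", OF A] cov2_wedge[OF x] by simp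
  moreover have "nabla g A x c a b + nabla g A x a c b = 0" for a b c
    using ky x unfolding killing_yano_def by blast
  ultimately have "X c a b = - X a c b" for a b c
    by (simp add: eq_neg_iff_add_eq_0)
  note X = this
  have K: "Y k i j = - Y i k j" for k i j
  proof -
    have "Y k i j = con (E i x) (\<lambda>a. con (E k x) (\<lambda>c. con (E j x) (\<lambda>b. X c a b)))"
      unfolding Y_def by (rule con_swap)
    also have "\<dots> = con (E i x) (\<lambda>a. con (E k x) (\<lambda>c. con (E j x) (\<lambda>b. - X a c b)))"
      by (rule arg_cong[where f="con (E i x)"]) (rule ext, rule arg_cong[where f="con (E k x)"], rule ext,
          rule arg_cong[where f="con (E j x)"], rule ext, rule X)
    also have "\<dots> = - Y i k j" unfolding Y_def by (simp only: con_simps(3))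
    finally show ?thesis .
  qed
  have Y: "Y k i j = gam k 1 i x * nullm j 3 + nullm i 1 * gam k 3 j x - (gam k 1 j x * nullm i 3 + nullm j 1 * gam k 3 i x)" for k i j
    unfolding Y_def X_def by (simp add: con_simps con_E_F[OF x] gam_def)
  have as: "gam 1 3 1 x = - gam 1 1 3 x" "gam 2 3 1 x = - gam 2 1 3 x" "gam 3 3 1 x = - gam 3 1 3 x"
      "gam 4 3 1 x = - gam 4 1 3 x"
    by (rule gam_antisym[OF x])+
  have 0: "gam k 1 1 x = 0" "gam k 3 3 x = 0" for k by (rule gam_diag[OF x])+
  have eqs: "gam 1 1 3 x = 0" "gam 2 1 3 x = 0" "gam 3 1 3 x = 0" "gam 4 1 3 x = 0"
      "gam 1 1 2 x = 0" "gam 2 1 2 x = 0" "gam 3 1 2 x = 0" "gam 4 1 2 x = - gam 2 1 4 x"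
      "gam 3 3 4 x = gam 4 1 2 x" "gam 1 3 4 x = 0" "gam 2 3 4 x = 0" "gam 4 3 4 x = 0"
      "gam 1 1 4 x = 0" "gam 3 1 4 x = 0" "gam 4 1 4 x = 0"
    using K[of 1 1 2, unfolded Y] K[of 2 2 1, unfolded Y] K[of 3 2 1, unfolded Y] K[of 4 2 1, unfolded Y]
      K[of 3 1 2, unfolded Y] K[of 2 2 3, unfolded Y] K[of 3 3 2, unfolded Y] K[of 4 2 3, unfolded Y]
      K[of 4 3 2, unfolded Y] K[of 1 2 4, unfolded Y] K[of 2 2 4, unfolded Y] K[of 4 4 2, unfolded Y]
      K[of 1 3 4, unfolded Y] K[of 3 3 4, unfolded Y] K[of 4 4 3, unfolded Y]
    by (simp_all add: as 0)
  have "\<forall>k. gam k 1 3 x = 0 \<and> gam k 1 2 x = (if k = 4 then - gam 2 1 4 x else 0) \<and>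
      gam k 1 4 x = (if k = 2 then gam 2 1 4 x else 0) \<and> gam k 3 4 x = (if k = 3 then - gam 2 1 4 x else 0)"
    unfolding forall_4 by (simp add: eqs)
  then show "gam k 1 3 x = 0" "gam k 1 2 x = (if k = 4 then - gam 2 1 4 x else 0)"
    "gam k 1 4 x = (if k = 2 then gam 2 1 4 x else 0)" "gam k 3 4 x = (if k = 3 then - gam 2 1 4 x else 0)"
    by simp_all
qed

lemma killing_yano_cov1:
  assumes A: "\<And>x a b. x \<in> V \<Longrightarrow> A x $ a $ b = F 1 a x * F 3 b x - F 1 b x * F 3 a x"
    and ky: "killing_yano V g A" and x: "x \<in> V"
  shows "cov g (F 1) c a x = gam 2 1 4 x * F 4 c x * F 1 a x - gam 2 1 4 x * F 1 c x * F 4 a x"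
proof (rule frame_ext2[OF x, of "\<lambda>c a. cov g (F 1) c a x"
      "\<lambda>c a. gam 2 1 4 x * F 4 c x * F 1 a x - gam 2 1 4 x * F 1 c x * F 4 a x"])
  fix i j
  define k where "k = gam 2 1 4 x"
  have "\<forall>i j. gam i 1 j x = k * nullm i 4 * nullm j 1 - k * nullm i 1 * nullm j 4"
    unfolding forall_4 by (simp add: killing_yano_gam[OF A ky x, folded k_def] gam_diag[OF x])
  then have "gam i 1 j x = k * nullm i 4 * nullm j 1 - k * nullm i 1 * nullm j 4" by simp
  then show "con (E i x) (\<lambda>c. con (E j x) (\<lambda>a. cov g (F 1) c a x))
    = con (E i x) (\<lambda>c. con (E j x) (\<lambda>a. gam 2 1 4 x * F 4 c x * F 1 a x - gam 2 1 4 x * F 1 c x * F 4 a x))"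
    by (simp only: k_def[symmetric] con_simps con_E_F[OF x] gam_def[symmetric])
qed

text \<open>Three times the square of \<open>gam 2 1 4\<close> is a frame component of the Ricci tensor, and
  $Ric=\sigma\,\ell\otimes\ell$ has no such component.\<close>

lemma killing_yano_parallel:
  assumes A: "\<And>x a b. x \<in> V \<Longrightarrow> A x $ a $ b = F 1 a x * F 3 b x - F 1 b x * F 3 a x"
    and ky: "killing_yano V g A" and x: "x \<in> V"
    and ric: "\<And>a b. ricci g x a b = \<sigma> * F 1 a x * F 1 b x"
  shows "gam 2 1 4 x = 0"
proof -
  let ?k = "gam 2 1 4"
  \<comment> \<open>By \<open>killing_yano_cov1\<close> the derivative of \<open>F 1\<close> is P
    tensor \<open>F 1\<close> minus Q tensor \<open>F 4\<close>; the second derivative follows from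
    the product rule.\<close>
  define P where "P a x = ?k x * F 4 a x" for a x
  define Q where "Q a x = ?k x * F 1 a x" for a x
  have sP: "smooth_on V (P a)" and sQ: "smooth_on V (Q a)" for a
    unfolding P_def[abs_def] Q_def[abs_def] by (intro smooth_on_mult open_U smooth_gam smooth_F)+
  have cP: "cov g P c a x = partial c ?k x * F 4 a x + ?k x * cov g (F 4) c a x" for c a
    unfolding P_def[abs_def] by (rule cov_scale[OF x smooth_gam smooth_F])
  have cQ: "cov g Q c a x = partial c ?k x * F 1 a x + ?k x * cov g (F 1) c a x" for c a
    unfolding Q_def[abs_def] by (rule cov_scale[OF x smooth_gam smooth_F])
  have c2: "cov2 g (cov g (F 1)) c d b x = cov g P c d x * F 1 b x + P d x * cov g (F 1) c b x
      - (cov g Q c d x * F 4 b x + Q d x * cov g (F 4) c b x)" for c d b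
  proof -
    have "cov2 g (cov g (F 1)) c d b x = cov2 g (\<lambda>d b x. P d x * F 1 b x - Q d x * F 4 b x) c d b x"
      by (rule cov2_cong[OF open_U x]) (simp add: killing_yano_cov1[OF A ky] P_def Q_def)
    also have "\<dots> = cov2 g (\<lambda>d b x. P d x * F 1 b x) c d b x - cov2 g (\<lambda>d b x. Q d x * F 4 b x) c d b x"
      by (rule cov2_diff) (intro differentiable_mult smooth_on_differentiable[OF sP x]
          smooth_on_differentiable[OF sQ x] smooth_on_differentiable[OF smooth_F x])+
    finally show ?thesis
      using cov2_prod[OF x, of P "F 1" g c d b, OF sP smooth_F] cov2_prod[OF x, of Q "F 4" g c d b, OF sQ smooth_F] by simp
  qed
  have Rf1: "Rf 1 j k m x = - ((con (E k x) (\<lambda>c. partial c ?k x) * nullm m 4 + ?k x * gam k 4 m x) * nullm j 1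
        + ?k x * nullm m 4 * gam k 1 j x
        - (con (E k x) (\<lambda>c. partial c ?k x) * nullm m 1 + ?k x * gam k 1 m x) * nullm j 4 - ?k x * nullm m 1 * gam k 4 j x)
      + ((con (E m x) (\<lambda>c. partial c ?k x) * nullm k 4 + ?k x * gam m 4 k x) * nullm j 1
        + ?k x * nullm k 4 * gam m 1 j x
        - (con (E m x) (\<lambda>c. partial c ?k x) * nullm k 1 + ?k x * gam m 1 k x) * nullm j 4 - ?k x * nullm k 1 * gam m 4 j x)" for j k m
  proof -
    define Z where "Z c d b = cov2 g (cov g (F 1)) c d b x" for c d b
    define z where "z k m = con (E k x) (\<lambda>c. con (E m x) (\<lambda>d. con (E j x) (\<lambda>b. Z c d b)))" for k m
    have "Rf 1 j k m x = - (z k m - con (E k x) (\<lambda>c. con (E m x) (\<lambda>d. con (E j x) (\<lambda>b. Z d c b))))"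
      unfolding Rf_ricci_identity[OF x] z_def Z_def by (simp add: con_simps)
    also have "con (E k x) (\<lambda>c. con (E m x) (\<lambda>d. con (E j x) (\<lambda>b. Z d c b))) = z m k"
      unfolding z_def by (rule con_swap)
    finally have "Rf 1 j k m x = - z k m + z m k" by simp
    moreover have "z k m = (con (E k x) (\<lambda>c. partial c ?k x) * nullm m 4 + ?k x * gam k 4 m x) * nullm j 1
        + ?k x * nullm m 4 * gam k 1 j x
        - (con (E k x) (\<lambda>c. partial c ?k x) * nullm m 1 + ?k x * gam k 1 m x) * nullm j 4 - ?k x * nullm m 1 * gam k 4 j x" for k m
      unfolding z_def Z_def c2 cP cQ unfolding P_def Q_def
      by (simp add: con_simps con_E_F[OF x] gam_def[symmetric] algebra_simps)
    ultimately show ?thesis by simp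
  qed
  have as: "gam k 4 1 x = - gam k 1 4 x" "gam k 4 3 x = - gam k 3 4 x" for k
    by (rule gam_antisym[OF x])+
  define k where "k = ?k x"
  \<comment> \<open>These two components contain no derivative of \<kappa>.\<close>
  have R1: "Rf 1 3 2 3 x = ?k x * ?k x" "Rf 1 2 2 1 x = - (?k x * ?k x)"
    unfolding Rf1 k_def[symmetric] by (simp_all add: as killing_yano_gam[OF A ky x, folded k_def])
  have rc: "con (E j x) (\<lambda>b. con (E m x) (\<lambda>d. ricci g x b d)) = \<sigma> * nullm j 1 * nullm m 1" for j m
    unfolding ric by (simp add: con_simps con_E_F[OF x])
  have z: "Rf i i k m x = 0" "Rf k m i i x = 0" for i k m
    using Rf_antisym[OF x, of i i k m] Rf_antisym2[of k m i i x] by simp_all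
  have "Rf 2 3 1 3 x = Rf 1 3 2 3 x" "Rf 2 4 1 4 x = Rf 1 4 2 4 x" "Rf 3 2 3 1 x = Rf 3 1 3 2 x" "Rf 4 2 4 1 x = Rf 4 1 4 2 x"
    by (rule Rf_pair_sym[OF x])+
  moreover have "Rf 3 1 3 2 x = Rf 1 3 2 3 x" "Rf 4 1 4 2 x = Rf 1 4 2 4 x" "Rf 4 3 4 3 x = Rf 3 4 3 4 x"
    using Rf_antisym[OF x, of 3 1 3 2] Rf_antisym2[of 1 3 3 2 x] Rf_antisym[OF x, of 4 1 4 2] Rf_antisym2[of 1 4 4 2 x]
      Rf_antisym[OF x, of 4 3 4 3] Rf_antisym2[of 3 4 4 3 x] by auto
  \<comment> \<open>\<open>Rf 1 4 2 4\<close> does contain a derivative of \<kappa>. It is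
    eliminated: the Ricci components 33 and 44 share \<open>Rf 3 4 3 4\<close>, so their vanishing
    equates \<open>Rf 1 4 2 4\<close> with \<open>Rf 1 3 2 3\<close>. The component 21 then adds up
    three squares, one from each of these two and one from \<open>Rf 1 2 2 1\<close>.\<close>
  ultimately have "3 * (?k x * ?k x) = 0"
    using ricci_frame[OF x, of 3 3] ricci_frame[OF x, of 4 4] ricci_frame[OF x, of 2 1] R1 unfolding rc by (simp add: z)
  then show ?thesis by simp
qed

text \<open>Once \<kappa> vanishes only the null-rotation coefficients survive, so
  \<open>F 3\<close> and \<open>F 4\<close> change by multiples of \<open>F 1\<close>, which are
  invisible in wedge products with \<open>F 1\<close>.\<close>

lemma killing_yano_parallel_cov:
  assumes A: "\<And>x a b. x \<in> V \<Longrightarrow> A x $ a $ b = F 1 a x * F 3 b x - F 1 b x * F 3 a x"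
    and ky: "killing_yano V g A" and x: "x \<in> V"
    and ric: "\<And>x a b. x \<in> V \<Longrightarrow> ricci g x a b = \<sigma> x * F 1 a x * F 1 b x"
  shows "cov g (F 1) c a x = 0"
    "cov g (F 3) c a x = - con (E 2 x) (\<lambda>a. cov g (F 3) c a x) * F 1 a x"
    "cov g (F 4) c a x = - con (E 2 x) (\<lambda>a. cov g (F 4) c a x) * F 1 a x"
proof -
  have k: "gam 2 1 4 x = 0" by (rule killing_yano_parallel[OF A ky x ric[OF x]])
  show "cov g (F 1) c a x = 0" by (simp add: killing_yano_cov1[OF A ky x] k)
  note G = killing_yano_gam[OF A ky x, unfolded k]
  have as: "gam k 3 1 x = - gam k 1 3 x" "gam k 4 1 x = - gam k 1 4 x" "gam k 4 3 x = - gam k 3 4 x" for k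
    by (rule gam_antisym[OF x])+
  have "\<forall>j. j \<noteq> 2 \<longrightarrow> gam k 3 j x = 0 \<and> gam k 4 j x = 0" for k
    unfolding forall_4 by (simp add: as G gam_diag[OF x])
  then have g0: "gam k i j x = 0" if "i = 3 \<or> i = 4" "j \<noteq> 2" for k i j
    using that by auto
  have "con (E j x) (\<lambda>a. cov g (F i) c a x) = 0" if "i = 3 \<or> i = 4" "j \<noteq> 2" for i j
  proof -
    have "(\<lambda>c. con (E j x) (\<lambda>a. cov g (F i) c a x)) = (\<lambda>c. 0)"
      by (rule frame_ext[OF x]) (use g0[OF that] in \<open>simp add: gam_def con_simps\<close>)
    then show ?thesis by (rule fun_cong)
  qed
  then show "cov g (F 3) c a x = - con (E 2 x) (\<lambda>a. cov g (F 3) c a x) * F 1 a x"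
    "cov g (F 4) c a x = - con (E 2 x) (\<lambda>a. cov g (F 4) c a x) * F 1 a x"
    using frame_expand[OF x, of "\<lambda>a. cov g (F 3) c a x" a] frame_expand[OF x, of "\<lambda>a. cov g (F 4) c a x" a] by auto
qed

end

section \<open>Curvature of pp-waves\<close>

text \<open>The pp-wave metric in real coordinates, the forms being du, dv + H du, dX, dY.
  \<open>H\<close> is a function on space-time; its independence of \<open>v\<close> is expressed by
  \<open>H_along_1\<close>, as \<open>E 1\<close> is the coordinate field of \<open>v\<close> up to
  sign.\<close>

locale pp_frame = null_frame V g w F for V g w F +
  fixes u v X Y H :: "real^4 \<Rightarrow> real"
  assumes smooth_uvXYH: "smooth_on V u" "smooth_on V v" "smooth_on V X" "smooth_on V Y" "smooth_on V H"
    and F1: "x \<in> V \<Longrightarrow> F 1 a x = partial a u x"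
    and F2: "x \<in> V \<Longrightarrow> F 2 a x = partial a v x + H x * partial a u x"
    and F3: "x \<in> V \<Longrightarrow> F 3 a x = partial a X x"
    and F4: "x \<in> V \<Longrightarrow> F 4 a x = partial a Y x"
    and H_along_1: "x \<in> V \<Longrightarrow> con (E 1 x) (\<lambda>a. partial a H x) = 0"
begin

definition h :: "4 \<Rightarrow> real^4 \<Rightarrow> real" where
  "h i x = con (E i x) (\<lambda>a. partial a H x)"

definition hh :: "4 \<Rightarrow> 4 \<Rightarrow> real^4 \<Rightarrow> real" where
  "hh i j x = con (E i x) (\<lambda>a. partial a (h j) x)"

lemma smooth_h: "smooth_on V (h i)"
  unfolding h_def[abs_def] con_def by (intro smooth_intros smooth_E open_U smooth_uvXYH)

lemma smooth_hh: "smooth_on V (hh i j)"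
  unfolding hh_def[abs_def] con_def by (intro smooth_intros smooth_E open_U smooth_h)

text \<open>Three of the forms are exact, and the exterior derivative of dv + H du is dH wedge
  du.\<close>

lemma partial_F:
  assumes x: "x \<in> V"
  shows "partial c (F i a) x - partial a (F i c) x
    = (if i = 2 then partial c H x * F 1 a x - partial a H x * F 1 c x else 0)"
proof -
  have e: "partial c (F 1 a) x = partial c (partial a u) x" "partial c (F 3 a) x = partial c (partial a X) x"
      "partial c (F 4 a) x = partial c (partial a Y) x"
      "partial c (F 2 a) x = partial c (\<lambda>x. partial a v x + H x * partial a u x) x" for a c
    using partial_cong[OF open_U x] F1 F2 F3 F4 by (metis (no_types, lifting))+
  have p2: "partial c (F 2 a) x = partial c (partial a v) x + (partial c H x * F 1 a x + H x * partial c (partial a u) x)" for a c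
    unfolding e using smooth_on_differentiable[OF smooth_on_partial[OF smooth_uvXYH(1)] x]
      smooth_on_differentiable[OF smooth_on_partial[OF smooth_uvXYH(2)] x] smooth_on_differentiable[OF smooth_uvXYH(5) x]
    by (simp add: partial_add partial_mult differentiable_mult F1[OF x])
  note c = partial_commute[OF open_U smooth_uvXYH(1) x, of c a] partial_commute[OF open_U smooth_uvXYH(2) x, of c a]
    partial_commute[OF open_U smooth_uvXYH(3) x, of c a] partial_commute[OF open_U smooth_uvXYH(4) x, of c a]
  show ?thesis
    using exhaust_4[of i] by (elim disjE) (simp_all add: e(1-3) p2 c)
qed

lemma gam_torsion:
  assumes x: "x \<in> V"
  shows "gam k i j x - gam j i k x = (if i = 2 then h k x * nullm j 1 - h j x * nullm k 1 else 0)"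
proof -
  have "cov g (F i) c a x - cov g (F i) a c x = (if i = 2 then partial c H x * F 1 a x - partial a H x * F 1 c x else 0)" for c a
    unfolding partial_F[OF x, symmetric] cov_def by (simp add: christoffel_sym[OF x, of _ c a])
  then have "con (E k x) (\<lambda>c. con (E j x) (\<lambda>a. cov g (F i) c a x - cov g (F i) a c x))
      = con (E k x) (\<lambda>c. con (E j x) (\<lambda>a. (if i = 2 then partial c H x * F 1 a x - partial a H x * F 1 c x else 0)))"
    by simp
  moreover have "con (E k x) (\<lambda>c. con (E j x) (\<lambda>a. cov g (F i) c a x - cov g (F i) a c x)) = gam k i j x - gam j i k x"
    unfolding con_simps gam_def by (subst (2) con_swap) (rule refl)
  ultimately show ?thesis
    by (cases "i = 2") (simp_all add: con_simps con_E_F[OF x] h_def)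
qed

text \<open>Antisymmetry in the last two indices together with the known curls determines all
  coefficients: three index permutations of \<open>gam_torsion\<close> are combined so that the
  undesired terms cancel.\<close>

lemma gam_koszul:
  assumes x: "x \<in> V"
  defines "t \<equiv> \<lambda>i k j. (if i = 2 then h k x * nullm j 1 - h j x * nullm k 1 else 0)"
  shows "gam k i j x = (t i k j - t j k i - t k j i) / 2"
proof -
  have 1: "gam k i j x - gam j i k x = t i k j" unfolding t_def by (rule gam_torsion[OF x])
  have 2: "gam k j i x - gam i j k x = t j k i" unfolding t_def by (rule gam_torsion[OF x])
  have 3: "gam j k i x - gam i k j x = t k j i" unfolding t_def by (rule gam_torsion[OF x])
  have 4: "gam k i j x = - gam k j i x" "gam j i k x = - gam j k i x" "gam i j k x = - gam i k j x"
    by (rule gam_antisym[OF x])+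
  show ?thesis unfolding 1[symmetric] 2[symmetric] 3[symmetric] using 4 by simp
qed

lemma gam_pp:
  assumes x: "x \<in> V"
  shows "gam k i j x = (if k = 2 \<and> i = 3 \<and> j = 2 then - h 3 x else if k = 2 \<and> i = 2 \<and> j = 3 then h 3 x
    else if k = 2 \<and> i = 4 \<and> j = 2 then - h 4 x else if k = 2 \<and> i = 2 \<and> j = 4 then h 4 x else 0)"
proof -
  have h1: "h 1 x = 0" unfolding h_def by (rule H_along_1[OF x])
  have "\<forall>i j k. gam k i j x = (if k = 2 \<and> i = 3 \<and> j = 2 then - h 3 x else if k = 2 \<and> i = 2 \<and> j = 3 then h 3 x
    else if k = 2 \<and> i = 4 \<and> j = 2 then - h 4 x else if k = 2 \<and> i = 2 \<and> j = 4 then h 4 x else 0)"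
    unfolding forall_4 gam_koszul[OF x] by (simp add: h1)
  then show ?thesis by blast
qed

lemma cov_F1: "x \<in> V \<Longrightarrow> cov g (F 1) c a x = 0"
  by (rule frame_ext2[of x "\<lambda>c a. cov g (F 1) c a x" "\<lambda>c a. 0"]) (simp_all add: gam_def[symmetric] gam_pp con_simps)

lemma cov_F3:
  assumes x: "x \<in> V"
  shows "cov g (F 3) c a x = - h 3 x * F 1 c x * F 1 a x"
proof (rule frame_ext2[OF x, of "\<lambda>c a. cov g (F 3) c a x" "\<lambda>c a. - h 3 x * F 1 c x * F 1 a x"])
  fix i j
  show "con (E i x) (\<lambda>a. con (E j x) (\<lambda>b. cov g (F 3) a b x)) = con (E i x) (\<lambda>a. con (E j x) (\<lambda>b. - h 3 x * F 1 a x * F 1 b x))"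
    using exhaust_4[of i] exhaust_4[of j]
    by (elim disjE) (simp_all add: gam_def[symmetric] gam_pp[OF x] con_simps con_E_F[OF x])
qed

lemma cov_F4:
  assumes x: "x \<in> V"
  shows "cov g (F 4) c a x = - h 4 x * F 1 c x * F 1 a x"
proof (rule frame_ext2[OF x, of "\<lambda>c a. cov g (F 4) c a x" "\<lambda>c a. - h 4 x * F 1 c x * F 1 a x"])
  fix i j
  show "con (E i x) (\<lambda>a. con (E j x) (\<lambda>b. cov g (F 4) a b x)) = con (E i x) (\<lambda>a. con (E j x) (\<lambda>b. - h 4 x * F 1 a x * F 1 b x))"
    using exhaust_4[of i] exhaust_4[of j]
    by (elim disjE) (simp_all add: gam_def[symmetric] gam_pp[OF x] con_simps con_E_F[OF x])
qed

lemma Rf_1: "x \<in> V \<Longrightarrow> Rf 1 j k m x = 0"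
proof -
  assume x: "x \<in> V"
  have "cov2 g (cov g (F 1)) c d b x = cov2 g (\<lambda>c a x. 0) c d b x" for c d b
    by (rule cov2_cong[OF open_U x]) (rule cov_F1)
  then show ?thesis unfolding Rf_ricci_identity[OF x] by (simp add: cov2_def con_simps)
qed

lemma Rf_34:
  assumes x: "x \<in> V" and i: "i = 3 \<or> i = 4"
  shows "Rf i j k m x = (hh k i x * nullm m 1 - hh m i x * nullm k 1) * nullm j 1"
proof -
  define P where "P a x = h i x * F 1 a x" for a x
  have sP: "smooth_on V (P a)" for a
    unfolding P_def[abs_def] by (intro smooth_on_mult open_U smooth_h smooth_F)
  have cP: "cov g P c a x = partial c (h i) x * F 1 a x" for c a
    unfolding P_def[abs_def] using cov_scale[OF x smooth_h, of "F 1" g i c a, OF smooth_F] cov_F1[OF x] by simp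
  have c2: "cov2 g (cov g (F i)) c d b x = - (partial c (h i) x * F 1 d x * F 1 b x)" for c d b
  proof -
    \<comment> \<open>The leading 0 gives the expression the shape of a difference, for
      \<open>cov2_diff\<close>.\<close>
    have "cov2 g (cov g (F i)) c d b x = cov2 g (\<lambda>d b x. 0 - P d x * F 1 b x) c d b x"
      by (rule cov2_cong[OF open_U x]) (use i in \<open>auto simp: cov_F3 cov_F4 P_def\<close>)
    also have "\<dots> = cov2 g (\<lambda>d b x. 0) c d b x - cov2 g (\<lambda>d b x. P d x * F 1 b x) c d b x"
      by (rule cov2_diff[where M="\<lambda>d b x. 0"]) (intro differentiable_mult differentiable_const smooth_on_differentiable[OF sP x]
          smooth_on_differentiable[OF smooth_F x])+
    finally show ?thesis
      using cov2_prod[OF x, of P "F 1" g c d b, OF sP smooth_F] cov_F1[OF x] cP by (simp add: cov2_def)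
  qed
  show ?thesis
    unfolding Rf_ricci_identity[OF x] c2
    by (simp add: con_simps con_E_F[OF x] hh_def[symmetric] algebra_simps)
qed

text \<open>The symmetry of the frame Hessian of \<open>H\<close> is read off from the pair symmetry
  of the curvature instead of from the commutator of the frame fields.\<close>

lemma hh_sym: "x \<in> V \<Longrightarrow> hh 4 3 x = hh 3 4 x"
  using Rf_pair_sym[of x 3 2 4 2] by (simp add: Rf_34)

lemma hh_1: "x \<in> V \<Longrightarrow> i = 3 \<or> i = 4 \<Longrightarrow> hh 1 i x = 0"
  using Rf_pair_sym[of x i 2 1 2] by (simp add: Rf_34 Rf_1)

definition W :: "4 \<Rightarrow> real^4 \<Rightarrow> 4 \<Rightarrow> 4 \<Rightarrow> real" where
  "W i x a b = F 1 a x * F i b x - F 1 b x * F i a x"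

text \<open>A component with 1 in the first slot vanishes since \<open>F 1\<close> is parallel, and
  antisymmetry moves a 2 from the first slot to the second. So the curvature is determined by the
  second derivatives of \<open>F 3\<close> and \<open>F 4\<close>.\<close>

lemma riemann_pp:
  assumes x: "x \<in> V"
  shows "riemann g x a b c d = hh 3 3 x * W 3 x a b * W 3 x c d
    + hh 3 4 x * (W 3 x a b * W 4 x c d + W 4 x a b * W 3 x c d) + hh 4 4 x * W 4 x a b * W 4 x c d"
    (is "_ = ?R a b c d")
proof -
  have R2: "Rf 2 1 k m x = - Rf 1 2 k m x" "Rf 2 3 k m x = - Rf 3 2 k m x" "Rf 2 4 k m x = - Rf 4 2 k m x"
    for k m
    by (rule Rf_antisym[OF x])+
  have R22: "Rf 2 2 k m x = 0" for k m using Rf_antisym[OF x, of 2 2 k m] by simp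
  define w where "w i j k = nullm j 1 * nullm k i - nullm k 1 * nullm j i" for i j k
  have W: "con (E j x) (\<lambda>a. con (E k x) (\<lambda>b. W i x a b)) = w i j k" for i j k
    unfolding W_def w_def by (simp add: con_simps con_E_F[OF x])
  have "con (E i x) (\<lambda>a. con (E j x) (\<lambda>b. con (E k x) (\<lambda>c. con (E m x) (\<lambda>d. ?R a b c d))))
      = hh 3 3 x * w 3 i j * w 3 k m + hh 3 4 x * (w 3 i j * w 4 k m + w 4 i j * w 3 k m) + hh 4 4 x * w 4 i j * w 4 k m" for i j k m
    by (simp add: con_simps W)
  moreover have "\<forall>i j k m. Rf i j k m x = hh 3 3 x * w 3 i j * w 3 k m
      + hh 3 4 x * (w 3 i j * w 4 k m + w 4 i j * w 3 k m) + hh 4 4 x * w 4 i j * w 4 k m"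
    unfolding forall_4 w_def by (simp add: Rf_1[OF x] Rf_34[OF x] R2 R22 hh_sym[OF x] hh_1[OF x])
  ultimately have *: "con (E i x) (\<lambda>a. con (E j x) (\<lambda>b. con (E k x) (\<lambda>c. con (E m x) (\<lambda>d. riemann g x a b c d))))
      = con (E i x) (\<lambda>a. con (E j x) (\<lambda>b. con (E k x) (\<lambda>c. con (E m x) (\<lambda>d. ?R a b c d))))" for i j k m
    unfolding Rf_def by simp
  have "con (E k x) (\<lambda>c. con (E m x) (\<lambda>d. riemann g x a b c d)) = con (E k x) (\<lambda>c. con (E m x) (\<lambda>d. ?R a b c d))" for a b k m
    by (rule frame_ext2[OF x, of "\<lambda>a b. con (E k x) (\<lambda>c. con (E m x) (\<lambda>d. riemann g x a b c d))"
        "\<lambda>a b. con (E k x) (\<lambda>c. con (E m x) (\<lambda>d. ?R a b c d))"]) (rule *)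
  then show ?thesis by (rule frame_ext2[OF x, of "riemann g x a b" "?R a b"])
qed

lemma ricci_pp:
  assumes x: "x \<in> V"
  shows "ricci g x a b = (hh 3 3 x + hh 4 4 x) * F 1 a x * F 1 b x"
proof (rule frame_ext2[OF x, of "ricci g x" "\<lambda>a b. (hh 3 3 x + hh 4 4 x) * F 1 a x * F 1 b x"])
  have R2: "Rf 2 1 k m x = - Rf 1 2 k m x" "Rf 2 3 k m x = - Rf 3 2 k m x" "Rf 2 4 k m x = - Rf 4 2 k m x"
    for k m
    by (rule Rf_antisym[OF x])+
  have R22: "Rf 2 2 k m x = 0" for k m using Rf_antisym[OF x, of 2 2 k m] by simp
  have "\<forall>j m. - Rf 1 j 2 m x - Rf 2 j 1 m x + Rf 3 j 3 m x + Rf 4 j 4 m x = (hh 3 3 x + hh 4 4 x) * nullm j 1 * nullm m 1"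
    unfolding forall_4 by (simp add: Rf_1[OF x] Rf_34[OF x] R2 R22 hh_sym[OF x] hh_1[OF x])
  then show "con (E j x) (\<lambda>a. con (E m x) (\<lambda>b. ricci g x a b))
    = con (E j x) (\<lambda>a. con (E m x) (\<lambda>b. (hh 3 3 x + hh 4 4 x) * F 1 a x * F 1 b x))" for j m
    unfolding ricci_frame[OF x] by (simp add: con_simps con_E_F[OF x])
qed

text \<open>The scalar curvature vanishes because l is null, and the Ricci part removes half the
  trace of the Hessian of \<open>H\<close> from both diagonal terms. What remains is the trace-free
  part.\<close>

lemma weyl_pp:
  assumes x: "x \<in> V"
  shows "weyl g x a b c d = (hh 3 3 x - hh 4 4 x) / 2 * (W 3 x a b * W 3 x c d - W 4 x a b * W 4 x c d)
    + hh 3 4 x * (W 3 x a b * W 4 x c d + W 4 x a b * W 3 x c d)"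
proof -
  have "scalar_curv g x = (hh 3 3 x + hh 4 4 x) * ip g (F 1) (F 1) x"
    unfolding scalar_curv_def ricci_pp[OF x] ip_def sum_distrib_left
    by (intro sum.cong refl) (simp add: algebra_simps)
  then have s: "scalar_curv g x = 0" by (simp add: ip_F[OF x])
  let ?l = "\<lambda>a. F 1 a x"
  have "g x $ a $ c * (?l b * ?l d) - g x $ a $ d * (?l b * ?l c) + g x $ b $ d * (?l a * ?l c) - g x $ b $ c * (?l a * ?l d)
      = W 3 x a b * W 3 x c d + W 4 x a b * W 4 x c d"
    unfolding g_expand[OF x] W_def by algebra
  from arg_cong[OF this, of "\<lambda>z. (hh 3 3 x + hh 4 4 x) * z / 2"]
  show ?thesis
    unfolding weyl_def riemann_pp[OF x] ricci_pp[OF x] s by (simp add: field_simps)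
qed

end

section \<open>Duality in a null frame\<close>

text \<open>Laplace expansion of the determinant with rows \<open>e\<close>, \<open>f\<close>,
  \<open>h\<close>, \<open>k\<close> as an explicit polynomial: contracting the Levi-Civita symbol
  with vectors then amounts to multilinearity.\<close>

definition dt :: "(4 \<Rightarrow> real) \<Rightarrow> (4 \<Rightarrow> real) \<Rightarrow> (4 \<Rightarrow> real) \<Rightarrow> (4 \<Rightarrow> real) \<Rightarrow> real" where
  "dt e f h k =
     e 1 * (f 2 * (h 3 * k 4 - h 4 * k 3) - f 3 * (h 2 * k 4 - h 4 * k 2) + f 4 * (h 2 * k 3 - h 3 * k 2))
   - e 2 * (f 1 * (h 3 * k 4 - h 4 * k 3) - f 3 * (h 1 * k 4 - h 4 * k 1) + f 4 * (h 1 * k 3 - h 3 * k 1))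
   + e 3 * (f 1 * (h 2 * k 4 - h 4 * k 2) - f 2 * (h 1 * k 4 - h 4 * k 1) + f 4 * (h 1 * k 2 - h 2 * k 1))
   - e 4 * (f 1 * (h 2 * k 3 - h 3 * k 2) - f 2 * (h 1 * k 3 - h 3 * k 1) + f 3 * (h 1 * k 2 - h 2 * k 1))"

lemma det_4:
  fixes A :: "real^4^4"
  shows "det A = dt (\<lambda>i. A $ 1 $ i) (\<lambda>i. A $ 2 $ i) (\<lambda>i. A $ 3 $ i) (\<lambda>i. A $ 4 $ i)"
proof -
  have f1: "finite {2::4, 3, 4}" "1 \<notin> {2::4, 3, 4}" by auto
  have f2: "finite {3::4, 4}" "2 \<notin> {3::4, 4}" by auto
  have f3: "finite {4::4}" "3 \<notin> {4::4}" by auto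
  show ?thesis
    unfolding det_def UNIV_4
    unfolding sum_over_permutations_insert[OF f1] sum_over_permutations_insert[OF f2] sum_over_permutations_insert[OF f3]
    unfolding permutes_sing
    by (simp add: sign_swap_id permutation_swap_id permutation_compose sign_compose sign_id swap_id_eq dt_def algebra_simps)
qed

lemma dt_repeated: "dt e e h k = 0" "dt e h e k = 0" "dt e h k e = 0" "dt h e e k = 0" "dt h e k e = 0" "dt h k e e = 0"
  by (simp_all add: dt_def algebra_simps)

lemma dt_permuted:
  "dt f k e h = - dt e f h k" "dt k f e h = dt e f h k" "dt f h e k = dt e f h k" "dt h f e k = - dt e f h k"
  by (simp_all add: dt_def algebra_simps)

lemma con_dt:
  "con z (\<lambda>a. dt (\<lambda>i. axis a 1 $ i) f h k) = dt z f h k" "con z (\<lambda>a. dt e (\<lambda>i. axis a 1 $ i) h k) = dt e z h k"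
  "con z (\<lambda>a. dt e f (\<lambda>i. axis a 1 $ i) k) = dt e f z k" "con z (\<lambda>a. dt e f h (\<lambda>i. axis a 1 $ i)) = dt e f h z"
  by (simp_all add: con_def sum_4 dt_def axis_def algebra_simps)

lemma levi_civita_dt:
  "levi_civita a b c d = dt (\<lambda>i. axis a 1 $ i) (\<lambda>i. axis b 1 $ i) (\<lambda>i. axis c 1 $ i) (\<lambda>i. axis d 1 $ i)"
  unfolding levi_civita_def det_4 by (simp add: vector_def)

lemma con_levi_civita:
  "con e1 (\<lambda>a. con e2 (\<lambda>b. con e3 (\<lambda>c. con e4 (\<lambda>d. levi_civita a b c d)))) = dt e1 e2 e3 e4"
  unfolding levi_civita_dt by (simp only: con_dt)

lemma levi_civita_antisym: "levi_civita a b d c = - levi_civita a b c d"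
  unfolding levi_civita_dt by (simp add: dt_def algebra_simps)

text \<open>The Hodge operator at one point on bare components, so that it applies alike to
  two-forms and to the first index pair of the Weyl tensor.\<close>

definition star :: "(real^4 \<Rightarrow> real^4^4) \<Rightarrow> (real^4 \<Rightarrow> real) \<Rightarrow> real^4 \<Rightarrow> (4 \<Rightarrow> 4 \<Rightarrow> real) \<Rightarrow> 4 \<Rightarrow> 4 \<Rightarrow> real" where
  "star g w x T a b = (\<Sum>c\<in>UNIV. \<Sum>d\<in>UNIV. vol w x a b c d *
        (\<Sum>e\<in>UNIV. \<Sum>f\<in>UNIV. ginv g x c e * ginv g x d f * T e f)) / 2"

lemma hodge_star: "hodge g w A x $ a $ b = star g w x (\<lambda>e f. A x $ e $ f) a b"
  by (simp add: hodge_def star_def)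

lemma weyl_dual_star: "weyl_dual g w x a b c d = star g w x (\<lambda>h k. weyl g x h k c d) a b"
  by (simp add: weyl_dual_def star_def)

lemma star_linear: "star g w x (\<lambda>e f. \<alpha> * S e f + \<beta> * T e f) a b = \<alpha> * star g w x S a b + \<beta> * star g w x T a b"
  unfolding star_def
  by (simp add: distrib_left sum.distrib sum_distrib_left add_divide_distrib) (simp add: algebra_simps)

definition wedge :: "(4 \<Rightarrow> 4 \<Rightarrow> real^4 \<Rightarrow> real) \<Rightarrow> 4 \<Rightarrow> real^4 \<Rightarrow> 4 \<Rightarrow> 4 \<Rightarrow> real" where
  "wedge F i x a b = F 1 a x * F i b x - F 1 b x * F i a x"

context null_frame
begin

lemma raise_wedge:
  "(\<Sum>e\<in>UNIV. \<Sum>f\<in>UNIV. ginv g x c e * ginv g x d f * wedge F i x e f) = E 1 x c * E i x d - E i x c * E 1 x d"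
proof -
  have "(\<Sum>e\<in>UNIV. \<Sum>f\<in>UNIV. ginv g x c e * ginv g x d f * wedge F i x e f)
    = (\<Sum>e\<in>UNIV. \<Sum>f\<in>UNIV. (ginv g x c e * F 1 e x) * (ginv g x d f * F i f x))
      - (\<Sum>e\<in>UNIV. \<Sum>f\<in>UNIV. (ginv g x c e * F i e x) * (ginv g x d f * F 1 f x))"
    by (simp add: wedge_def sum_subtractf algebra_simps)
  then show ?thesis by (simp add: raise_def sum_product)
qed

lemma star_wedge:
  "star g w x (wedge F i x) a b = w x * con (E 1 x) (\<lambda>c. con (E i x) (\<lambda>d. levi_civita a b c d))"
proof -
  let ?S = "\<lambda>i j. \<Sum>c\<in>UNIV. \<Sum>d\<in>UNIV. vol w x a b c d * (E i x c * E j x d)"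
  have "?S i 1 = (\<Sum>c\<in>UNIV. \<Sum>d\<in>UNIV. - (vol w x a b c d * (E 1 x c * E i x d)))"
  proof (subst sum.swap, intro sum.cong refl)
    fix c d
    have "levi_civita a b d c = - levi_civita a b c d" by (rule levi_civita_antisym)
    then show "vol w x a b d c * (E i x d * E 1 x c) = - (vol w x a b c d * (E 1 x c * E i x d))"
      by (simp add: vol_def)
  qed
  then have "?S i 1 = - ?S 1 i" by (simp add: sum_negf)
  moreover have "star g w x (wedge F i x) a b = (?S 1 i - ?S i 1) / 2"
    unfolding star_def raise_wedge by (simp add: right_diff_distrib sum_subtractf)
  ultimately have "star g w x (wedge F i x) a b = ?S 1 i" by simp
  then show ?thesis by (simp add: con_def vol_def sum_distrib_left algebra_simps)
qed

text \<open>The volume element on the frame, equal to 1 or -1 by \<open>orient_square\<close>. It is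
  1 in a frame built from A and its dual, but the coordinates of a given pp-wave may have either
  orientation.\<close>

definition orient :: "real^4 \<Rightarrow> real" where
  "orient x = w x * dt (E 1 x) (E 2 x) (E 3 x) (E 4 x)"

lemma con_star_wedge:
  "con (E k x) (\<lambda>a. con (E m x) (\<lambda>b. star g w x (wedge F i x) a b)) = w x * dt (E k x) (E m x) (E 1 x) (E i x)"
  unfolding star_wedge con_simps con_levi_civita ..

text \<open>On \<open>E k\<close>, \<open>E m\<close> the dual of F1 wedge Fi is a multiple of the
  determinant of \<open>E k\<close>, \<open>E m\<close>, \<open>E 1\<close>, \<open>E i\<close>,
  which is nonzero only if \<open>k\<close> and \<open>m\<close> are the two missing indices. One of
  them is 2, which marks a wedge product with \<open>F 1\<close>.\<close>

lemma star_wedge_34: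
  assumes x: "x \<in> V"
  shows "star g w x (wedge F 3 x) a b = orient x * wedge F 4 x a b"
    "star g w x (wedge F 4 x) a b = - orient x * wedge F 3 x a b"
proof -
  have 3: "\<forall>k m. w x * dt (E k x) (E m x) (E 1 x) (E 3 x)
      = orient x * (nullm k 1 * nullm m 4 - nullm m 1 * nullm k 4)"
    unfolding forall_4 orient_def
    by (simp add: dt_repeated dt_permuted[of _ "E 4 x" "E 1 x" "E 3 x"])
      (simp add: dt_def algebra_simps)
  have 4: "\<forall>k m. w x * dt (E k x) (E m x) (E 1 x) (E 4 x)
      = - orient x * (nullm k 1 * nullm m 3 - nullm m 1 * nullm k 3)"
    unfolding forall_4 orient_def
    by (simp add: dt_repeated) (simp add: dt_def algebra_simps)
  show "star g w x (wedge F 3 x) a b = orient x * wedge F 4 x a b"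
  proof (rule frame_ext2[OF x, of "star g w x (wedge F 3 x)" "\<lambda>a b. orient x * wedge F 4 x a b"])
    show "con (E k x) (\<lambda>a. con (E m x) (\<lambda>b. star g w x (wedge F 3 x) a b))
        = con (E k x) (\<lambda>a. con (E m x) (\<lambda>b. orient x * wedge F 4 x a b))" for k m
      unfolding con_star_wedge using 3 by (simp add: wedge_def con_simps con_E_F[OF x])
  qed
  show "star g w x (wedge F 4 x) a b = - orient x * wedge F 3 x a b"
  proof (rule frame_ext2[OF x, of "star g w x (wedge F 4 x)" "\<lambda>a b. - orient x * wedge F 3 x a b"])
    show "con (E k x) (\<lambda>a. con (E m x) (\<lambda>b. star g w x (wedge F 4 x) a b))
        = con (E k x) (\<lambda>a. con (E m x) (\<lambda>b. - orient x * wedge F 3 x a b))" for k m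
      unfolding con_star_wedge using 4 by (simp add: wedge_def con_simps con_E_F[OF x])
  qed
qed

text \<open>The Gram matrix of the frame vectors has determinant -1, while the determinant of
  \<open>g x\<close> is minus the square of \<open>w x\<close>.\<close>

lemma orient_square:
  assumes x: "x \<in> V"
  shows "orient x * orient x = 1"
proof -
  define R :: "real^4^4" where "R = (\<chi> i a. E i x a)"
  define N :: "real^4^4" where "N = (\<chi> i j. nullm i j)"
  have "(R ** g x ** transpose R) $ i $ j = nullm i j" for i j
  proof -
    have "(R ** g x ** transpose R) $ i $ j = con (E j x) (\<lambda>b. con (E i x) (\<lambda>a. g x $ a $ b))"
      by (simp add: R_def matrix_matrix_mult_def transpose_def con_def mult.commute)
    also have "(\<lambda>b. con (E i x) (\<lambda>a. g x $ a $ b)) = (\<lambda>b. F i b x)"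
      unfolding g_expand[OF x] using frame_expand[OF x]
      by (simp add: con_simps con_E_F[OF x]) (use exhaust_4[of i] in auto)
    finally show ?thesis by (simp add: con_E_F[OF x] nullm_sym)
  qed
  then have "R ** g x ** transpose R = N" by (simp add: N_def vec_eq_iff)
  then have "det R * det (g x) * det R = det N" by (metis det_mul det_transpose)
  moreover have "det N = -1" unfolding det_4 by (simp add: N_def dt_def)
  moreover have "det R = dt (E 1 x) (E 2 x) (E 3 x) (E 4 x)" unfolding det_4 by (simp add: R_def dt_def)
  moreover have "det (g x) = - (w x)\<^sup>2" using spacetime x by (simp add: spacetime_def)
  ultimately show ?thesis by (simp add: orient_def power2_eq_square algebra_simps)
qed

lemma form_sd_wedge:
  assumes x: "x \<in> V" and A: "\<And>a b. A x $ a $ b = wedge F 3 x a b"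
  shows "hodge g w A x $ a $ b = orient x * wedge F 4 x a b"
    "form_sd g w A x $ a $ b = Complex (wedge F 3 x a b / sqrt 2) (- orient x * wedge F 4 x a b / sqrt 2)"
proof -
  have "(\<lambda>e f. A x $ e $ f) = wedge F 3 x" using A by (intro ext)
  then show h: "hodge g w A x $ a $ b = orient x * wedge F 4 x a b"
    unfolding hodge_star by (simp add: star_wedge_34[OF x])
  show "form_sd g w A x $ a $ b = Complex (wedge F 3 x a b / sqrt 2) (- orient x * wedge F 4 x a b / sqrt 2)"
    unfolding form_sd_def by (simp add: h A complex_eq_iff)
qed

end

section \<open>The self-dual Weyl tensor of a pp-wave\<close>

context pp_frame
begin

lemma W_wedge: "W i x = wedge F i x"
  by (intro ext) (simp add: W_def wedge_def)

text \<open>Reversing the orientation conjugates the self-dual parts of A and of the Weyl tensor,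
  and accordingly \<psi>; hence the factor \<open>orient\<close> in the imaginary part.\<close>

definition \<psi> :: "real^4 \<Rightarrow> complex" where
  "\<psi> x = Complex ((hh 3 3 x - hh 4 4 x) / 2) (orient x * hh 3 4 x)"

text \<open>With a = F1 wedge F3 and b = F1 wedge F4, the two tensors in \<open>weyl_pp\<close> are,
  up to the sign -\<open>orient\<close> of the second, the real and imaginary parts of the tensor
  square of a - i \<open>orient\<close> b. The two factors 1/sqrt 2 in \<open>form_sd\<close>
  produce the 1/2 in \<open>weyl_sd\<close>.\<close>

lemma weyl_sd_pp:
  assumes x: "x \<in> V" and A: "\<And>a b. A x $ a $ b = wedge F 3 x a b"
  shows "weyl_sd g w x a b c d = \<psi> x * form_sd g w A x $ a $ b * form_sd g w A x $ c $ d"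
proof -
  let ?p = "(hh 3 3 x - hh 4 4 x) / 2" and ?q = "hh 3 4 x" and ?D = "orient x"
  let ?A = "wedge F 3 x" and ?B = "wedge F 4 x"
  have w: "weyl g x h k c d = (?p * ?A c d + ?q * ?B c d) * ?A h k + (?q * ?A c d - ?p * ?B c d) * ?B h k" for h k
    unfolding weyl_pp[OF x] W_wedge by (simp add: algebra_simps)
  have wd: "weyl_dual g w x a b c d = (?p * ?A c d + ?q * ?B c d) * (?D * ?B a b) + (?q * ?A c d - ?p * ?B c d) * (- ?D * ?A a b)"
    unfolding weyl_dual_star w star_linear star_wedge_34[OF x] ..
  have D: "?D * ?D = 1" by (rule orient_square[OF x])
  have s: "Complex (a / sqrt 2) (b / sqrt 2) = Complex a b / complex_of_real (sqrt 2)" for a b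
    by (simp add: complex_eq_iff)
  have s2: "complex_of_real (sqrt 2) * complex_of_real (sqrt 2) = 2"
    by (simp flip: of_real_mult)
  let ?F = "\<lambda>a b. Complex (?A a b) (- ?D * ?B a b)"
  have 1: "\<psi> x * form_sd g w A x $ a $ b * form_sd g w A x $ c $ d
      = Complex ?p (?D * ?q) * ?F a b * ?F c d / (complex_of_real (sqrt 2) * complex_of_real (sqrt 2))"
    unfolding form_sd_wedge(2)[of x A, OF x A] s \<psi>_def by simp
  have 2: "Complex ?p (?D * ?q) * ?F a b * ?F c d = 2 * weyl_sd g w x a b c d"
  proof (rule complex_eqI)
    define P where "P = ?p"
    show "Re (Complex ?p (?D * ?q) * ?F a b * ?F c d) = Re (2 * weyl_sd g w x a b c d)"
      unfolding weyl_sd_def wd w P_def[symmetric] using D by simp algebra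
    show "Im (Complex ?p (?D * ?q) * ?F a b * ?F c d) = Im (2 * weyl_sd g w x a b c d)"
      unfolding weyl_sd_def wd w P_def[symmetric] using D by simp algebra
  qed
  show ?thesis unfolding 1 2 s2 by simp
qed

end

section \<open>Frames adapted to a null form\<close>

text \<open>\<open>ip\<close> at a single point, for forms such as p and q that are not given as
  fields.\<close>

definition ipx :: "(real^4 \<Rightarrow> real^4^4) \<Rightarrow> real^4 \<Rightarrow> (4 \<Rightarrow> real) \<Rightarrow> (4 \<Rightarrow> real) \<Rightarrow> real" where
  "ipx g x \<alpha> \<beta> = (\<Sum>a\<in>UNIV. \<Sum>b\<in>UNIV. ginv g x a b * \<alpha> a * \<beta> b)"

lemma ip_ipx: "ip g \<theta> \<phi> x = ipx g x (\<lambda>a. \<theta> a x) (\<lambda>a. \<phi> a x)"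
  by (simp add: ip_def ipx_def)

lemma ipx_linear:
  "ipx g x (\<lambda>a. \<alpha> a + \<beta> a) \<gamma> = ipx g x \<alpha> \<gamma> + ipx g x \<beta> \<gamma>"
  "ipx g x \<gamma> (\<lambda>a. \<alpha> a + \<beta> a) = ipx g x \<gamma> \<alpha> + ipx g x \<gamma> \<beta>"
  "ipx g x (\<lambda>a. \<alpha> a - \<beta> a) \<gamma> = ipx g x \<alpha> \<gamma> - ipx g x \<beta> \<gamma>"
  "ipx g x \<gamma> (\<lambda>a. \<alpha> a - \<beta> a) = ipx g x \<gamma> \<alpha> - ipx g x \<gamma> \<beta>"
  "ipx g x (\<lambda>a. - \<alpha> a) \<gamma> = - ipx g x \<alpha> \<gamma>"
  "ipx g x \<gamma> (\<lambda>a. - \<alpha> a) = - ipx g x \<gamma> \<alpha>"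
  "ipx g x (\<lambda>a. c * \<alpha> a) \<gamma> = c * ipx g x \<alpha> \<gamma>"
  "ipx g x \<gamma> (\<lambda>a. c * \<alpha> a) = c * ipx g x \<gamma> \<alpha>"
  "ipx g x (\<lambda>a. \<alpha> a * c) \<gamma> = c * ipx g x \<alpha> \<gamma>"
  "ipx g x \<gamma> (\<lambda>a. \<alpha> a * c) = c * ipx g x \<gamma> \<alpha>"
  by (simp_all add: ipx_def sum.distrib sum_subtractf sum_negf sum_distrib_left algebra_simps)

lemma (in spacetime_on) ipx_sym: "x \<in> U \<Longrightarrow> ipx g x \<alpha> \<beta> = ipx g x \<beta> \<alpha>"
  unfolding ipx_def by (subst sum.swap) (simp add: ginv_sym[of x] ac_simps)

lemma cinner_g_Complex:
  "cinner_g g x (\<chi> a. Complex (\<alpha> a) (\<beta> a)) (\<chi> a. Complex (\<gamma> a) (\<delta> a))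
    = Complex (ipx g x \<alpha> \<gamma> - ipx g x \<beta> \<delta>) (ipx g x \<alpha> \<delta> + ipx g x \<beta> \<gamma>)"
  by (simp add: cinner_g_def ipx_def complex_eq_iff sum.distrib sum_subtractf algebra_simps)

text \<open>The conditions on \<open>m\<close> say that its real and imaginary parts are orthogonal,
  with squares 1/2. Multiplied by sqrt 2 they become unit vectors, and this factor cancels the
  1/sqrt 2 in \<open>form_sd\<close>; the -i there is the origin of the minus sign in the
  dual.\<close>

lemma (in spacetime_on) fundamental_vector_real:
  assumes x: "x \<in> U" and f: "fundamental_vector g w A x l"
  obtains p q where "ipx g x (($) l) (($) l) = 0" "ipx g x (($) l) p = 0" "ipx g x (($) l) q = 0"
    "ipx g x p p = 1" "ipx g x q q = 1" "ipx g x p q = 0"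
    "\<forall>a b. A x $ a $ b = l $ a * p b - l $ b * p a" "\<forall>a b. hodge g w A x $ a $ b = - (l $ a * q b - l $ b * q a)"
proof -
  obtain m :: "complex^4" where
    ll: "cinner_g g x (\<chi> a. complex_of_real (l $ a)) (\<chi> a. complex_of_real (l $ a)) = 0" and
    mm: "cinner_g g x m m = 0" and ml: "cinner_g g x m (\<chi> a. complex_of_real (l $ a)) = 0" and
    mm': "cinner_g g x m (\<chi> a. cnj (m $ a)) = 1" and
    sd: "\<And>a b. form_sd g w A x $ a $ b = (\<chi> a. complex_of_real (l $ a)) $ a * m $ b - (\<chi> a. complex_of_real (l $ a)) $ b * m $ a"
  proof -
    from f show ?thesis
      unfolding fundamental_vector_def Let_def
      by (elim exE conjE) (rule that, assumption+, erule allE, erule allE, assumption)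
  qed
  define r where "r a = Re (m $ a)" for a
  define i where "i a = Im (m $ a)" for a
  have m: "m = (\<chi> a. Complex (r a) (i a))" "(\<chi> a. cnj (m $ a)) = (\<chi> a. Complex (r a) (- i a))"
    "(\<chi> a. complex_of_real (l $ a)) = (\<chi> a. Complex (l $ a) 0)"
    by (simp_all add: vec_eq_iff r_def i_def complex_eq_iff)
  have z: "ipx g x \<alpha> (\<lambda>a. 0) = 0" "ipx g x (\<lambda>a. 0) \<alpha> = 0" for \<alpha>
    by (simp_all add: ipx_def)
  note mm[unfolded m(1) cinner_g_Complex complex_eq_iff] and ml[unfolded m(1,3) cinner_g_Complex complex_eq_iff]
    and ll[unfolded m(3) cinner_g_Complex complex_eq_iff]
  moreover note mm'[unfolded m(2), unfolded m(1) cinner_g_Complex complex_eq_iff]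
  ultimately have 1: "ipx g x r r - ipx g x i i = 0" "ipx g x r i + ipx g x i r = 0"
      "ipx g x r (($) l) = 0" "ipx g x i (($) l) = 0" "ipx g x (($) l) (($) l) = 0" "ipx g x r r + ipx g x i i = 1"
    by (simp_all add: z ipx_linear)
  have s: "sqrt 2 * sqrt 2 = (2::real)" by simp
  define p where "p a = sqrt 2 * r a" for a
  define q where "q a = sqrt 2 * i a" for a
  have sd': "(complex_of_real (A x $ a $ b) - \<i> * complex_of_real (hodge g w A x $ a $ b)) / complex_of_real (sqrt 2)
      = complex_of_real (l $ a) * Complex (r b) (i b) - complex_of_real (l $ b) * Complex (r a) (i a)" for a b
    using sd[of a b] by (simp add: form_sd_def m(1))
  have "A x $ a $ b / sqrt 2 = l $ a * r b - l $ b * r a" for a b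
    using arg_cong[OF sd'[of a b], of Re] by simp
  then have A: "A x $ a $ b = sqrt 2 * (l $ a * r b - l $ b * r a)" for a b
    by (simp add: field_simps)
  have "- (hodge g w A x $ a $ b / sqrt 2) = l $ a * i b - l $ b * i a" for a b
    using arg_cong[OF sd'[of a b], of Im] by simp
  note B0 = this
  have B: "hodge g w A x $ a $ b = - (sqrt 2 * (l $ a * i b - l $ b * i a))" for a b
  proof -
    have "hodge g w A x $ a $ b = - (sqrt 2 * (- (hodge g w A x $ a $ b / sqrt 2)))" by simp
    then show ?thesis unfolding B0 .
  qed
  show thesis
  proof (rule that)
    show "ipx g x (($) l) (($) l) = 0" by (rule 1)
    show "ipx g x (($) l) p = 0" "ipx g x (($) l) q = 0"
      unfolding p_def[abs_def] q_def[abs_def] ipx_linear using 1 ipx_sym[OF x, of "($) l" r] ipx_sym[OF x, of "($) l" i] by simp_all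
    show "ipx g x p p = 1" "ipx g x q q = 1"
      unfolding p_def[abs_def] q_def[abs_def] ipx_linear using 1 by (simp_all add: mult.assoc[symmetric])
    show "ipx g x p q = 0"
      unfolding p_def[abs_def] q_def[abs_def] ipx_linear using 1 ipx_sym[OF x, of i r] by simp
    show "\<forall>a b. A x $ a $ b = l $ a * p b - l $ b * p a" unfolding A p_def by (simp add: algebra_simps)
    show "\<forall>a b. hodge g w A x $ a $ b = - (l $ a * q b - l $ b * q a)" unfolding B q_def by (simp add: algebra_simps)
  qed
qed

lemma (in spacetime_on) smooth_hodge:
  assumes "\<And>a b. smooth_on U (\<lambda>x. A x $ a $ b)"
  shows "smooth_on U (\<lambda>x. hodge g w A x $ a $ b)"
proof -
  have w: "smooth_on U w" using spacetime by (simp add: spacetime_def)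
  show ?thesis
    unfolding hodge_star star_def vol_def
    by (intro smooth_on_divide smooth_intros smooth_ginv assms w open_U) simp
qed

lemma null_frame_exists:
  assumes st: "spacetime V g w" and ky: "null_killing_yano V g w A" and pr: "pure_radiation V g w A" and p: "p \<in> V"
  obtains V' F \<sigma> where "open V'" "p \<in> V'" "V' \<subseteq> V" "null_frame V' g w F"
    "\<And>x a b. x \<in> V' \<Longrightarrow> A x $ a $ b = wedge F 3 x a b"
    "\<And>x a b. x \<in> V' \<Longrightarrow> hodge g w A x $ a $ b = wedge F 4 x a b"
    "\<And>x a b. x \<in> V' \<Longrightarrow> ricci g x a b = \<sigma> x * F 1 a x * F 1 b x"
proof -
  interpret spacetime_on V g w by (unfold_locales) (rule st)
  have sA: "smooth_on V (\<lambda>x. A x $ a $ b)" for a b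
    using ky open_U by (auto simp: null_killing_yano_def killing_yano_def two_form_on_def intro!: smooth_on_nth)
  have sB: "smooth_on V (\<lambda>x. hodge g w A x $ a $ b)" for a b by (rule smooth_hodge[OF sA])
  obtain \<sigma> l where l: "\<And>x. x \<in> V \<Longrightarrow> fundamental_vector g w A x (l x)"
    and ric: "\<And>x a b. x \<in> V \<Longrightarrow> ricci g x a b = \<sigma> x * l x $ a * l x $ b"
  proof -
    from pr show ?thesis
      unfolding pure_radiation_def by (elim exE conjE) (rule that, simp_all)
  qed
  \<comment> \<open>Contraction of A with itself. As p is a unit vector orthogonal to the null
    vector l, this is the tensor square of l, which does not depend on the choice of sign.\<close>
  define S where "S a c x = (\<Sum>b\<in>UNIV. \<Sum>d\<in>UNIV. ginv g x b d * A x $ a $ b * A x $ c $ d)" for a c x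
  have sS: "smooth_on V (S a c)" for a c
    unfolding S_def[abs_def] by (intro smooth_intros smooth_ginv sA open_U)
  have S: "S a c x = l x $ a * l x $ c" if x: "x \<in> V" for a c x
  proof -
    obtain p q where pq: "ipx g x (($) (l x)) (($) (l x)) = 0" "ipx g x (($) (l x)) p = 0" "ipx g x (($) (l x)) q = 0"
      "ipx g x p p = 1" "ipx g x q q = 1" "ipx g x p q = 0"
      and A0: "\<forall>a b. A x $ a $ b = l x $ a * p b - l x $ b * p a"
      and B0: "\<forall>a b. hodge g w A x $ a $ b = - (l x $ a * q b - l x $ b * q a)"
      using fundamental_vector_real[OF x l[OF x]] .
    note A = A0[rule_format] and B = B0[rule_format]
    have "S a c x = ipx g x (\<lambda>b. l x $ a * p b - l x $ b * p a) (\<lambda>d. l x $ c * p d - l x $ d * p c)"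
      by (simp add: S_def ipx_def A)
    also have "\<dots> = l x $ a * l x $ c"
      using pq ipx_sym[OF x, of p "($) (l x)"] by (simp add: ipx_linear)
    finally show ?thesis .
  qed
  have "A p \<noteq> 0" using ky p by (simp add: null_killing_yano_def null_form_def)
  then obtain i where "l p $ i \<noteq> 0"
  proof -
    obtain a b where "A p $ a $ b \<noteq> 0" using \<open>A p \<noteq> 0\<close> by (metis vec_eq_iff zero_index)
    moreover obtain r q where "ipx g p (($) (l p)) (($) (l p)) = 0" "ipx g p (($) (l p)) r = 0" "ipx g p (($) (l p)) q = 0"
      "ipx g p r r = 1" "ipx g p q q = 1" "ipx g p r q = 0"
      and r0: "\<forall>a b. A p $ a $ b = l p $ a * r b - l p $ b * r a"
      and "\<forall>a b. hodge g w A p $ a $ b = - (l p $ a * q b - l p $ b * q a)"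
      using fundamental_vector_real[OF p l[OF p]] .
    ultimately have "l p $ a \<noteq> 0 \<or> l p $ b \<noteq> 0" by (auto simp: r0)
    then show thesis using that by auto
  qed
  define V1 where "V1 = {x \<in> V. S i i x > 0}"
  have "V1 = V \<inter> S i i -` {0<..}" by (auto simp: V1_def)
  then have "open V1"
    using continuous_open_preimage[OF smooth_on_continuous[OF sS] open_U open_greaterThan] by simp
  moreover have "V1 \<subseteq> V" by (auto simp: V1_def)
  moreover have "S i i p > 0" using S[OF p, of i i] \<open>l p $ i \<noteq> 0\<close> not_real_square_gt_zero by metis
  ultimately have V1: "open V1" "V1 \<subseteq> V" "p \<in> V1" using p by (auto simp: V1_def)
  \<comment> \<open>Since \<open>S i i x\<close> is the square of \<open>l x $ i\<close>, this is l
    with the sign that makes its component \<open>i\<close> positive, and it is smooth because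
    \<open>S\<close> is.\<close>
  define L where "L a x = S a i x / sqrt (S i i x)" for a x
  have sL: "smooth_on V1 (L a)" for a
    unfolding L_def[abs_def]
    by (intro smooth_on_divide smooth_on_sqrt V1 smooth_on_subset[OF sS]) (auto simp: V1_def)
  have L: "L a x = sgn (l x $ i) * l x $ a" "l x $ i \<noteq> 0" if x: "x \<in> V1" for a x
  proof -
    have xV: "x \<in> V" using x V1 by auto
    have "l x $ i * l x $ i > 0" using x S[OF xV, of i i] by (simp add: V1_def)
    then show n: "l x $ i \<noteq> 0" by auto
    show "L a x = sgn (l x $ i) * l x $ a"
      unfolding L_def S[OF xV] using n by (simp add: sgn_if field_simps)
  qed
  define R where "R j x = (\<Sum>a\<in>UNIV. ginv g x j a * L a x)" for j x
  have sR: "smooth_on V1 (R j)" for j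
    unfolding R_def[abs_def] using V1 by (intro smooth_intros smooth_on_subset[OF smooth_ginv] sL)
  obtain j where j: "R j p \<noteq> 0"
  proof -
    have "L i p = (\<Sum>a\<in>UNIV. (\<Sum>j\<in>UNIV. g p $ i $ j * ginv g p j a) * L a p)"
      by (simp add: g_ginv[OF p] sum_kronecker)
    also have "\<dots> = (\<Sum>j\<in>UNIV. g p $ i $ j * R j p)"
      unfolding R_def sum_distrib_left sum_distrib_right by (subst sum.swap) (simp add: mult.assoc)
    finally have "L i p = (\<Sum>j\<in>UNIV. g p $ i $ j * R j p)" .
    moreover have "L i p \<noteq> 0" using L[OF V1(3)] by (simp add: sgn_if)
    ultimately have ne: "(\<Sum>j\<in>UNIV. g p $ i $ j * R j p) \<noteq> 0" by simp
    have "\<not> (\<forall>j. R j p = 0)"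
    proof
      assume "\<forall>j. R j p = 0"
      then have "(\<Sum>j\<in>UNIV. g p $ i $ j * R j p) = 0" by simp
      with ne show False by contradiction
    qed
    then show thesis using that by auto
  qed
  define V' where "V' = {x \<in> V1. R j x \<noteq> 0}"
  have "V' = V1 \<inter> R j -` (- {0})" by (auto simp: V'_def)
  then have "open V'"
    using continuous_open_preimage[OF smooth_on_continuous[OF sR] V1(1) open_Compl[OF closed_singleton]] by simp
  then have V': "open V'" "V' \<subseteq> V" "p \<in> V'" using V1 j by (auto simp: V'_def)
  have V'1: "V' \<subseteq> V1" by (auto simp: V'_def)
  \<comment> \<open>The multiple of the coordinate form of index \<open>j\<close> whose product with
    \<open>L\<close> is -1.\<close>
  define N where "N a x = - (if a = j then 1 else 0) / R j x" for a x
  define NN where "NN x = ip g N N x" for x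
  \<comment> \<open>Adding NN/2 times \<open>L\<close> makes \<open>N\<close> null. Inserting
    \<open>N\<close> into A and its dual gives p and q up to sign, shifted by the multiples of l
    that make them orthogonal to the second form.\<close>
  define F :: "4 \<Rightarrow> 4 \<Rightarrow> real^4 \<Rightarrow> real" where "F k a x = (if k = 1 then L a x else if k = 2 then N a x + NN x / 2 * L a x
     else if k = 3 then (\<Sum>b\<in>UNIV. \<Sum>c\<in>UNIV. A x $ a $ b * ginv g x b c * N c x)
     else (\<Sum>b\<in>UNIV. \<Sum>c\<in>UNIV. hodge g w A x $ a $ b * ginv g x b c * N c x))" for k a x
  have sN: "smooth_on V' (N a)" for a
    unfolding N_def[abs_def] using V' V'1 by (intro smooth_on_divide smooth_on_const smooth_on_subset[OF sR]) (auto simp: V'_def)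
  have sG: "smooth_on V' (\<lambda>x. ginv g x a b)" for a b using smooth_on_subset[OF smooth_ginv V'(2)] .
  have sNN: "smooth_on V' NN" unfolding NN_def[abs_def] ip_def by (intro smooth_intros sN sG V'(1))
  have sF: "smooth_on V' (F k a)" for k a
  proof -
    have "smooth_on V' (L a)" using smooth_on_subset[OF sL V'1] .
    moreover have "smooth_on V' (\<lambda>x. N a x + NN x / 2 * L a x)"
      by (intro smooth_on_add smooth_on_mult smooth_on_divide sN sNN smooth_on_const V'(1) smooth_on_subset[OF sL V'1]) simp
    moreover have "smooth_on V' (\<lambda>x. \<Sum>b\<in>UNIV. \<Sum>c\<in>UNIV. A x $ a $ b * ginv g x b c * N c x)"
      by (intro smooth_intros sN sG V'(1) smooth_on_subset[OF sA V'(2)])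
    moreover have "smooth_on V' (\<lambda>x. \<Sum>b\<in>UNIV. \<Sum>c\<in>UNIV. hodge g w A x $ a $ b * ginv g x b c * N c x)"
      by (intro smooth_intros sN sG V'(1) smooth_on_subset[OF sB V'(2)])
    ultimately show ?thesis unfolding F_def[abs_def] by (cases "k = 1"; cases "k = 2"; cases "k = 3") simp_all
  qed
  have main: "(\<forall>i j. ip g (F i) (F j) x = nullm i j) \<and> (\<forall>a b. A x $ a $ b = wedge F 3 x a b)
      \<and> (\<forall>a b. hodge g w A x $ a $ b = wedge F 4 x a b) \<and> (\<forall>a b. ricci g x a b = \<sigma> x * F 1 a x * F 1 b x)"
    if x': "x \<in> V'" for x
  proof -
    have x: "x \<in> V" "x \<in> V1" using x' V' V'1 by auto
    obtain p q where pq: "ipx g x (($) (l x)) (($) (l x)) = 0" "ipx g x (($) (l x)) p = 0" "ipx g x (($) (l x)) q = 0"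
      "ipx g x p p = 1" "ipx g x q q = 1" "ipx g x p q = 0"
      and A0: "\<forall>a b. A x $ a $ b = l x $ a * p b - l x $ b * p a"
      and B0: "\<forall>a b. hodge g w A x $ a $ b = - (l x $ a * q b - l x $ b * q a)"
      using fundamental_vector_real[OF x(1) l[OF x(1)]] .
    note A = A0[rule_format] and B = B0[rule_format]
    \<comment> \<open>If l, p and q change sign together, A and its dual remain the same.\<close>
    define s where "s = sgn (l x $ i)"
    have s: "s * s = 1" using L(2)[OF x(2)] by (simp add: s_def sgn_if)
    define k where "k a = s * l x $ a" for a
    define P where "P a = s * p a" for a
    define Q where "Q a = s * q a" for a
    define n where "n a = N a x" for a
    have s2: "s * (s * z) = z" for z using s by (simp add: mult.assoc[symmetric])
    have ip0: "ipx g x k k = 0" "ipx g x k P = 0" "ipx g x k Q = 0" "ipx g x P P = 1" "ipx g x Q Q = 1" "ipx g x P Q = 0"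
      unfolding k_def[abs_def] P_def[abs_def] Q_def[abs_def] ipx_linear using pq s by (simp_all add: s2)
    have ln: "ipx g x k n = -1"
    proof -
      have "ipx g x n k = (\<Sum>a\<in>UNIV. n a * R a x)"
        unfolding ipx_def R_def sum_distrib_left k_def s_def L(1)[OF x(2)] by (simp add: ac_simps)
      also have "\<dots> = (\<Sum>a\<in>UNIV. (if a = j then 1 else 0) * (- (R a x / R j x)))"
        unfolding n_def N_def by (intro sum.cong refl) simp
      also have "\<dots> = -1" unfolding sum_kronecker using x' by (simp add: V'_def)
      finally show ?thesis using ipx_sym[OF x(1)] by simp
    qed
    note sym = ipx_sym[OF x(1), of P k] ipx_sym[OF x(1), of Q k] ipx_sym[OF x(1), of Q P]
      ipx_sym[OF x(1), of n k] ipx_sym[OF x(1), of n P] ipx_sym[OF x(1), of n Q]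
    define \<alpha> where "\<alpha> = ipx g x P n"
    define \<beta> where "\<beta> = ipx g x Q n"
    have A': "A x $ a $ b = k a * P b - k b * P a" for a b
      unfolding A k_def P_def using s by algebra
    have B': "hodge g w A x $ a $ b = - (k a * Q b - k b * Q a)" for a b
      unfolding B k_def Q_def using s by algebra
    have F1: "F 1 a x = k a" for a by (simp add: F_def L(1)[OF x(2)] k_def s_def)
    have F2: "F 2 a x = n a + NN x / 2 * k a" for a by (simp add: F_def L(1)[OF x(2)] k_def s_def n_def)
    have F3: "F 3 a x = P a + \<alpha> * k a" for a
    proof -
      have "F 3 a x = ipx g x (\<lambda>b. k a * P b - k b * P a) n"
        by (simp add: F_def ipx_def A' n_def sum_distrib_left ac_simps)
      then show ?thesis by (simp add: ipx_linear ln \<alpha>_def)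
    qed
    have F4: "F 4 a x = - (Q a + \<beta> * k a)" for a
    proof -
      have "F 4 a x = ipx g x (\<lambda>b. - (k a * Q b - k b * Q a)) n"
        by (simp add: F_def ipx_def B' n_def sum_distrib_left ac_simps)
      then show ?thesis by (simp add: ipx_linear ln \<beta>_def)
    qed
    have NN: "NN x = ipx g x n n" by (simp add: NN_def ip_ipx n_def[abs_def])
    have "\<forall>i j. ip g (F i) (F j) x = nullm i j"
      unfolding forall_4 ip_ipx F1 F2 F3 F4 ipx_linear NN
      by (simp add: ip0 ln sym \<alpha>_def[symmetric] \<beta>_def[symmetric])
    moreover have "A x $ a $ b = wedge F 3 x a b" "hodge g w A x $ a $ b = wedge F 4 x a b" for a b
      unfolding A' B' wedge_def F1 F3 F4 by (simp_all add: algebra_simps)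
    moreover have "ricci g x a b = \<sigma> x * F 1 a x * F 1 b x" for a b
      unfolding ric[OF x(1)] F1 k_def using s by algebra
    ultimately show ?thesis by simp
  qed
  have "null_frame V' g w F"
  proof
    show "spacetime V' g w" by (rule spacetime_subset[OF st V'(1,2)])
    show "smooth_on V' (F i a)" for i a by (rule sF)
    show "ip g (F i) (F j) x = nullm i j" if "x \<in> V'" for x i j using main[OF that] by simp
  qed
  then show thesis
    by (rule that[OF V'(1,3,2), of F \<sigma>]) (simp_all add: main)
qed

section \<open>Adapted coordinates\<close>

context null_frame
begin

lemma cov_antisym:
  assumes x: "x \<in> V"
  shows "con (E j x) (\<lambda>a. cov g (F i) c a x) = - con (E i x) (\<lambda>a. cov g (F j) c a x)"
proof -
  have "partial c (ip g (F i) (F j)) x = partial c (\<lambda>x. nullm i j) x"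
    by (rule partial_cong[OF open_U x]) (rule ip_F)
  then show ?thesis
    using partial_ip[OF x order.refl, of "F i" "F j" c, OF smooth_F smooth_F open_U]
    by (simp add: con_E[OF x] ip_sym[OF x, of "F j"])
qed

lemma curl_cov:
  assumes x: "x \<in> V"
  shows "partial c (F i a) x - partial a (F i c) x = cov g (F i) c a x - cov g (F i) a c x"
  by (simp add: cov_def christoffel_sym[OF x, of _ c a])

text \<open>If q tensor l is symmetric, q is proportional to l; contraction with \<open>E 2\<close>
  finds the factor.\<close>

lemma cov_gradient:
  assumes x: "x \<in> V" and c: "\<And>c a. cov g (F i) c a x = q c * F 1 a x"
    and sym: "\<And>c a. cov g (F i) c a x = cov g (F i) a c x"
  shows "cov g (F i) c a x = gam 2 i 2 x * F 1 c x * F 1 a x"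
proof -
  have "con (E 2 x) (\<lambda>a. q c * F 1 a x) = con (E 2 x) (\<lambda>a. q a * F 1 c x)" for c
    using sym[unfolded c, of c] by (intro arg_cong[where f="con (E 2 x)"] ext)
  then have "- q c = con (E 2 x) q * F 1 c x" for c
    by (simp add: con_simps con_E_F[OF x])
  from this[symmetric] have q: "q c = - con (E 2 x) q * F 1 c x" for c by simp
  have "gam 2 i 2 x = - con (E 2 x) q"
    unfolding gam_def c by (simp add: con_simps con_E_F[OF x])
  then show ?thesis unfolding c using q[of c] by simp
qed

text \<open>Metric compatibility leaves no freedom: by \<open>cov_antisym\<close> the components of
  the derivative of \<open>F 2\<close> are minus the \<open>E 2\<close>-components of the
  derivatives of the other forms.\<close>

lemma cov2_of_gradients:
  assumes x: "x \<in> V" and 1: "\<And>c a. cov g (F 1) c a x = 0"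
    and 34: "\<And>i c a. i = 3 \<or> i = 4 \<Longrightarrow> cov g (F i) c a x = gam 2 i 2 x * F 1 c x * F 1 a x"
  shows "cov g (F 2) c a x = gam 2 3 2 x * F 1 c x * F 3 a x + gam 2 4 2 x * F 1 c x * F 4 a x"
proof -
  have "con (E 1 x) (\<lambda>a. cov g (F 2) c a x) = 0"
    using cov_antisym[OF x, of 1 2 c] by (simp add: 1 con_simps)
  moreover have "con (E 2 x) (\<lambda>a. cov g (F 2) c a x) = 0"
    using cov_antisym[OF x, of 2 2 c] by simp
  moreover have "con (E i x) (\<lambda>a. cov g (F 2) c a x) = gam 2 i 2 x * F 1 c x" if "i = 3 \<or> i = 4" for i
    using cov_antisym[OF x, of i 2 c] by (simp add: 34[OF that] con_simps con_E_F[OF x])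
  ultimately show ?thesis
    using frame_expand[OF x, of "\<lambda>a. cov g (F 2) c a x" a] by simp
qed

end

text \<open>The null rotation that makes $p$ and $q$ exact preserves $\ell\wedge p$ and $\ell\wedge q$.\<close>

lemma pp_frame_exists:
  assumes nf: "null_frame V g w F" and p: "p \<in> V"
    and cov1: "\<And>x c a. x \<in> V \<Longrightarrow> cov g (F 1) c a x = 0"
    and cov34: "\<And>x i c a. x \<in> V \<Longrightarrow> i = 3 \<or> i = 4 \<Longrightarrow> cov g (F i) c a x = \<pi> i c x * F 1 a x"
  obtains V' F' u v X Y H where "open V'" "p \<in> V'" "V' \<subseteq> V" "pp_frame V' g w F' u v X Y H"
    "\<And>x i a b. x \<in> V' \<Longrightarrow> i = 3 \<or> i = 4 \<Longrightarrow> wedge F' i x a b = wedge F i x a b"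
proof -
  interpret null_frame V g w F by (rule nf)
  obtain r where r: "r > 0" "cube p r \<subseteq> V" using cube_subset[OF open_U p] .
  have sub: "\<And>x. x \<in> cube p r \<Longrightarrow> x \<in> V" using r by auto
  have "partial i (F 1 j) y = partial j (F 1 i) y" if "y \<in> cube p r" for y i j
    using curl_cov[OF sub[OF that], of i 1 j] by (simp add: cov1[OF sub[OF that]])
  then obtain u where su: "smooth_on (cube p r) u" and u: "\<And>y i. y \<in> cube p r \<Longrightarrow> partial i u y = F 1 i y"
    using potential_on_cube[of p r "F 1" UNIV, OF smooth_on_subset[OF smooth_F r(2)]] by (metis UNIV_I)
  have "\<exists>a0. partial a0 u p \<noteq> 0"
  proof (rule ccontr)
    assume "\<not> ?thesis"
    then have "(\<lambda>a. F 1 a p) = (\<lambda>a. 0)" using u[OF center_in_cube[OF r(1)]] by auto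
    then have "con (E 2 p) (\<lambda>a. F 1 a p) = 0" by (simp add: con_simps)
    then show False by (simp add: con_E_F[OF p])
  qed
  then obtain a0 where a0: "partial a0 u p \<noteq> 0" ..
  show thesis
  \<comment> \<open>The neighbourhood is fixed before the forms: the same \<open>V'\<close> has to
    serve for X and Y and then for v, whose form is built from the defects of X and Y.\<close>
  proof (rule potential_along_slices[OF open_cube center_in_cube[OF r(1)] su a0])
    fix V'
    assume V': "open V'" "p \<in> V'" "V' \<subseteq> cube p r" and pot:
      "\<And>(\<theta> :: 4 \<Rightarrow> real^4 \<Rightarrow> real) \<pi>. (\<And>a. smooth_on V' (\<theta> a)) \<Longrightarrow>
      (\<And>x a b. x \<in> V' \<Longrightarrow> partial a (\<theta> b) x - partial b (\<theta> a) x
         = \<pi> a x * partial b u x - \<pi> b x * partial a u x) \<Longrightarrow>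
      \<exists>f k. smooth_on V' f \<and> smooth_on V' k \<and> (\<forall>x\<in>V'. \<forall>b. partial b f x = \<theta> b x + k x * partial b u x)"
    have V'V: "V' \<subseteq> V" using V' r by auto
    have xV: "x \<in> V" if "x \<in> V'" for x using that V'V by auto
    have u': "partial b u x = F 1 b x" if "x \<in> V'" for x b using u that V' by auto
    have sF: "smooth_on V' (F i a)" for i a by (rule smooth_on_subset[OF smooth_F V'V])
    have curl34: "partial a (F i b) x - partial b (F i a) x = \<pi> i a x * partial b u x - \<pi> i b x * partial a u x"
      if x: "x \<in> V'" and i: "i = 3 \<or> i = 4" for x a b i
      unfolding u'[OF x] curl_cov[OF xV[OF x]] cov34[OF xV[OF x] i] ..
    obtain X kX where X: "smooth_on V' X" "smooth_on V' kX" "\<forall>x\<in>V'. \<forall>b. partial b X x = F 3 b x + kX x * partial b u x"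
      using pot[of "F 3" "\<pi> 3", OF sF curl34] by auto
    obtain Y kY where Y: "smooth_on V' Y" "smooth_on V' kY" "\<forall>x\<in>V'. \<forall>b. partial b Y x = F 4 b x + kY x * partial b u x"
      using pot[of "F 4" "\<pi> 4", OF sF curl34] by auto
    \<comment> \<open>Null rotation about \<open>F 1\<close> with the defects as parameters; the
      quadratic term keeps the second form null.\<close>
    define F' :: "4 \<Rightarrow> 4 \<Rightarrow> real^4 \<Rightarrow> real" where
      "F' k a x = (if k = 1 then F 1 a x
        else if k = 2 then F 2 a x + kX x * F 3 a x + kY x * F 4 a x + (kX x * kX x + kY x * kY x) / 2 * F 1 a x
        else if k = 3 then F 3 a x + kX x * F 1 a x else F 4 a x + kY x * F 1 a x)" for k a x
    have F': "F' 1 = (\<lambda>a x. F 1 a x)"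
      "F' 2 = (\<lambda>a x. F 2 a x + kX x * F 3 a x + kY x * F 4 a x + (kX x * kX x + kY x * kY x) / 2 * F 1 a x)"
      "F' 3 = (\<lambda>a x. F 3 a x + kX x * F 1 a x)" "F' 4 = (\<lambda>a x. F 4 a x + kY x * F 1 a x)"
      by (intro ext, simp add: F'_def)+
    have sF': "smooth_on V' (F' i a)" for i a
    proof -
      have "smooth_on V' (F' 1 a)" "smooth_on V' (F' 2 a)" "smooth_on V' (F' 3 a)" "smooth_on V' (F' 4 a)"
        unfolding F' by (intro smooth_on_add smooth_on_mult smooth_on_divide smooth_on_const sF X Y V'(1); simp)+
      then show ?thesis using exhaust_4[of i] by auto
    qed
    have nf': "null_frame V' g w F'"
    proof
      show "spacetime V' g w" by (rule spacetime_subset[OF spacetime V'(1) V'V])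
      show "smooth_on V' (F' i a)" for i a by (rule sF')
      show "ip g (F' i) (F' j) x = nullm i j" if x: "x \<in> V'" for x i j
      proof -
        have b: "ipx g x (\<lambda>a. F i a x) (\<lambda>a. F j a x) = nullm i j" for i j
          using ip_F[OF xV[OF x], of i j] by (simp add: ip_ipx)
        have "\<forall>i j. ip g (F' i) (F' j) x = nullm i j"
          unfolding forall_4 ip_ipx F' ipx_linear b by (simp add: algebra_simps)
        then show ?thesis by simp
      qed
    qed
    interpret N: null_frame V' g w F' by (rule nf')
    have XF: "partial b X x = F' 3 b x" "partial b Y x = F' 4 b x" if "x \<in> V'" for x b
      using X(3) Y(3) that u'[OF that] by (simp_all add: F')
    have c1: "cov g (F' 1) c a x = 0" if "x \<in> V'" for x c a
      using cov1[OF xV[OF that]] by (simp add: F')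
    have c34: "cov g (F' i) c a x = N.gam 2 i 2 x * F' 1 c x * F' 1 a x" if x: "x \<in> V'" and i: "i = 3 \<or> i = 4" for x i c a
    proof -
      define k where "k = (if i = 3 then kX else kY)"
      define Z where "Z = (if i = 3 then X else Y)"
      have sk: "smooth_on V' k" and sZ: "smooth_on V' Z" using X Y by (simp_all add: k_def Z_def)
      have Fi: "F' i = (\<lambda>a x. F i a x + k x * F 1 a x)" using i by (auto simp: F' k_def)
      have Zi: "partial b Z y = F' i b y" if "y \<in> V'" for y b using i XF[OF that] by (auto simp: Z_def)
      have s1: "smooth_on V' (\<lambda>x. k x * F 1 a x)" for a by (intro smooth_on_mult V'(1) sk sF)
      have "cov g (F' i) c a x = cov g (F i) c a x + cov g (\<lambda>a x. k x * F 1 a x) c a x" for c a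
        unfolding Fi by (rule cov_add[OF x sF s1])
      also have "cov g (F i) c a x + cov g (\<lambda>a x. k x * F 1 a x) c a x = (\<pi> i c x + partial c k x) * F' 1 a x" for c a
        using cov_scale[OF x sk, of "F 1" g c a, OF sF] cov34[OF xV[OF x] i] cov1[OF xV[OF x]]
        by (simp add: F' algebra_simps)
      finally have q: "cov g (F' i) c a x = (\<pi> i c x + partial c k x) * F' 1 a x" for c a .
      have "partial c (F' i a) x = partial c (partial a Z) x" for c a
        by (rule partial_cong[OF V'(1) x]) (simp add: Zi)
      then have "partial c (F' i a) x - partial a (F' i c) x = 0" for c a
        using partial_commute[OF V'(1) sZ x, of c a] by simp
      then have "cov g (F' i) c a x = cov g (F' i) a c x" for c a
        using N.curl_cov[OF x, of c i a] by simp
      then show ?thesis by (rule N.cov_gradient[OF x q])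
    qed
    have curl2: "partial c (F' 2 a) x - partial a (F' 2 c) x
        = N.gam 2 3 2 x * (F' 1 c x * F' 3 a x - F' 1 a x * F' 3 c x) + N.gam 2 4 2 x * (F' 1 c x * F' 4 a x - F' 1 a x * F' 4 c x)"
      if x: "x \<in> V'" for x c a
    proof -
      have "cov g (F' 2) c a x = N.gam 2 3 2 x * F' 1 c x * F' 3 a x + N.gam 2 4 2 x * F' 1 c x * F' 4 a x" for c a
        by (rule N.cov2_of_gradients[OF x]) (rule c1[OF x], rule c34[OF x])
      then show ?thesis unfolding N.curl_cov[OF x] by (simp add: algebra_simps)
    qed
    \<comment> \<open>Every term of the curl of \<open>F' 2\<close> contains \<open>F' 1\<close>,
      which is du; so \<open>F' 2\<close> is closed on the slices u = const.\<close>
    define \<sigma> where "\<sigma> a x = - (N.gam 2 3 2 x * F' 3 a x + N.gam 2 4 2 x * F' 4 a x)" for a x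
    have "partial a (F' 2 b) x - partial b (F' 2 a) x = \<sigma> a x * partial b u x - \<sigma> b x * partial a u x" if x: "x \<in> V'" for x a b
      unfolding curl2[OF x] u'[OF x] \<sigma>_def by (simp add: F'(1) algebra_simps)
    then obtain v k where v: "smooth_on V' v" "smooth_on V' k" "\<forall>x\<in>V'. \<forall>b. partial b v x = F' 2 b x + k x * partial b u x"
      using pot[of "F' 2" \<sigma>, OF sF'] by auto
    have su': "smooth_on V' u" by (rule smooth_on_subset[OF su V'(3)])
    define H where "H x = - k x" for x
    have sH: "smooth_on V' H" unfolding H_def[abs_def] by (rule smooth_on_minus[OF V'(1) v(2)])
    have F2: "F' 2 a x = partial a v x + H x * partial a u x" if "x \<in> V'" for x a
      using v(3) that by (simp add: H_def)
    \<comment> \<open>On \<open>E 1\<close> the forms \<open>F' 1\<close>, \<open>F' 3\<close> and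
      \<open>F' 4\<close> vanish. Evaluating the two expressions for the curl of \<open>F' 2\<close>
      on \<open>E 1\<close>, \<open>E 2\<close> therefore isolates the derivative of
      \<open>H\<close> along \<open>E 1\<close>.\<close>
    have H1: "con (N.E 1 x) (\<lambda>a. partial a H x) = 0" if x: "x \<in> V'" for x
    proof -
      have p2: "partial c (F' 2 a) x = partial c (partial a v) x + (partial c H x * F' 1 a x + H x * partial c (partial a u) x)" for c a
      proof -
        note dd = smooth_on_differentiable[OF smooth_on_partial[OF v(1)] x] smooth_on_differentiable[OF smooth_on_partial[OF su'] x]
          smooth_on_differentiable[OF sH x]
        have "partial c (F' 2 a) x = partial c (\<lambda>x. partial a v x + H x * partial a u x) x"
          by (rule partial_cong[OF V'(1) x]) (rule F2)
        then show ?thesis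
          by (simp add: partial_add[OF dd(1) differentiable_mult[OF dd(3,2)]] partial_mult[OF dd(3,2)] u'[OF x] F')
      qed
      have "partial c H x * F' 1 a x - partial a H x * F' 1 c x = N.gam 2 3 2 x * (F' 1 c x * F' 3 a x - F' 1 a x * F' 3 c x)
          + N.gam 2 4 2 x * (F' 1 c x * F' 4 a x - F' 1 a x * F' 4 c x)" for c a
        using curl2[OF x, of c a] partial_commute[OF V'(1) v(1) x, of c a] partial_commute[OF V'(1) su' x, of c a]
        unfolding p2 by simp
      then have "con (N.E 1 x) (\<lambda>c. con (N.E 2 x) (\<lambda>a. partial c H x * F' 1 a x - partial a H x * F' 1 c x))
        = con (N.E 1 x) (\<lambda>c. con (N.E 2 x) (\<lambda>a. N.gam 2 3 2 x * (F' 1 c x * F' 3 a x - F' 1 a x * F' 3 c x)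
          + N.gam 2 4 2 x * (F' 1 c x * F' 4 a x - F' 1 a x * F' 4 c x)))"
        by (simp only:)
      then show ?thesis by (simp add: con_simps N.con_E_F[OF x])
    qed
    have "pp_frame V' g w F' u v X Y H"
    proof (intro pp_frame.intro nf' pp_frame_axioms.intro)
      show "F' 1 a x = partial a u x" if "x \<in> V'" for x a by (simp add: F' u'[OF that])
      show "F' 2 a x = partial a v x + H x * partial a u x" if "x \<in> V'" for x a by (rule F2[OF that])
      show "F' 3 a x = partial a X x" "F' 4 a x = partial a Y x" if "x \<in> V'" for x a by (simp_all add: XF[OF that])
      show "con (N.E 1 x) (\<lambda>a. partial a H x) = 0" if "x \<in> V'" for x by (rule H1[OF that])
    qed (rule su' v X Y sH)+
    then show thesis
    proof (rule that[OF V'(1,2) V'V])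
      show "wedge F' i x a b = wedge F i x a b" if "x \<in> V'" "i = 3 \<or> i = 4" for x i a b
        using that(2) by (auto simp: wedge_def F' algebra_simps)
    qed
  qed
qed

lemma null_killing_yano_pp_frame:
  assumes st: "spacetime V g w" and ky: "null_killing_yano V g w A" and pr: "pure_radiation V g w A" and p: "p \<in> V"
  obtains V' F u v X Y H where "open V'" "p \<in> V'" "V' \<subseteq> V" "pp_frame V' g w F u v X Y H"
    "\<And>x a b. x \<in> V' \<Longrightarrow> A x $ a $ b = wedge F 3 x a b"
    "\<And>x a b. x \<in> V' \<Longrightarrow> hodge g w A x $ a $ b = wedge F 4 x a b"
proof (rule null_frame_exists[OF assms])
  fix V1 F \<sigma>
  assume V1: "open V1" "p \<in> V1" "V1 \<subseteq> V" and nf: "null_frame V1 g w F"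
    and A: "\<And>x a b. x \<in> V1 \<Longrightarrow> A x $ a $ b = wedge F 3 x a b"
    and B: "\<And>x a b. x \<in> V1 \<Longrightarrow> hodge g w A x $ a $ b = wedge F 4 x a b"
    and ric: "\<And>x a b. x \<in> V1 \<Longrightarrow> ricci g x a b = \<sigma> x * F 1 a x * F 1 b x"
  interpret null_frame V1 g w F by (rule nf)
  have "smooth_on V A" using ky by (simp add: null_killing_yano_def killing_yano_def two_form_on_def)
  then have "killing_yano V1 g A"
    using ky V1(3) smooth_on_subset[OF \<open>smooth_on V A\<close> V1(3)]
    unfolding null_killing_yano_def killing_yano_def two_form_on_def by auto
  moreover have "A x $ a $ b = F 1 a x * F 3 b x - F 1 b x * F 3 a x" if "x \<in> V1" for x a b
    using A[OF that] by (simp add: wedge_def)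
  ultimately have c: "cov g (F 1) c a x = 0"
    "cov g (F 3) c a x = - con (E 2 x) (\<lambda>a. cov g (F 3) c a x) * F 1 a x"
    "cov g (F 4) c a x = - con (E 2 x) (\<lambda>a. cov g (F 4) c a x) * F 1 a x" if "x \<in> V1" for x c a
    using killing_yano_parallel_cov[of A x \<sigma> c a] ric that by auto
  have c34: "cov g (F i) c a x = - con (E 2 x) (\<lambda>a. cov g (F i) c a x) * F 1 a x" if "x \<in> V1" "i = 3 \<or> i = 4" for x i c a
    using c(2,3)[OF that(1)] that(2) by auto
  show thesis
  proof (rule pp_frame_exists[OF nf V1(2) c(1) c34])
    fix V' F' u v X Y H
    assume V': "open V'" "p \<in> V'" "V' \<subseteq> V1" "pp_frame V' g w F' u v X Y H"
      and W: "\<And>x i a b. x \<in> V' \<Longrightarrow> i = 3 \<or> i = 4 \<Longrightarrow> wedge F' i x a b = wedge F i x a b"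
    show thesis
    proof (rule that[OF V'(1,2) _ V'(4)])
      show "V' \<subseteq> V" using V'(3) V1(3) by auto
      show "A x $ a $ b = wedge F' 3 x a b" if "x \<in> V'" for x a b
        using A[of x a b] W[OF that, of 3 a b] V'(3) that by auto
      show "hodge g w A x $ a $ b = wedge F' 4 x a b" if "x \<in> V'" for x a b
        using B[of x a b] W[OF that, of 4 a b] V'(3) that by auto
    qed
  qed
qed

lemma partial_Re: "f differentiable (at x) \<Longrightarrow> partial a (\<lambda>x. Re (f x)) x = Re (partial a f x)"
  by (rule partial_bounded_linear[OF bounded_linear_Re])

lemma partial_Im: "f differentiable (at x) \<Longrightarrow> partial a (\<lambda>x. Im (f x)) x = Im (partial a f x)"
  by (rule partial_bounded_linear[OF bounded_linear_Im])

lemma partial_Complex: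
  assumes "open S" "x \<in> S" "smooth_on S f" "smooth_on S g"
  shows "partial a (\<lambda>x. Complex (f x) (g x)) x = Complex (partial a f x) (partial a g x)"
proof -
  have d: "(\<lambda>x. Complex (f x) (g x)) differentiable (at x)"
    using smooth_on_differentiable[OF smooth_on_Complex[OF assms(1,3,4)] assms(2)] .
  show ?thesis using partial_Re[OF d, of a] partial_Im[OF d, of a] by (simp add: complex_eq_iff)
qed

lemma partial_scale:
  fixes f :: "real^4 \<Rightarrow> real"
  shows "f differentiable (at x) \<Longrightarrow> partial a (\<lambda>x. f x / c) x = partial a f x / c"
  by (rule partial_bounded_linear[OF bounded_linear_divide])

text \<open>The Taylor polynomial of degree two about a moving point, evaluated at the fixed point
  \<open>e\<close>, has derivatives along the slice that contain only third derivatives of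
  \<open>f\<close>, which vanish. So it is constant, and its values at \<open>e\<close> and
  \<open>y\<close> give Taylor's formula without remainder. The first derivatives of
  \<open>f\<close> are treated in the same way.\<close>

lemma quadratic_on_cube:
  fixes f :: "real^4 \<Rightarrow> real"
  assumes f: "smooth_on (cube c r) f" and f2: "\<And>y. y \<in> cube c r \<Longrightarrow> partial 2 f y = 0"
    and P: "\<And>y i. y \<in> cube c r \<Longrightarrow> i = 3 \<or> i = 4 \<Longrightarrow>
      partial i (partial 3 (partial 3 f)) y = partial i (partial 4 (partial 4 f)) y"
    and Q: "\<And>y i. y \<in> cube c r \<Longrightarrow> i = 3 \<or> i = 4 \<Longrightarrow> partial i (partial 3 (partial 4 f)) y = 0"
    and y: "y \<in> cube c r" and e: "e \<in> cube c r" "e $ 1 = y $ 1"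
  shows "f y = f e + partial 3 f e * (y $ 3 - e $ 3) + partial 4 f e * (y $ 4 - e $ 4)
    + partial 3 (partial 3 f) e / 2 * (y $ 3 - e $ 3)^2 + partial 3 (partial 4 f) e * ((y $ 3 - e $ 3) * (y $ 4 - e $ 4))
    + partial 4 (partial 4 f) e / 2 * (y $ 4 - e $ 4)^2"
proof -
  let ?W = "cube c r" and ?I = "{2, 3, 4} :: 4 set"
  note sp = smooth_on_partial[OF f] and spp = smooth_on_partial[OF smooth_on_partial[OF f]]
  have comm: "partial a (partial b f) z = partial b (partial a f) z" if "z \<in> ?W" for a b z
    by (rule partial_commute[OF open_cube f that])
  have comm2: "partial a (partial b (partial d f)) z = partial b (partial a (partial d f)) z" if "z \<in> ?W" for a b d z
    by (rule partial_commute[OF open_cube sp that])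
  have comm3: "partial a (partial b (partial d f)) z = partial a (partial d (partial b f)) z" if "z \<in> ?W" for a b d z
    by (rule partial_cong[OF open_cube that]) (rule comm)
  have z2: "partial 2 (partial a f) z = 0" if "z \<in> ?W" for a z
  proof -
    have "partial a (partial 2 f) z = partial a (\<lambda>z. 0) z" by (rule partial_cong[OF open_cube that]) (rule f2)
    then show ?thesis using comm[OF that, of 2 a] by simp
  qed
  have z22: "partial 2 (partial a (partial b f)) z = 0" if "z \<in> ?W" for a b z
  proof -
    have "partial a (partial 2 (partial b f)) z = partial a (\<lambda>z. 0) z" by (rule partial_cong[OF open_cube that]) (rule z2)
    then show ?thesis using comm2[OF that, of 2 a] by simp
  qed
  have third: "partial 3 (partial 4 (partial 4 f)) z = 0" "partial 4 (partial 3 (partial 3 f)) z = 0"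
    "partial 4 (partial 4 (partial 4 f)) z = 0" "partial 3 (partial 3 (partial 3 f)) z = 0" if z: "z \<in> ?W" for z
  proof -
    show 1: "partial 3 (partial 4 (partial 4 f)) z = 0"
      using comm2[OF z, of 3 4 4] Q[OF z, of 4] by simp
    show 2: "partial 4 (partial 3 (partial 3 f)) z = 0"
      using comm2[OF z, of 4 3 3] comm3[OF z, of 3 4 3] Q[OF z, of 3] by simp
    show "partial 4 (partial 4 (partial 4 f)) z = 0" using P[OF z, of 4] 2 by simp
    show "partial 3 (partial 3 (partial 3 f)) z = 0" using P[OF z, of 3] 1 by simp
  qed
  have Q': "partial 4 (partial 3 (partial 4 f)) z = 0" "partial 3 (partial 3 (partial 4 f)) z = 0" if "z \<in> ?W" for z
    using Q[OF that] by auto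
  have ye: "y $ i = e $ i" if "i \<notin> ?I" for i using that e(2) exhaust_4[of i] by auto
  have const: "k y = k e" if k: "smooth_on ?W k" "\<And>z. z \<in> ?W \<Longrightarrow> partial 2 k z = 0" "\<And>z. z \<in> ?W \<Longrightarrow> partial 3 k z = 0"
      "\<And>z. z \<in> ?W \<Longrightarrow> partial 4 k z = 0" for k :: "real^4 \<Rightarrow> real"
  proof (rule constant_along_slices[of c r k ?I, OF k(1) _ y e(1)])
    show "partial i k z = 0" if "z \<in> ?W" "i \<in> ?I" for z i using k(2-4)[OF that(1)] that(2) by auto
  qed (rule ye)
  have c2: "partial 3 (partial 3 f) y = partial 3 (partial 3 f) e" "partial 3 (partial 4 f) y = partial 3 (partial 4 f) e"
    "partial 4 (partial 4 f) y = partial 4 (partial 4 f) e"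
    by (rule const; (rule spp | simp add: z22 third Q'))+
  define x where "x z = z $ 3 - e $ 3" for z :: "real^4"
  define t where "t z = z $ 4 - e $ 4" for z :: "real^4"
  have sx: "smooth_on ?W x" "smooth_on ?W t"
    unfolding x_def[abs_def] t_def[abs_def] by (intro smooth_on_diff smooth_on_const smooth_on_coordinate open_cube)+
  have px: "partial a x z = (if a = 3 then 1 else 0)" "partial a t z = (if a = 4 then 1 else 0)" if z: "z \<in> ?W" for a z
    unfolding x_def[abs_def] t_def[abs_def]
    using smooth_on_differentiable[OF smooth_on_coordinate[OF open_cube] z]
    by (subst partial_diff; simp add: partial_coordinate)+
  have x0: "x e = 0" "t e = 0" by (simp_all add: x_def t_def)
  note d = smooth_on_differentiable[OF f] smooth_on_differentiable[OF sp] smooth_on_differentiable[OF spp]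
    smooth_on_differentiable[OF sx(1)] smooth_on_differentiable[OF sx(2)]
  note derivs = partial_add partial_diff partial_mult differentiable_add differentiable_diff differentiable_mult d px
  have c1: "partial 3 f y - partial 3 (partial 3 f) y * x y - partial 3 (partial 4 f) y * t y = partial 3 f e"
  proof -
    let ?G = "\<lambda>z. partial 3 f z - partial 3 (partial 3 f) z * x z - partial 3 (partial 4 f) z * t z"
    have "?G y = ?G e"
      by (intro const smooth_on_diff smooth_on_mult open_cube sx sp spp)
        (simp_all add: derivs z2 z22 third Q' comm[of _ 4 3])
    then show ?thesis by (simp add: x0)
  qed
  have c1': "partial 4 f y - partial 3 (partial 4 f) y * x y - partial 4 (partial 4 f) y * t y = partial 4 f e"
  proof -
    let ?G = "\<lambda>z. partial 4 f z - partial 3 (partial 4 f) z * x z - partial 4 (partial 4 f) z * t z"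
    have "?G y = ?G e"
      by (intro const smooth_on_diff smooth_on_mult open_cube sx sp spp)
        (simp_all add: derivs z2 z22 third Q')
    then show ?thesis by (simp add: x0)
  qed
  have c0: "2 * f y - 2 * (partial 3 f y * x y) - 2 * (partial 4 f y * t y) + partial 3 (partial 3 f) y * (x y * x y)
      + 2 * (partial 3 (partial 4 f) y * (x y * t y)) + partial 4 (partial 4 f) y * (t y * t y) = 2 * f e"
  proof -
    \<comment> \<open>Twice the Taylor polynomial about \<open>z\<close>, evaluated at
      \<open>e\<close>.\<close>
    let ?G = "\<lambda>z. 2 * f z - 2 * (partial 3 f z * x z) - 2 * (partial 4 f z * t z) + partial 3 (partial 3 f) z * (x z * x z)
      + 2 * (partial 3 (partial 4 f) z * (x z * t z)) + partial 4 (partial 4 f) z * (t z * t z)"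
    have "?G y = ?G e"
      by (intro const smooth_on_diff smooth_on_add smooth_on_mult smooth_on_const open_cube sx f sp spp)
        (simp_all add: derivs f2 z2 z22 third Q' comm[of _ 4 3] algebra_simps)
    then show ?thesis by (simp add: x0)
  qed
  let ?a = "partial 3 (partial 3 f) e" and ?b = "partial 3 (partial 4 f) e" and ?d = "partial 4 (partial 4 f) e"
  have f3: "partial 3 f y = partial 3 f e + ?a * x y + ?b * t y" and f4: "partial 4 f y = partial 4 f e + ?b * x y + ?d * t y"
    using c1 c1' unfolding c2 by linarith+
  have "f y = f e + partial 3 f e * x y + partial 4 f e * t y + ?a / 2 * (x y * x y) + ?b * (x y * t y) + ?d / 2 * (t y * t y)"
    using c0 unfolding c2 f3 f4 by (simp add: algebra_simps)
  then show ?thesis by (simp add: x_def t_def power2_eq_square)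
qed

text \<open>The coefficients come from Re z = (z + cnj z) / 2 and Im z = (z - cnj z) / (2
  i).\<close>

lemma quadratic_on_real:
  assumes "\<And>s z. (s, z) \<in> D \<Longrightarrow> H (s, z) = b0 s + b1 s * Re z + b2 s * Im z
    + b3 s * (Re z)\<^sup>2 + b4 s * (Re z * Im z) + b5 s * (Im z)\<^sup>2"
  shows "quadratic_on D H"
proof -
  have "complex_of_real (H (s, z)) = Complex (b0 s) 0 + Complex (b1 s / 2) (- b2 s / 2) * z + Complex (b1 s / 2) (b2 s / 2) * cnj z
      + Complex ((b3 s - b5 s) / 4) (- b4 s / 4) * z\<^sup>2 + Complex ((b3 s + b5 s) / 2) 0 * z * cnj z
      + Complex ((b3 s - b5 s) / 4) (b4 s / 4) * (cnj z)\<^sup>2" if "(s, z) \<in> D" for s z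
    unfolding assms[OF that] by (simp add: complex_eq_iff power2_eq_square field_simps)
  then show ?thesis unfolding quadratic_on_def by (intro exI) auto
qed

section \<open>The real coordinates u, v, X, Y\<close>

context pp_frame
begin

definition coords :: "real^4 \<Rightarrow> real^4" where
  "coords x = (\<chi> i. if i = 1 then u x else if i = 2 then v x else if i = 3 then X x else Y x)"

lemma coords_nth: "(\<lambda>x. coords x $ 1) = u" "(\<lambda>x. coords x $ 2) = v" "(\<lambda>x. coords x $ 3) = X" "(\<lambda>x. coords x $ 4) = Y"
  by (simp_all add: coords_def)

lemma smooth_coords: "smooth_on V coords"
proof (rule smooth_on_vec[OF open_U])
  show "smooth_on V (\<lambda>x. coords x $ i)" for i
    using exhaust_4[of i] smooth_uvXYH by (elim disjE) (simp_all add: coords_nth)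
qed

lemma vector_expand:
  assumes x: "x \<in> V"
  shows "z a = - con z (\<lambda>b. F 2 b x) * E 1 x a - con z (\<lambda>b. F 1 b x) * E 2 x a
    + con z (\<lambda>b. F 3 b x) * E 3 x a + con z (\<lambda>b. F 4 b x) * E 4 x a"
proof -
  have "z a = (\<Sum>b\<in>UNIV. (if a = b then 1 else 0) * z b)" by (simp add: sum_kronecker)
  also have "\<dots> = (\<Sum>b\<in>UNIV. (- E 1 x a * F 2 b x - E 2 x a * F 1 b x + E 3 x a * F 3 b x + E 4 x a * F 4 b x) * z b)"
    by (simp only: completeness[OF x])
  finally show ?thesis
    by (simp add: con_def sum_distrib_left sum_distrib_right sum_subtractf sum.distrib sum_negf algebra_simps)
qed

lemma con_F:
  assumes x: "x \<in> V"
  shows "con z (\<lambda>b. F 1 b x) = con z (\<lambda>b. partial b u x)"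
    "con z (\<lambda>b. F 2 b x) = con z (\<lambda>b. partial b v x) + H x * con z (\<lambda>b. partial b u x)"
    "con z (\<lambda>b. F 3 b x) = con z (\<lambda>b. partial b X x)" "con z (\<lambda>b. F 4 b x) = con z (\<lambda>b. partial b Y x)"
  by (simp_all add: F1[OF x] F2[OF x] F3[OF x] F4[OF x] con_simps)

end

locale pp_chart = pp_frame V g w F u v X Y H
  for V g w F u v X Y H +
  fixes p :: "real^4" and r :: real and S :: "(real^4) set" and \<gamma> :: "real^4 \<Rightarrow> real^4"
  assumes r: "r > 0" and S: "open S" "p \<in> S" "S \<subseteq> V"
    and image: "coords ` S = cube (coords p) r" "\<gamma> ` cube (coords p) r = S"
    and \<gamma>_coords: "\<And>x. x \<in> S \<Longrightarrow> \<gamma> (coords x) = x"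
    and coords_\<gamma>: "\<And>y. y \<in> cube (coords p) r \<Longrightarrow> coords (\<gamma> y) = y"
    and smooth_\<gamma>: "smooth_on (cube (coords p) r) \<gamma>"

text \<open>A vector annihilated by du, dv, dX and dY is annihilated by all forms of the frame and
  hence zero, so the inverse function theorem applies to \<open>coords\<close>.\<close>

lemma (in pp_frame) pp_chart_exists:
  assumes p: "p \<in> V"
  obtains r S \<gamma> where "pp_chart V g w F u v X Y H p r S \<gamma>"
proof -
  have "z = 0" if z: "frechet_derivative coords (at p) z = 0" for z
  proof -
    have *: "con (\<lambda>a. z $ a) (\<lambda>a. partial a (\<lambda>x. coords x $ i) p) = 0" for i
      using frechet_nth[OF smooth_on_differentiable[OF smooth_coords p], of z i] z by (simp add: con_def)
    have "con (\<lambda>a. z $ a) (\<lambda>b. F i b p) = 0" if "i = 1 \<or> i = 2 \<or> i = 3 \<or> i = 4" for i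
      using that *[of 1] *[of 2] *[of 3] *[of 4] unfolding coords_nth by (auto simp: con_F[OF p])
    then have "z $ a = 0" for a using vector_expand[OF p, of "\<lambda>a. z $ a" a] by simp
    then show ?thesis by (simp add: vec_eq_iff)
  qed
  then show thesis
  proof (rule smooth_chart[OF open_U p smooth_coords])
    fix r S \<gamma>
    assume "0 < r" "open S" "p \<in> S" "S \<subseteq> V" "coords ` S = cube (coords p) r" "\<gamma> ` cube (coords p) r = S"
      "\<And>x. x \<in> S \<Longrightarrow> \<gamma> (coords x) = x" "\<And>y. y \<in> cube (coords p) r \<Longrightarrow> coords (\<gamma> y) = y" "smooth_on (cube (coords p) r) \<gamma>"
    then have "pp_chart V g w F u v X Y H p r S \<gamma>"
      by unfold_locales
    then show thesis by (rule that)
  qed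
qed

context pp_chart
begin

abbreviation W' where "W' \<equiv> cube (coords p) r"

lemma \<gamma>_in: "y \<in> W' \<Longrightarrow> \<gamma> y \<in> S" "y \<in> W' \<Longrightarrow> \<gamma> y \<in> V"
  using image S by auto

lemma coords_in: "x \<in> S \<Longrightarrow> coords x \<in> W'"
  using image by auto

lemma smooth_comp_\<gamma>: "smooth_on S f \<Longrightarrow> smooth_on W' (\<lambda>y. f (\<gamma> y))" for f :: "real^4 \<Rightarrow> real"
  using smooth_on_compose[OF open_cube smooth_\<gamma>, of S f] image by simp

text \<open>A coordinate field is determined by its pairings with the frame forms, and these are
  immediate from the forms du, dv + H du, dX, dY. The sign for v stems from the product -1 of
  \<open>F 1\<close> and \<open>F 2\<close>.\<close>

lemma partial_\<gamma>:
  assumes y: "y \<in> W'"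
  shows "partial 2 (\<lambda>y. \<gamma> y $ a) y = - E 1 (\<gamma> y) a" "partial 3 (\<lambda>y. \<gamma> y $ a) y = E 3 (\<gamma> y) a"
    "partial 4 (\<lambda>y. \<gamma> y $ a) y = E 4 (\<gamma> y) a"
proof -
  let ?G = "\<lambda>i a. partial i (\<lambda>y. \<gamma> y $ a) y"
  have *: "con (?G i) (\<lambda>a. partial a (\<lambda>x. coords x $ j) (\<gamma> y)) = (if j = i then 1 else 0)" for i j
  proof -
    have "partial i (\<lambda>y. coords (\<gamma> y) $ j) y = partial i (\<lambda>y. y $ j) y"
      by (rule partial_cong[OF open_cube y]) (simp add: coords_\<gamma>)
    moreover have "(\<lambda>x. coords x $ j) differentiable (at (\<gamma> y))"
      by (rule smooth_on_differentiable[OF smooth_on_nth[OF open_U smooth_coords] \<gamma>_in(2)[OF y]])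
    ultimately show ?thesis
      using partial_compose[of "\<lambda>x. coords x $ j" \<gamma> y i] smooth_on_differentiable[OF smooth_\<gamma> y]
      by (simp add: con_def partial_coordinate)
  qed
  have "con (?G i) (\<lambda>b. F 1 b (\<gamma> y)) = (if i = 1 then 1 else 0)"
    "con (?G i) (\<lambda>b. F 2 b (\<gamma> y)) = (if i = 2 then 1 else 0) + H (\<gamma> y) * (if i = 1 then 1 else 0)"
    "con (?G i) (\<lambda>b. F 3 b (\<gamma> y)) = (if i = 3 then 1 else 0)" "con (?G i) (\<lambda>b. F 4 b (\<gamma> y)) = (if i = 4 then 1 else 0)" for i
    using *[of i 1] *[of i 2] *[of i 3] *[of i 4] unfolding con_F[OF \<gamma>_in(2)[OF y]] coords_nth by auto
  then show "?G 2 a = - E 1 (\<gamma> y) a" "?G 3 a = E 3 (\<gamma> y) a" "?G 4 a = E 4 (\<gamma> y) a"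
    using vector_expand[OF \<gamma>_in(2)[OF y], of "?G 2" a] vector_expand[OF \<gamma>_in(2)[OF y], of "?G 3" a]
      vector_expand[OF \<gamma>_in(2)[OF y], of "?G 4" a] by simp_all
qed

lemma partial_comp_\<gamma>:
  fixes f :: "real^4 \<Rightarrow> real"
  assumes f: "smooth_on S f" and y: "y \<in> W'"
  shows "partial 2 (\<lambda>y. f (\<gamma> y)) y = - con (E 1 (\<gamma> y)) (\<lambda>a. partial a f (\<gamma> y))"
    "partial 3 (\<lambda>y. f (\<gamma> y)) y = con (E 3 (\<gamma> y)) (\<lambda>a. partial a f (\<gamma> y))"
    "partial 4 (\<lambda>y. f (\<gamma> y)) y = con (E 4 (\<gamma> y)) (\<lambda>a. partial a f (\<gamma> y))"
proof -
  have "partial i (\<lambda>y. f (\<gamma> y)) y = con (\<lambda>a. partial i (\<lambda>y. \<gamma> y $ a) y) (\<lambda>a. partial a f (\<gamma> y))" for i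
    using partial_compose[OF smooth_on_differentiable[OF f \<gamma>_in(1)[OF y]] smooth_on_differentiable[OF smooth_\<gamma> y], of i]
    by (simp add: con_def)
  then show "partial 2 (\<lambda>y. f (\<gamma> y)) y = - con (E 1 (\<gamma> y)) (\<lambda>a. partial a f (\<gamma> y))"
    "partial 3 (\<lambda>y. f (\<gamma> y)) y = con (E 3 (\<gamma> y)) (\<lambda>a. partial a f (\<gamma> y))"
    "partial 4 (\<lambda>y. f (\<gamma> y)) y = con (E 4 (\<gamma> y)) (\<lambda>a. partial a f (\<gamma> y))"
    by (simp_all add: partial_\<gamma>[OF y] con_def sum_negf)
qed

definition Hc :: "real^4 \<Rightarrow> real" where "Hc y = H (\<gamma> y)"

lemma smooth_Hc: "smooth_on W' Hc"
  unfolding Hc_def[abs_def] by (rule smooth_comp_\<gamma>[OF smooth_on_subset[OF smooth_uvXYH(5) S(3)]])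

lemma partial_Hc:
  assumes y: "y \<in> W'"
  shows "partial 2 Hc y = 0" "partial 3 Hc y = h 3 (\<gamma> y)" "partial 4 Hc y = h 4 (\<gamma> y)"
  unfolding Hc_def[abs_def] partial_comp_\<gamma>[OF smooth_on_subset[OF smooth_uvXYH(5) S(3)] y] h_def
  using H_along_1[OF \<gamma>_in(2)[OF y]] by simp_all

lemma partial2_Hc:
  assumes y: "y \<in> W'" and i: "i = 3 \<or> i = 4" and j: "j = 3 \<or> j = 4"
  shows "partial i (partial j Hc) y = hh i j (\<gamma> y)"
proof -
  have "partial i (partial j Hc) y = partial i (\<lambda>y. h j (\<gamma> y)) y"
    by (rule partial_cong[OF open_cube y]) (use j partial_Hc in auto)
  then show ?thesis
    using i partial_comp_\<gamma>[OF smooth_on_subset[OF smooth_h S(3)] y, of j] by (auto simp: hh_def)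
qed

end

section \<open>The complex coordinate and the profile as a function of u and \<xi>\<close>

context pp_chart
begin

text \<open>The factor 1/sqrt 2 turns 2 d\<xi> d(cnj \<xi>) into dX^2 + dY^2.\<close>

definition \<xi> :: "real^4 \<Rightarrow> complex" where
  "\<xi> x = Complex (X x / sqrt 2) (Y x / sqrt 2)"

text \<open>As \<open>H\<close> does not depend on v, a function of u and \<xi> is obtained by
  freezing v at its value at the centre, which keeps the point inside the cube.\<close>

definition slice :: "real \<times> complex \<Rightarrow> real^4" where
  "slice q = (\<chi> i. if i = 1 then fst q else if i = 2 then v p else if i = 3 then sqrt 2 * Re (snd q) else sqrt 2 * Im (snd q))"

definition real_coords :: "real \<times> real \<times> complex \<Rightarrow> real^4" where
  "real_coords q = (\<chi> i. if i = 1 then fst q else if i = 2 then fst (snd q)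
     else if i = 3 then sqrt 2 * Re (snd (snd q)) else sqrt 2 * Im (snd (snd q)))"

definition Hs :: "real \<times> complex \<Rightarrow> real" where
  "Hs q = Hc (slice q)"

lemma smooth_slice: "smooth_on UNIV slice"
proof (rule smooth_on_vec[OF open_UNIV])
  have "smooth_on UNIV (\<lambda>q. fst q :: real)" for q :: "real \<times> complex"
    by (intro smooth_on_linear bounded_linear_fst open_UNIV)
  moreover have "smooth_on UNIV (\<lambda>q::real \<times> complex. sqrt 2 * Re (snd q))" "smooth_on UNIV (\<lambda>q::real \<times> complex. sqrt 2 * Im (snd q))"
    by (intro smooth_on_mult smooth_on_const open_UNIV smooth_on_bounded_linear[OF bounded_linear_Re]
        smooth_on_bounded_linear[OF bounded_linear_Im] smooth_on_linear bounded_linear_snd)+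
  moreover have "smooth_on UNIV (\<lambda>q::real \<times> complex. v p)" by (rule smooth_on_const)
  ultimately show "smooth_on UNIV (\<lambda>q. slice q $ i)" for i
    using exhaust_4[of i] smooth_on_linear[OF bounded_linear_fst open_UNIV]
    by (elim disjE) (simp_all add: slice_def)
qed

lemma bounded_linear_real_coords: "bounded_linear real_coords"
  unfolding linear_conv_bounded_linear[symmetric]
  by (rule linearI) (auto simp: real_coords_def vec_eq_iff algebra_simps)

lemma slice_in:
  assumes x: "x \<in> S"
  shows "slice (u x, \<xi> x) \<in> W'"
proof -
  have "\<bar>slice (u x, \<xi> x) $ i - coords p $ i\<bar> < r" for i
  proof (cases "i = 2")
    case True
    then show ?thesis using r by (simp add: slice_def coords_def)
  next
    case False
    then have "slice (u x, \<xi> x) $ i = coords x $ i" by (simp add: slice_def coords_def \<xi>_def)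
    then show ?thesis using coords_in[OF x] by (simp add: cube_def)
  qed
  then show ?thesis by (simp add: cube_def)
qed

lemma Hs_eq:
  assumes x: "x \<in> S"
  shows "Hs (u x, \<xi> x) = H x"
proof -
  have "Hc (slice (u x, \<xi> x)) = Hc (coords x)"
  proof (rule constant_along_slices[of "coords p" r Hc "{2}", OF smooth_Hc])
    show "partial i Hc y = 0" if "y \<in> W'" "i \<in> {2}" for y i using partial_Hc(1)[OF that(1)] that(2) by simp
    show "slice (u x, \<xi> x) $ i = coords x $ i" if "i \<notin> {2}" for i using that by (simp add: slice_def coords_def \<xi>_def)
  qed (rule slice_in[OF x] coords_in[OF x])+
  then show ?thesis by (simp add: Hs_def Hc_def \<gamma>_coords[OF x])
qed

text \<open>The pairs that \<open>slice\<close> maps into the cube form an open set containing all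
  values of (u, \<xi>) on \<open>S\<close>, and there \<open>Hs\<close> is a composition of smooth
  maps.\<close>

lemma smooth_Hs: "smooth_on ((\<lambda>x. (u x, \<xi> x)) ` S) Hs"
proof -
  have o: "open (slice -` W')"
    by (rule open_vimage[OF open_cube smooth_on_continuous[OF smooth_slice]])
  have "smooth_on (slice -` W') Hs"
    unfolding Hs_def[abs_def]
    by (rule smooth_on_compose[OF o smooth_on_subset[OF smooth_slice] smooth_Hc]) auto
  then show ?thesis by (rule smooth_on_subset) (use slice_in in auto)
qed

lemma smooth_\<xi>: "smooth_on V \<xi>"
  unfolding \<xi>_def[abs_def] by (intro smooth_on_Complex smooth_on_divide smooth_on_const smooth_uvXYH open_U) auto

text \<open>\<open>real_coords\<close> is the linear change from (u, v, \<xi>) to the real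
  coordinates; image and inverse of the complex chart are those of \<open>coords\<close>,
  transported by it.\<close>

lemma coordinates_on_chart: "coordinates_on S (\<lambda>x. (u x, v x, \<xi> x))"
proof -
  let ?P = "\<lambda>x. (u x, v x, \<xi> x)"
  have RC: "real_coords (?P x) = coords x" for x
    by (simp add: real_coords_def coords_def \<xi>_def vec_eq_iff)
  have inv: "?P (\<gamma> (real_coords q)) = q" if "real_coords q \<in> W'" for q
  proof -
    have c: "coords (\<gamma> (real_coords q)) $ i = real_coords q $ i" for i by (simp add: coords_\<gamma>[OF that])
    show ?thesis
      using c[of 1] c[of 2] c[of 3] c[of 4] by (simp add: coords_def real_coords_def \<xi>_def prod_eq_iff complex_eq_iff)
  qed
  have img: "?P ` S = real_coords -` W'"
  proof
    show "?P ` S \<subseteq> real_coords -` W'"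
    proof (rule image_subsetI)
      show "?P x \<in> real_coords -` W'" if "x \<in> S" for x using coords_in[OF that] by (simp add: RC)
    qed
    show "real_coords -` W' \<subseteq> ?P ` S"
    proof
      fix q assume q: "q \<in> real_coords -` W'"
      then have q': "real_coords q \<in> W'" by simp
      show "q \<in> ?P ` S" by (rule image_eqI[of q ?P, OF inv[OF q', symmetric] \<gamma>_in(1)[OF q']])
    qed
  qed
  have cont: "continuous_on UNIV real_coords"
    by (rule linear_continuous_on[OF bounded_linear_real_coords])
  have oimg: "open (real_coords -` W')" by (rule open_vimage[OF open_cube cont])
  have inj: "inj_on ?P S"
  proof (rule inj_onI)
    fix x y assume xy: "x \<in> S" "y \<in> S" "?P x = ?P y"
    then have "coords x = coords y" using RC[of x] RC[of y] by simp
    then have "\<gamma> (coords x) = \<gamma> (coords y)" by (rule arg_cong)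
    then show "x = y" unfolding \<gamma>_coords[OF xy(1)] \<gamma>_coords[OF xy(2)] .
  qed
  have "inv_into S ?P q = \<gamma> (real_coords q)" if "q \<in> real_coords -` W'" for q
  proof -
    have q: "real_coords q \<in> W'" using that by simp
    show ?thesis by (rule inv_into_f_eq[OF inj \<gamma>_in(1)[OF q] inv[OF q]])
  qed
  moreover have "smooth_on (real_coords -` W') (\<lambda>q. \<gamma> (real_coords q))"
    by (rule smooth_on_compose[OF oimg smooth_on_linear[OF bounded_linear_real_coords oimg] smooth_\<gamma>]) auto
  ultimately have "smooth_on (real_coords -` W') (inv_into S ?P)"
    using smooth_on_cong[OF oimg, of "inv_into S ?P" "\<lambda>q. \<gamma> (real_coords q)"] by simp
  moreover have "smooth_on S ?P"
    by (intro smooth_on_Pair S(1) smooth_on_subset[OF _ S(3)] smooth_uvXYH smooth_\<xi>)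
  ultimately show ?thesis
    unfolding coordinates_on_def img using S(1) inj oimg by simp
qed

lemma pp_wave_chart: "pp_wave_on S g u v \<xi> Hs"
  unfolding pp_wave_on_def
proof (intro conjI ballI allI)
  show "coordinates_on S (\<lambda>x. (u x, v x, \<xi> x))" by (rule coordinates_on_chart)
  show "smooth_on ((\<lambda>x. (u x, \<xi> x)) ` S) Hs" by (rule smooth_Hs)
  fix x a b assume x: "x \<in> S"
  then have xV: "x \<in> V" using S by auto
  have p: "partial a \<xi> x = Complex (partial a X x / sqrt 2) (partial a Y x / sqrt 2)" for a
  proof -
    have "partial a \<xi> x = Complex (partial a (\<lambda>x. X x / sqrt 2) x) (partial a (\<lambda>x. Y x / sqrt 2) x)"
      unfolding \<xi>_def[abs_def] by (rule partial_Complex[OF open_U xV])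
        (intro smooth_on_divide smooth_on_const smooth_uvXYH open_U; simp)+
    then show ?thesis
      using smooth_on_differentiable[OF smooth_uvXYH(3) xV] smooth_on_differentiable[OF smooth_uvXYH(4) xV]
      by (simp add: partial_scale)
  qed
  have s: "sqrt 2 * sqrt 2 = (2::real)" by simp
  show "complex_of_real (g x $ a $ b) =
        - complex_of_real (partial a u x * partial b v x + partial b u x * partial a v x)
        - complex_of_real (2 * Hs (u x, \<xi> x) * partial a u x * partial b u x)
        + (partial a \<xi> x * cnj (partial b \<xi> x) + partial b \<xi> x * cnj (partial a \<xi> x))"
    unfolding p Hs_eq[OF x] g_expand[OF xV] F1[OF xV] F2[OF xV] F3[OF xV] F4[OF xV]
    by (simp add: complex_eq_iff field_simps)
qed

lemma quadratic_chart:
  assumes a: "smooth_on S a" "\<And>x. x \<in> S \<Longrightarrow> a x = (hh 3 3 x - hh 4 4 x) / 2"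
      "\<And>x i. x \<in> S \<Longrightarrow> i = 3 \<or> i = 4 \<Longrightarrow> con (E i x) (\<lambda>c. partial c a x) = 0"
    and b: "smooth_on S b" "\<And>x. x \<in> S \<Longrightarrow> b x = hh 3 4 x"
      "\<And>x i. x \<in> S \<Longrightarrow> i = 3 \<or> i = 4 \<Longrightarrow> con (E i x) (\<lambda>c. partial c b x) = 0"
  shows "quadratic_on ((\<lambda>x. (u x, \<xi> x)) ` S) Hs"
proof -
  have z: "partial i (\<lambda>y. f (\<gamma> y)) y = 0" if "y \<in> W'" "i = 3 \<or> i = 4" "smooth_on S f"
      "\<And>x i. x \<in> S \<Longrightarrow> i = 3 \<or> i = 4 \<Longrightarrow> con (E i x) (\<lambda>c. partial c f x) = 0" for f y i
    using partial_comp_\<gamma>[OF that(3,1)] that(2) that(4)[OF \<gamma>_in(1)[OF that(1)]] by auto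
  have P: "partial i (partial 3 (partial 3 Hc)) y = partial i (partial 4 (partial 4 Hc)) y" if y: "y \<in> W'" and i: "i = 3 \<or> i = 4" for y i
  proof -
    \<comment> \<open>The difference of the two pure second derivatives of \<open>Hc\<close> is 2
      \<open>a\<close>, and \<open>a\<close> is constant along X and Y.\<close>
    have "partial i (partial 3 (partial 3 Hc)) y = partial i (\<lambda>y. partial 4 (partial 4 Hc) y + 2 * a (\<gamma> y)) y"
      by (rule partial_cong[OF open_cube y]) (simp add: partial2_Hc a(2)[OF \<gamma>_in(1)] field_simps)
    also have "\<dots> = partial i (partial 4 (partial 4 Hc)) y + partial i (\<lambda>y. 2 * a (\<gamma> y)) y"
      by (intro partial_add smooth_on_differentiable[OF smooth_on_partial[OF smooth_on_partial[OF smooth_Hc]] y]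
          smooth_on_differentiable[OF smooth_on_mult[OF open_cube smooth_on_const smooth_comp_\<gamma>[OF a(1)]] y])
    also have "partial i (\<lambda>y. 2 * a (\<gamma> y)) y = 0"
      using z[OF y i a(1) a(3)] smooth_on_differentiable[OF smooth_comp_\<gamma>[OF a(1)] y] by (simp add: partial_mult)
    finally show ?thesis by simp
  qed
  have Q: "partial i (partial 3 (partial 4 Hc)) y = 0" if y: "y \<in> W'" and i: "i = 3 \<or> i = 4" for y i
  proof -
    have "partial i (partial 3 (partial 4 Hc)) y = partial i (\<lambda>y. b (\<gamma> y)) y"
      by (rule partial_cong[OF open_cube y]) (simp add: partial2_Hc b(2)[OF \<gamma>_in(1)])
    then show ?thesis using z[OF y i b(1) b(3)] by simp
  qed
  \<comment> \<open>Base point of the expansion in the slice u = s: the remaining coordinates are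
    those of \<open>p\<close>, so the Taylor coefficients depend on s only.\<close>
  define e :: "real \<Rightarrow> real^4" where "e s = (\<chi> i. if i = 1 then s else coords p $ i)" for s
  define A0 where "A0 s = Hc (e s)" for s
  define A1 where "A1 s = partial 3 Hc (e s)" for s
  define A2 where "A2 s = partial 4 Hc (e s)" for s
  define A3 where "A3 s = partial 3 (partial 3 Hc) (e s) / 2" for s
  define A4 where "A4 s = partial 3 (partial 4 Hc) (e s)" for s
  define A5 where "A5 s = partial 4 (partial 4 Hc) (e s) / 2" for s
  let ?x = "X p" and ?y = "Y p" and ?s = "sqrt 2"
  show ?thesis
  proof (rule quadratic_on_real)
    fix s z assume "(s, z) \<in> (\<lambda>x. (u x, \<xi> x)) ` S"
    then have W: "slice (s, z) \<in> W'" using slice_in by auto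
    have e1: "e s $ 1 = slice (s, z) $ 1" by (simp add: e_def slice_def)
    have "\<bar>e s $ 1 - coords p $ 1\<bar> < r" using W by (simp add: e1 cube_def)
    then have eW: "e s \<in> W'" using r by (simp add: cube_def e_def)
    have n: "slice (s, z) $ 3 = ?s * Re z" "slice (s, z) $ 4 = ?s * Im z" "e s $ 3 = ?x" "e s $ 4 = ?y"
      by (simp_all add: slice_def e_def coords_def)
    have s2: "?s * (?s * t) = 2 * t" for t by (simp add: mult.assoc[symmetric])
    have "Hs (s, z) = A0 s + A1 s * (?s * Re z - ?x) + A2 s * (?s * Im z - ?y) + A3 s * (?s * Re z - ?x)^2
        + A4 s * ((?s * Re z - ?x) * (?s * Im z - ?y)) + A5 s * (?s * Im z - ?y)^2"
      using quadratic_on_cube[OF smooth_Hc partial_Hc(1) P Q W eW e1]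
      unfolding Hs_def A0_def A1_def A2_def A3_def A4_def A5_def n by simp
    then show "Hs (s, z) = (A0 s - A1 s * ?x - A2 s * ?y + A3 s * ?x\<^sup>2 + A4 s * ?x * ?y + A5 s * ?y\<^sup>2)
        + (?s * A1 s - 2 * ?s * A3 s * ?x - ?s * A4 s * ?y) * Re z + (?s * A2 s - 2 * ?s * A5 s * ?y - ?s * A4 s * ?x) * Im z
        + 2 * A3 s * (Re z)\<^sup>2 + 2 * A4 s * (Re z * Im z) + 2 * A5 s * (Im z)\<^sup>2"
      by (simp add: power2_eq_square algebra_simps s2)
  qed
qed

end

section \<open>The null Killing-Yano tensor of a pp-wave\<close>

context pp_frame
begin

lemma con_wedge: "x \<in> V \<Longrightarrow> con (E k x) (\<lambda>a. con (E m x) (\<lambda>b. wedge F i x a b)) = nullm k 1 * nullm m i - nullm m 1 * nullm k i"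
  unfolding wedge_def by (simp add: con_simps con_E_F)

text \<open>In any frame the dual of F1 wedge F3 is \<open>orient\<close> times F1 wedge F4;
  comparing a nonzero component with the prescribed dual fixes the sign.\<close>

lemma orient_1:
  assumes x: "x \<in> V" and A: "\<And>a b. A x $ a $ b = wedge F 3 x a b" and B: "\<And>a b. hodge g w A x $ a $ b = wedge F 4 x a b"
  shows "orient x = 1"
proof -
  have "wedge F 4 x a b = orient x * wedge F 4 x a b" for a b
    using form_sd_wedge(1)[of x A, OF x A, of a b] unfolding B .
  then have "con (E 2 x) (\<lambda>a. con (E 4 x) (\<lambda>b. wedge F 4 x a b)) = con (E 2 x) (\<lambda>a. con (E 4 x) (\<lambda>b. orient x * wedge F 4 x a b))"
    by (simp only: )
  then show ?thesis by (simp only: con_simps con_wedge[OF x]) simp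
qed

text \<open>The wedge product applied to \<open>t\<close> is \<open>F 1\<close> times the pairing of
  \<open>t\<close> with \<open>E i\<close>, minus \<open>F i\<close> times that with
  \<open>E 1\<close>; contraction with \<open>E 2\<close> leaves only the former.\<close>

lemma form_apply_zero:
  assumes x: "x \<in> V" and i: "i = 3 \<or> i = 4"
    and z: "\<And>a. (\<Sum>b\<in>UNIV. \<Sum>c\<in>UNIV. wedge F i x a b * ginv g x b c * t c) = 0"
  shows "con (E i x) t = 0"
proof -
  have c: "(\<Sum>b\<in>UNIV. \<Sum>c\<in>UNIV. F k b x * ginv g x b c * t c) = con (E k x) t" for k
    unfolding con_def raise_def sum_distrib_right by (subst sum.swap) (simp add: ginv_sym[OF x] ac_simps)
  have "F 1 a x * con (E i x) t - F i a x * con (E 1 x) t = 0" for a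
    using z[of a] unfolding c[symmetric] wedge_def sum_distrib_left
    by (simp add: sum_subtractf algebra_simps)
  then have "con (E 2 x) (\<lambda>a. F 1 a x * con (E i x) t - F i a x * con (E 1 x) t) = 0"
    by (simp add: con_simps)
  then show ?thesis using i by (auto simp: con_simps con_E_F[OF x])
qed

text \<open>The witness for the converse. It is parallel, for the derivative of \<open>F 3\<close>
  is a multiple of \<open>F 1\<close>, and so satisfies the Killing-Yano equation trivially.\<close>

definition A0 :: "real^4 \<Rightarrow> real^4^4" where
  "A0 x = (\<chi> a b. wedge F 3 x a b)"

lemma A0_nth: "A0 x $ a $ b = wedge F 3 x a b"
  by (simp add: A0_def)

lemma killing_yano_A0: "killing_yano V g A0"
  unfolding killing_yano_def two_form_on_def
proof (intro conjI ballI allI)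
  show "smooth_on V A0"
    unfolding A0_def[abs_def] wedge_def by (intro smooth_intros_vec_lambda smooth_intros smooth_F open_U)
  show "A0 x $ a $ b = - A0 x $ b $ a" for x a b by (simp add: A0_nth wedge_def)
  fix x a b c assume x: "x \<in> V"
  have "nabla g A0 x c a b = 0" for c a b
    unfolding nabla_cov2 A0_nth wedge_def cov2_wedge[OF x] by (simp add: cov_F1[OF x] cov_F3[OF x])
  then show "nabla g A0 x a b c + nabla g A0 x b a c = 0" by simp
qed

text \<open>Both two-forms share the null form \<open>F 1\<close>, to which \<open>F 3\<close> and
  \<open>F 4\<close> are orthogonal; every term of the product contains one of these vanishing
  products.\<close>

lemma wedge_product:
  assumes x: "x \<in> V" and ij: "i = 3 \<or> i = 4" "j = 3 \<or> j = 4"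
  shows "(\<Sum>a\<in>UNIV. \<Sum>b\<in>UNIV. \<Sum>c\<in>UNIV. \<Sum>d\<in>UNIV. ginv g x a c * ginv g x b d * wedge F i x a b * wedge F j x c d) = 0"
proof -
  have "(\<Sum>a\<in>UNIV. \<Sum>b\<in>UNIV. \<Sum>c\<in>UNIV. \<Sum>d\<in>UNIV. ginv g x a c * ginv g x b d * wedge F i x a b * wedge F j x c d)
    = (\<Sum>a\<in>UNIV. \<Sum>b\<in>UNIV. wedge F i x a b * (E 1 x a * E j x b - E j x a * E 1 x b))"
    unfolding raise_wedge[of x _ _ j, symmetric] sum_distrib_left by (simp add: ac_simps)
  also have "\<dots> = con (E 1 x) (\<lambda>a. con (E j x) (\<lambda>b. wedge F i x a b)) - con (E j x) (\<lambda>a. con (E 1 x) (\<lambda>b. wedge F i x a b))"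
    by (simp add: con_def sum_distrib_left sum_subtractf algebra_simps)
  also have "\<dots> = 0" using ij by (auto simp: con_wedge[OF x])
  finally show ?thesis .
qed

lemma null_form_A0: "null_form V g w A0"
  unfolding null_form_def
proof (intro ballI conjI)
  fix x assume x: "x \<in> V"
  show "A0 x \<noteq> 0"
  proof
    assume "A0 x = 0"
    then have "wedge F 3 x a b = 0" for a b using A0_nth[of x a b] by simp
    then have "con (E 2 x) (\<lambda>a. con (E 3 x) (\<lambda>b. wedge F 3 x a b)) = 0" by (simp add: con_simps)
    then show False by (simp add: con_wedge[OF x])
  qed
  let ?G = "\<lambda>a b c d. ginv g x a c * ginv g x b d" and ?f = "\<lambda>a b. form_sd g w A0 x $ a $ b"
  define k where "k = complex_of_real (1 / sqrt 2)"
  define m where "m = - \<i> * complex_of_real (orient x / sqrt 2)"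
  have f: "?f a b = complex_of_real (wedge F 3 x a b) * k + complex_of_real (wedge F 4 x a b) * m" for a b
    unfolding form_sd_wedge(2)[of x A0, OF x A0_nth] k_def m_def by (simp add: complex_eq_iff)
  let ?T = "\<lambda>i j. \<Sum>a\<in>UNIV. \<Sum>b\<in>UNIV. \<Sum>c\<in>UNIV. \<Sum>d\<in>UNIV. ?G a b c d * wedge F i x a b * wedge F j x c d"
  have "complex_of_real (?G a b c d) * ?f a b * ?f c d
      = complex_of_real (?G a b c d * wedge F 3 x a b * wedge F 3 x c d) * (k * k)
      + complex_of_real (?G a b c d * wedge F 3 x a b * wedge F 4 x c d) * (k * m)
      + complex_of_real (?G a b c d * wedge F 4 x a b * wedge F 3 x c d) * (k * m)
      + complex_of_real (?G a b c d * wedge F 4 x a b * wedge F 4 x c d) * (m * m)" for a b c d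
    unfolding f by (simp add: algebra_simps)
  then have "(\<Sum>a\<in>UNIV. \<Sum>b\<in>UNIV. \<Sum>c\<in>UNIV. \<Sum>d\<in>UNIV. complex_of_real (?G a b c d) * ?f a b * ?f c d)
     = complex_of_real (?T 3 3) * (k * k) + complex_of_real (?T 3 4) * (k * m)
      + complex_of_real (?T 4 3) * (k * m) + complex_of_real (?T 4 4) * (m * m)"
    by (simp only: sum.distrib sum_distrib_right of_real_sum)
  then show "(\<Sum>a\<in>UNIV. \<Sum>b\<in>UNIV. \<Sum>c\<in>UNIV. \<Sum>d\<in>UNIV. complex_of_real (?G a b c d) * ?f a b * ?f c d) = 0"
    by (simp only: wedge_product[OF x] simp_thms) simp
qed

lemma pure_radiation_A0: "pure_radiation V g w A0"
  unfolding pure_radiation_def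
proof (intro exI conjI ballI allI)
  show "smooth_on V (\<lambda>x. hh 3 3 x + hh 4 4 x)" by (intro smooth_on_add open_U smooth_hh)
  fix x assume x: "x \<in> V"
  let ?l = "\<lambda>x. \<chi> a. F 1 a x"
  show "ricci g x a b = (hh 3 3 x + hh 4 4 x) * ?l x $ a * ?l x $ b" for a b
    by (simp add: ricci_pp[OF x])
  \<comment> \<open>These are the factors of m = (p - i \<open>orient\<close> q) / sqrt 2; the
    normalization of m with its conjugate is a sum of two halves.\<close>
  define c where "c = 1 / sqrt 2"
  define d where "d = - orient x / sqrt 2"
  have cd: "c * c = 1 / 2" "d * d = 1 / 2"
    using orient_square[OF x] by (simp_all add: c_def d_def)
  let ?m = "\<chi> a. Complex (c * F 3 a x) (d * F 4 a x)"
  have L: "(\<chi> a. complex_of_real (?l x $ a)) = (\<chi> a. Complex (F 1 a x) 0)" by (simp add: vec_eq_iff complex_eq_iff)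
  have m': "(\<chi> a. cnj (?m $ a)) = (\<chi> a. Complex (c * F 3 a x) (- (d * F 4 a x)))" by (simp add: vec_eq_iff complex_eq_iff)
  have b: "ipx g x (\<lambda>a. F i a x) (\<lambda>a. F j a x) = nullm i j" for i j
    using ip_F[OF x, of i j] by (simp add: ip_ipx)
  have z: "ipx g x (\<lambda>a. 0) \<alpha> = 0" "ipx g x \<alpha> (\<lambda>a. 0) = 0" for \<alpha> by (simp_all add: ipx_def)
  show "fundamental_vector g w A0 x (?l x)"
    unfolding fundamental_vector_def Let_def
  proof (intro exI[of _ ?m] conjI allI)
    show "cinner_g g x (\<chi> a. complex_of_real (?l x $ a)) (\<chi> a. complex_of_real (?l x $ a)) = 0"
      "cinner_g g x ?m (\<chi> a. complex_of_real (?l x $ a)) = 0" "cinner_g g x ?m ?m = 0"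
      "cinner_g g x ?m (\<chi> a. cnj (?m $ a)) = 1"
      unfolding L m' cinner_g_Complex ipx_linear b z by (simp_all add: complex_eq_iff cd mult.assoc[symmetric])
    show "form_sd g w A0 x $ a $ b = (\<chi> a. complex_of_real (?l x $ a)) $ a * ?m $ b - (\<chi> a. complex_of_real (?l x $ a)) $ b * ?m $ a" for a b
      unfolding form_sd_wedge(2)[of x A0, OF x A0_nth] L
      by (simp add: complex_eq_iff wedge_def c_def d_def field_simps)
  qed
qed

end

section \<open>From pp-wave coordinates to a null frame\<close>

lemma (in spacetime_on) ip_of_metric:
  assumes x: "x \<in> U" and m: "\<And>a b. g x $ a $ b = - F 1 a x * F 2 b x - F 2 a x * F 1 b x + F 3 a x * F 3 b x + F 4 a x * F 4 b x"
  shows "ip g (F i) (F j) x = nullm i j"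
proof -
  define \<Theta> :: "real^4^4" where "\<Theta> = (\<chi> i a. F i a x)"
  define N :: "real^4^4" where "N = (\<chi> i j. nullm i j)"
  let ?G = "matrix_inv (g x)"
  have "(\<Sum>k\<in>UNIV. nullm i k * nullm k j) = (if i = j then 1 else 0)" for i j
    using exhaust_4[of i] exhaust_4[of j] by (elim disjE) (simp_all add: sum_4)
  then have NN: "N ** N = mat 1"
    by (simp add: N_def matrix_matrix_mult_def vec_eq_iff mat_def)
  \<comment> \<open>Inverting this congruence yields the matrix of products of the forms, because
    \<open>N\<close> is its own inverse.\<close>
  have "transpose \<Theta> ** N ** \<Theta> = g x"
    by (simp add: vec_eq_iff m \<Theta>_def N_def matrix_matrix_mult_def transpose_def sum_4)
  then have "(transpose \<Theta> ** N) ** (\<Theta> ** ?G) = mat 1"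
    using matrix_inv_right[OF invertible_g[OF x]] by (simp add: matrix_mul_assoc)
  then have "(\<Theta> ** ?G) ** (transpose \<Theta> ** N) = mat 1" by (simp add: matrix_left_right_inverse)
  then have "(\<Theta> ** ?G) ** (transpose \<Theta> ** N) ** N = N" by simp
  then have "\<Theta> ** ?G ** transpose \<Theta> ** (N ** N) = N" by (simp only: matrix_mul_assoc)
  then have "\<Theta> ** ?G ** transpose \<Theta> = N" by (simp add: NN)
  moreover have "ip g (F i) (F j) x = (\<Theta> ** ?G ** transpose \<Theta>) $ i $ j"
    unfolding ip_def ginv_def \<Theta>_def matrix_matrix_mult_def transpose_def
    by (subst sum.swap) (simp add: sum_distrib_left sum_distrib_right ac_simps)
  ultimately show ?thesis by (simp add: N_def)
qed

lemma pp_wave_pp_frame: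
  assumes st: "spacetime U g w" and VU: "V \<subseteq> U" and pp: "pp_wave_on V g u v \<xi> Hf"
  obtains F X Y H where "pp_frame V g w F u v X Y H"
proof -
  have co: "coordinates_on V (\<lambda>x. (u x, v x, \<xi> x))" and sHf: "smooth_on ((\<lambda>x. (u x, \<xi> x)) ` V) Hf"
    and metric: "\<forall>x\<in>V. \<forall>a b. complex_of_real (g x $ a $ b) =
        - complex_of_real (partial a u x * partial b v x + partial b u x * partial a v x)
        - complex_of_real (2 * Hf (u x, \<xi> x) * partial a u x * partial b u x)
        + (partial a \<xi> x * cnj (partial b \<xi> x) + partial b \<xi> x * cnj (partial a \<xi> x))"
    using pp by (simp_all add: pp_wave_on_def)
  have V: "open V" using co by (simp add: coordinates_on_def)
  have stV: "spacetime V g w" by (rule spacetime_subset[OF st V VU])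
  interpret spacetime_on V g w by unfold_locales (rule stV)
  have sP: "smooth_on V (\<lambda>x. (u x, v x, \<xi> x))" using co by (simp add: coordinates_on_def)
  have su: "smooth_on V u" using smooth_on_bounded_linear[OF bounded_linear_fst V sP] by simp
  have sv: "smooth_on V v"
    using smooth_on_bounded_linear[OF bounded_linear_fst V smooth_on_bounded_linear[OF bounded_linear_snd V sP]] by simp
  have s\<xi>: "smooth_on V \<xi>"
    using smooth_on_bounded_linear[OF bounded_linear_snd V smooth_on_bounded_linear[OF bounded_linear_snd V sP]] by simp
  define X where "X x = sqrt 2 * Re (\<xi> x)" for x
  define Y where "Y x = sqrt 2 * Im (\<xi> x)" for x
  define H where "H x = Hf (u x, \<xi> x)" for x
  have sX: "smooth_on V X" unfolding X_def[abs_def]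
    by (intro smooth_on_mult smooth_on_const V smooth_on_bounded_linear[OF bounded_linear_Re] s\<xi>)
  have sY: "smooth_on V Y" unfolding Y_def[abs_def]
    by (intro smooth_on_mult smooth_on_const V smooth_on_bounded_linear[OF bounded_linear_Im] s\<xi>)
  have sH: "smooth_on V H" unfolding H_def[abs_def]
    by (rule smooth_on_compose[OF V smooth_on_Pair[OF V su s\<xi>] sHf]) simp
  have pXY: "partial a X x = sqrt 2 * Re (partial a \<xi> x)" "partial a Y x = sqrt 2 * Im (partial a \<xi> x)" if "x \<in> V" for x a
  proof -
    have d: "\<xi> differentiable (at x)" by (rule smooth_on_differentiable[OF s\<xi> that])
    show "partial a X x = sqrt 2 * Re (partial a \<xi> x)" unfolding X_def[abs_def]
      by (rule partial_bounded_linear[OF bounded_linear_compose[OF bounded_linear_mult_right bounded_linear_Re] d])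
    show "partial a Y x = sqrt 2 * Im (partial a \<xi> x)" unfolding Y_def[abs_def]
      by (rule partial_bounded_linear[OF bounded_linear_compose[OF bounded_linear_mult_right bounded_linear_Im] d])
  qed
  define F :: "4 \<Rightarrow> 4 \<Rightarrow> real^4 \<Rightarrow> real" where
    "F i a x = (if i = 1 then partial a u x else if i = 2 then partial a v x + H x * partial a u x
       else if i = 3 then partial a X x else partial a Y x)" for i a x
  have F: "F 1 a = partial a u" "F 2 a = (\<lambda>x. partial a v x + H x * partial a u x)" "F 3 a = partial a X" "F 4 a = partial a Y" for a
    by (intro ext, simp add: F_def)+
  have g: "g x $ a $ b = - F 1 a x * F 2 b x - F 2 a x * F 1 b x + F 3 a x * F 3 b x + F 4 a x * F 4 b x" if x: "x \<in> V" for x a b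
  proof -
    have s2: "sqrt 2 * (sqrt 2 * t) = 2 * t" for t :: real by (simp add: mult.assoc[symmetric])
    have "g x $ a $ b = Re (complex_of_real (g x $ a $ b))" by simp
    also have "\<dots> = - (partial a u x * partial b v x + partial b u x * partial a v x) - 2 * H x * partial a u x * partial b u x
        + 2 * (Re (partial a \<xi> x) * Re (partial b \<xi> x) + Im (partial a \<xi> x) * Im (partial b \<xi> x))"
      unfolding metric[rule_format, OF x] H_def by (simp add: algebra_simps)
    finally show ?thesis unfolding F pXY[OF x] by (simp add: algebra_simps s2)
  qed
  have nf: "null_frame V g w F"
  proof
    show "smooth_on V (F i a)" for i a
    proof -
      have "smooth_on V (F 1 a)" "smooth_on V (F 2 a)" "smooth_on V (F 3 a)" "smooth_on V (F 4 a)"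
        unfolding F by (intro smooth_on_add smooth_on_mult smooth_on_partial su sv sX sY sH V)+
      then show ?thesis using exhaust_4[of i] by auto
    qed
    show "ip g (F i) (F j) x = nullm i j" if "x \<in> V" for x i j
      by (rule ip_of_metric[OF that]) (rule g[OF that])
  qed
  interpret N: null_frame V g w F by (rule nf)
  \<comment> \<open>Since \<open>Hf\<close> depends on u and \<xi> only, the derivative of
    \<open>H\<close> along \<open>E 1\<close> is a linear image of those of u and \<xi>. These
    vanish because \<open>F 1\<close> is orthogonal to itself, to \<open>F 3\<close> and to
    \<open>F 4\<close>.\<close>
  have H1: "con (N.E 1 x) (\<lambda>a. partial a H x) = 0" if x: "x \<in> V" for x
  proof -
    have d1: "((\<lambda>x. (u x, \<xi> x)) has_derivative (\<lambda>z. (frechet_derivative u (at x) z, frechet_derivative \<xi> (at x) z))) (at x)"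
      by (intro has_derivative_Pair smooth_on_has_derivative[OF su x] smooth_on_has_derivative[OF s\<xi> x])
    have d2: "(Hf has_derivative frechet_derivative Hf (at (u x, \<xi> x))) (at (u x, \<xi> x))"
      by (rule smooth_on_has_derivative[OF sHf]) (use x in auto)
    then interpret L: bounded_linear "frechet_derivative Hf (at (u x, \<xi> x))" by (rule has_derivative_bounded_linear)
    let ?L = "frechet_derivative Hf (at (u x, \<xi> x))" and ?e = "N.E 1 x"
    have "partial a H x = ?L (partial a u x, partial a \<xi> x)" for a
      unfolding H_def[abs_def] using partial_eqI[OF has_derivative_compose[OF d1 d2], of a] by (simp add: partial_def)
    then have "con ?e (\<lambda>a. partial a H x) = (\<Sum>a\<in>UNIV. ?e a * ?L (partial a u x, partial a \<xi> x))"
      by (simp add: con_def)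
    also have "\<dots> = ?L (\<Sum>a\<in>UNIV. ?e a *\<^sub>R (partial a u x, partial a \<xi> x))"
      by (simp only: L.sum L.scaleR real_scaleR_def)
    also have "(\<Sum>a\<in>UNIV. ?e a *\<^sub>R (partial a u x, partial a \<xi> x)) = 0"
    proof -
      have c: "con ?e (\<lambda>a. partial a u x) = 0" "con ?e (\<lambda>a. partial a X x) = 0" "con ?e (\<lambda>a. partial a Y x) = 0"
        using N.con_E_F[OF x, of 1 1] N.con_E_F[OF x, of 1 3] N.con_E_F[OF x, of 1 4] unfolding F by simp_all
      have "con ?e (\<lambda>a. Re (partial a \<xi> x)) = 0" "con ?e (\<lambda>a. Im (partial a \<xi> x)) = 0"
        using c(2,3) unfolding pXY[OF x] con_simps by simp_all
      then show ?thesis using c(1)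
        by (simp add: con_def prod_eq_iff fst_sum snd_sum complex_eq_iff)
    qed
    finally show ?thesis by (simp add: L.zero)
  qed
  have "pp_frame V g w F u v X Y H"
  proof (intro pp_frame.intro nf pp_frame_axioms.intro)
    show "con (N.E 1 x) (\<lambda>a. partial a H x) = 0" if "x \<in> V" for x by (rule H1[OF that])
  qed (simp_all add: F su sv sX sY sH)
  then show thesis by (rule that)
qed

section \<open>The plane wave criterion\<close>

context pp_frame
begin

lemma plane_wave_near_pp:
  assumes st: "spacetime U g w" and VU: "V \<subseteq> U" and p: "p \<in> V"
    and A: "\<And>x a b. x \<in> V \<Longrightarrow> A x $ a $ b = wedge F 3 x a b"
    and B: "\<And>x a b. x \<in> V \<Longrightarrow> hodge g w A x $ a $ b = wedge F 4 x a b"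
    and s: "smooth_on V \<phi>" and \<phi>: "\<And>x. x \<in> V \<Longrightarrow> \<phi> x = Complex ((hh 3 3 x - hh 4 4 x) / 2) (hh 3 4 x)"
    and 1: "\<And>x. x \<in> V \<Longrightarrow> form_apply g A (differential \<phi>) x = 0"
    and 2: "\<And>x. x \<in> V \<Longrightarrow> form_apply g (hodge g w A) (differential \<phi>) x = 0"
  shows "plane_wave_near U g p"
proof -
  obtain r S \<gamma> where ch: "pp_chart V g w F u v X Y H p r S \<gamma>" using pp_chart_exists[OF p] .
  interpret C: pp_chart V g w F u v X Y H p r S \<gamma> by (rule ch)
  \<comment> \<open>Real and imaginary parts of d\<phi> are tested separately; A yields the X
    direction and its dual the Y direction.\<close>
  have z: "con (E i x) (\<lambda>c. Re (partial c \<phi> x)) = 0" "con (E i x) (\<lambda>c. Im (partial c \<phi> x)) = 0"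
    if x: "x \<in> V" and i: "i = 3 \<or> i = 4" for x i
  proof -
    have e: "(\<Sum>b\<in>UNIV. \<Sum>c\<in>UNIV. complex_of_real (wedge F i x a b * ginv g x b c) * partial c \<phi> x) = 0" for a
      using arg_cong[OF 1[OF x], of "\<lambda>z. z $ a"] arg_cong[OF 2[OF x], of "\<lambda>z. z $ a"] i
      by (auto simp: form_apply_def differential_def A[OF x] B[OF x])
    show "con (E i x) (\<lambda>c. Re (partial c \<phi> x)) = 0"
      by (rule form_apply_zero[OF x i]) (use arg_cong[OF e, of Re] in simp)
    show "con (E i x) (\<lambda>c. Im (partial c \<phi> x)) = 0"
      by (rule form_apply_zero[OF x i]) (use arg_cong[OF e, of Im] in simp)
  qed
  have sS: "smooth_on S \<phi>" by (rule smooth_on_subset[OF s C.S(3)])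
  have SV: "x \<in> V" if "x \<in> S" for x using that C.S(3) by auto
  have "quadratic_on ((\<lambda>x. (u x, C.\<xi> x)) ` S) C.Hs"
  proof (rule C.quadratic_chart[of "\<lambda>x. Re (\<phi> x)" "\<lambda>x. Im (\<phi> x)"])
    show "smooth_on S (\<lambda>x. Re (\<phi> x))" "smooth_on S (\<lambda>x. Im (\<phi> x))"
      by (rule smooth_on_bounded_linear[OF bounded_linear_Re C.S(1) sS], rule smooth_on_bounded_linear[OF bounded_linear_Im C.S(1) sS])
    show "Re (\<phi> x) = (hh 3 3 x - hh 4 4 x) / 2" "Im (\<phi> x) = hh 3 4 x" if "x \<in> S" for x
      using \<phi>[OF SV[OF that]] by simp_all
    show "con (E i x) (\<lambda>c. partial c (\<lambda>x. Re (\<phi> x)) x) = 0" "con (E i x) (\<lambda>c. partial c (\<lambda>x. Im (\<phi> x)) x) = 0"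
      if "x \<in> S" "i = 3 \<or> i = 4" for x i
      using z[OF SV[OF that(1)] that(2)] smooth_on_differentiable[OF sS that(1)]
      by (simp_all add: partial_Re partial_Im)
  qed
  then show ?thesis
    unfolding plane_wave_near_def using C.pp_wave_chart C.S VU by blast
qed

end

section \<open>Uniqueness and gluing of the factor \<psi>\<close>

lemma form_sd_nonzero:
  assumes "A x \<noteq> 0"
  obtains a b where "form_sd g w A x $ a $ b \<noteq> 0"
proof -
  obtain a b where "A x $ a $ b \<noteq> 0" using assms by (metis vec_eq_iff zero_index)
  then have "Re (form_sd g w A x $ a $ b) \<noteq> 0" by (simp add: form_sd_def)
  then have "form_sd g w A x $ a $ b \<noteq> 0" by auto
  then show thesis by (rule that)
qed

text \<open>Evaluated at an index pair at which the self-dual form is nonzero, the tensor determines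
  its factor. Hence local factors glue, and any given \<psi> coincides with the locally computed
  one.\<close>

lemma weyl_factor_unique:
  fixes \<phi> \<psi> :: complex
  assumes "A x \<noteq> 0"
    and "\<And>a b c d. weyl_sd g w x a b c d = \<phi> * form_sd g w A x $ a $ b * form_sd g w A x $ c $ d"
    and "\<And>a b c d. weyl_sd g w x a b c d = \<psi> * form_sd g w A x $ a $ b * form_sd g w A x $ c $ d"
  shows "\<phi> = \<psi>"
proof -
  obtain a b where ab: "form_sd g w A x $ a $ b \<noteq> 0" using form_sd_nonzero[of A x g w, OF assms(1)] .
  show ?thesis using trans[OF assms(2)[of a b a b, symmetric] assms(3)[of a b a b]] ab by simp
qed

lemma local_structure:
  assumes st: "spacetime U g w" and ky: "null_killing_yano U g w A" and pr: "pure_radiation U g w A" and p: "p \<in> U"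
  obtains V F u v X Y H \<phi> where "open V" "p \<in> V" "V \<subseteq> U" "pp_frame V g w F u v X Y H"
    "\<forall>x\<in>V. \<forall>a b. A x $ a $ b = wedge F 3 x a b" "\<forall>x\<in>V. \<forall>a b. hodge g w A x $ a $ b = wedge F 4 x a b"
    "smooth_on V \<phi>"
    "\<forall>x\<in>V. \<phi> x = Complex ((pp_frame.hh g F H 3 3 x - pp_frame.hh g F H 4 4 x) / 2) (pp_frame.hh g F H 3 4 x)"
    "\<forall>x\<in>V. \<forall>a b c d. weyl_sd g w x a b c d = \<phi> x * form_sd g w A x $ a $ b * form_sd g w A x $ c $ d"
proof (rule null_killing_yano_pp_frame[OF assms])
  fix V F u v X Y H
  assume V: "open V" "p \<in> V" "V \<subseteq> U" and pp: "pp_frame V g w F u v X Y H"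
    and A: "\<And>x a b. x \<in> V \<Longrightarrow> A x $ a $ b = wedge F 3 x a b"
    and B: "\<And>x a b. x \<in> V \<Longrightarrow> hodge g w A x $ a $ b = wedge F 4 x a b"
  interpret pp_frame V g w F u v X Y H by (rule pp)
  define \<phi> where "\<phi> x = Complex ((hh 3 3 x - hh 4 4 x) / 2) (hh 3 4 x)" for x
  have "smooth_on V \<phi>"
    unfolding \<phi>_def[abs_def] by (intro smooth_on_Complex smooth_on_divide smooth_on_diff smooth_on_const smooth_hh open_U) simp
  moreover have "weyl_sd g w x a b c d = \<phi> x * form_sd g w A x $ a $ b * form_sd g w A x $ c $ d" if x: "x \<in> V" for x a b c d
    using weyl_sd_pp[of x A a b c d, OF x A[OF x]] orient_1[of x A, OF x A[OF x] B[OF x]]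
    by (simp add: \<psi>_def \<phi>_def)
  ultimately show thesis
    by (intro that[OF V pp, of \<phi>]) (simp_all add: A B \<phi>_def)
qed

theorem corollary1:
  fixes U :: "(real^4) set" and g :: "real^4 \<Rightarrow> real^4^4" and w :: "real^4 \<Rightarrow> real"
  assumes "spacetime U g w"
  shows
    "(\<forall>p\<in>U.
        (\<exists>V A. open V \<and> p \<in> V \<and> V \<subseteq> U \<and> null_killing_yano V g w A \<and> pure_radiation V g w A)
          \<longleftrightarrow> pp_wave_near U g p)
     \<and> (\<forall>A. null_killing_yano U g w A \<and> pure_radiation U g w A \<longrightarrow>
          (\<exists>\<psi>. smooth_on U \<psi> \<and>
             (\<forall>x\<in>U. \<forall>a b c d. weyl_sd g w x a b c d
                = \<psi> x * form_sd g w A x $ a $ b * form_sd g w A x $ c $ d))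
          \<and> (\<forall>\<psi>. smooth_on U \<psi> \<and>
               (\<forall>x\<in>U. \<forall>a b c d. weyl_sd g w x a b c d
                  = \<psi> x * form_sd g w A x $ a $ b * form_sd g w A x $ c $ d) \<and>
               (\<forall>x\<in>U. form_apply g A (differential \<psi>) x = 0 \<and>
                        form_apply g (hodge g w A) (differential \<psi>) x = 0)
             \<longrightarrow> (\<forall>p\<in>U. plane_wave_near U g p)))"
proof (intro conjI ballI allI impI iffI)
  fix p assume p: "p \<in> U"
  assume "\<exists>V A. open V \<and> p \<in> V \<and> V \<subseteq> U \<and> null_killing_yano V g w A \<and> pure_radiation V g w A"
  then obtain V A where V: "open V" "p \<in> V" "V \<subseteq> U" and A: "null_killing_yano V g w A" "pure_radiation V g w A"
    by auto
  show "pp_wave_near U g p"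
  proof (rule null_killing_yano_pp_frame[OF spacetime_subset[OF assms V(1,3)] A V(2)])
    fix V' F u v X Y H
    assume V': "V' \<subseteq> V" "p \<in> V'" and pp: "pp_frame V' g w F u v X Y H"
    obtain r S \<gamma> where ch: "pp_chart V' g w F u v X Y H p r S \<gamma>" using pp_frame.pp_chart_exists[OF pp V'(2)] .
    interpret C: pp_chart V' g w F u v X Y H p r S \<gamma> by (rule ch)
    have "S \<subseteq> U" using C.S(3) V' V by auto
    then show ?thesis unfolding pp_wave_near_def using C.pp_wave_chart C.S(2) by blast
  qed
next
  fix p assume "p \<in> U" "pp_wave_near U g p"
  then obtain V u v \<xi> Hf where V: "p \<in> V" "V \<subseteq> U" and pp: "pp_wave_on V g u v \<xi> Hf"
    unfolding pp_wave_near_def by auto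
  obtain F X Y H where "pp_frame V g w F u v X Y H" using pp_wave_pp_frame[OF assms V(2) pp] .
  then interpret pp_frame V g w F u v X Y H .
  have "null_killing_yano V g w A0" "pure_radiation V g w A0"
    using killing_yano_A0 null_form_A0 pure_radiation_A0 by (simp_all add: null_killing_yano_def)
  then show "\<exists>V A. open V \<and> p \<in> V \<and> V \<subseteq> U \<and> null_killing_yano V g w A \<and> pure_radiation V g w A"
    using open_U V by (intro exI[of _ V] exI[of _ A0]) simp
next
  fix A assume A: "null_killing_yano U g w A \<and> pure_radiation U g w A"
  let ?W = "\<lambda>x z. \<forall>a b c d. weyl_sd g w x a b c d = z * form_sd g w A x $ a $ b * form_sd g w A x $ c $ d"
  have A0: "A x \<noteq> 0" if "x \<in> U" for x using A that by (simp add: null_killing_yano_def null_form_def)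
  have loc: "\<exists>V \<phi>. open V \<and> p \<in> V \<and> V \<subseteq> U \<and> smooth_on V \<phi> \<and> (\<forall>x\<in>V. ?W x (\<phi> x))" if p: "p \<in> U" for p
  proof (rule local_structure[OF assms conjunct1[OF A] conjunct2[OF A] p])
    fix V F u v X Y H \<phi>
    assume "open V" "p \<in> V" "V \<subseteq> U" "smooth_on V \<phi>" "\<forall>x\<in>V. ?W x (\<phi> x)"
    then show ?thesis by (intro exI[of _ V] exI[of _ \<phi>]) simp
  qed
  \<comment> \<open>The factor exists near every point and is unique, so it can be defined
    pointwise; smoothness is inherited from the local factors.\<close>
  define \<psi> where "\<psi> x = (THE z. ?W x z)" for x
  have \<psi>: "\<psi> x = z" if "x \<in> U" "?W x z" for x z
    unfolding \<psi>_def
  proof (rule the_equality)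
    fix y assume y: "?W x y"
    show "y = z"
    proof (rule weyl_factor_unique[of A x g w, OF A0[OF that(1)]])
      show "weyl_sd g w x a b c d = y * form_sd g w A x $ a $ b * form_sd g w A x $ c $ d" for a b c d
        by (rule y[rule_format])
      show "weyl_sd g w x a b c d = z * form_sd g w A x $ a $ b * form_sd g w A x $ c $ d" for a b c d
        by (rule that(2)[rule_format])
    qed
  qed (rule that(2))
  have "smooth_on U \<psi>"
  proof (rule smooth_on_local)
    fix p assume "p \<in> U"
    obtain V \<phi> where V: "open V" "p \<in> V" "V \<subseteq> U" and \<phi>: "smooth_on V \<phi>" "\<forall>x\<in>V. ?W x (\<phi> x)"
      using loc[OF \<open>p \<in> U\<close>] by (elim exE conjE)
    have "\<psi> x = \<phi> x" if "x \<in> V" for x using \<psi>[of x "\<phi> x"] \<phi>(2) V(3) that by auto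
    then have "smooth_on V \<psi>" using smooth_on_cong[OF V(1), of \<psi> \<phi>] \<phi>(1) by simp
    then show "\<exists>T. open T \<and> p \<in> T \<and> smooth_on T \<psi>" using V by auto
  qed
  moreover have "?W x (\<psi> x)" if x: "x \<in> U" for x
  proof -
    obtain V \<phi> where "x \<in> V" "\<forall>x\<in>V. ?W x (\<phi> x)" using loc[OF x] by auto
    then have "?W x (\<phi> x)" by simp
    then show ?thesis unfolding \<psi>[OF x \<open>?W x (\<phi> x)\<close>] .
  qed
  ultimately show "\<exists>\<psi>. smooth_on U \<psi> \<and> (\<forall>x\<in>U. ?W x (\<psi> x))" by (intro exI[of _ \<psi>]) simp
next
  fix A \<psi> p
  assume A: "null_killing_yano U g w A \<and> pure_radiation U g w A" and p: "p \<in> U"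
    and \<psi>: "smooth_on U \<psi> \<and>
               (\<forall>x\<in>U. \<forall>a b c d. weyl_sd g w x a b c d
                  = \<psi> x * form_sd g w A x $ a $ b * form_sd g w A x $ c $ d) \<and>
               (\<forall>x\<in>U. form_apply g A (differential \<psi>) x = 0 \<and>
                        form_apply g (hodge g w A) (differential \<psi>) x = 0)"
  show "plane_wave_near U g p"
  proof (rule local_structure[OF assms conjunct1[OF A] conjunct2[OF A] p])
    fix V F u v X Y H \<phi>
    assume V: "open V" "p \<in> V" "V \<subseteq> U" and pp: "pp_frame V g w F u v X Y H"
      and AB: "\<forall>x\<in>V. \<forall>a b. A x $ a $ b = wedge F 3 x a b" "\<forall>x\<in>V. \<forall>a b. hodge g w A x $ a $ b = wedge F 4 x a b"
      and \<phi>: "\<forall>x\<in>V. \<phi> x = Complex ((pp_frame.hh g F H 3 3 x - pp_frame.hh g F H 4 4 x) / 2) (pp_frame.hh g F H 3 4 x)"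
        "\<forall>x\<in>V. \<forall>a b c d. weyl_sd g w x a b c d = \<phi> x * form_sd g w A x $ a $ b * form_sd g w A x $ c $ d"
    \<comment> \<open>By uniqueness the given \<psi> is the explicit combination of second
      derivatives of \<open>H\<close>, so the hypothesis on its differential becomes one on third
      derivatives of \<open>H\<close>.\<close>
    have "\<psi> x = \<phi> x" if x: "x \<in> V" for x
    proof (rule weyl_factor_unique[of A x g w])
      have xU: "x \<in> U" using x V(3) by auto
      show "A x \<noteq> 0" using A xU by (simp add: null_killing_yano_def null_form_def)
      show "weyl_sd g w x a b c d = \<psi> x * form_sd g w A x $ a $ b * form_sd g w A x $ c $ d" for a b c d
        using \<psi> xU by simp
      show "weyl_sd g w x a b c d = \<phi> x * form_sd g w A x $ a $ b * form_sd g w A x $ c $ d" for a b c d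
        using \<phi>(2) x by simp
    qed
    then show ?thesis
      using V AB \<phi>(1) \<psi> smooth_on_subset[of U \<psi> V]
      by (intro pp_frame.plane_wave_near_pp[OF pp assms V(3,2), of A \<psi>]) auto
  qed
qed

end
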